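(* Suppose $\kappa\geq\omega_1$ is a cardinal such that $\kappa^{<\kappa}=\kappa$. Then the forcing axiom \[\mathrm{FA}_{\kappa^+}(\{\mathbb{P}\mid\mathbb{P}\text{ is }\kappa\text{-lattice and }\kappa\text{-}\mathsf{MRP}\text{-strongly proper}\})\] is false.
   Context: The base theory is $\mathsf{ZFC}$. In a forcing notion, $q\le p$ means that $q$ extends (is stronger than) $p$. For a class $\Gamma$ of forcing notions and a cardinal $\lambda$, $\mathrm{FA}_\lambda(\Gamma)$ is the assertion that for every $\mathbb{P}\in\Gamma$ and every collection $\{D_\alpha\mid\alpha<\lambda\}$ of dense subsets of $\mathbb{P}$ there is a filter $G\subseteq\mathbb{P}$ such that $G\cap D_\alpha\ne\varnothing$ for all $\alpha<\lambda$. A forcing is $\kappa$-lattice if every set of size less than $\kappa$ of pairwise compatible conditions has a greatest lower bound. A set $M$ is $\kappa$-closed if for every $\alpha<\kappa$, every function $f\colon\alpha\to M$ belongs to $M$. Given a model $M$ and a set $X\in M$, a set $S\subseteq[X]^\kappa$ is an $M$-stationary subset of $[X]^\kappa$ if for every function $F\colon[X]^{<\omega}\to X$ with $F\in M$ there is some $N\in S\cap M$ such that $F``[N]^{<\omega}\subseteq N$. A forcing $\mathbb{P}$ is $\kappa$-$\mathsf{MRP}$-strongly proper if for every large enough $\theta$, every $\kappa$-closed $M\prec H(\theta)$ of size $\kappa$ such that $\mathbb{P}\in M$, and every $p\in\mathbb{P}\cap M$ there is $q\le p$ such that for every $q'\le q$, the set $\mathcal{X}_{q'}$ of all $X\in[\mathbb{P}\cap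 M]^\kappa$ for which there is $\pi_X(q')\in\mathbb{P}\cap X$ such that every $r\in X$ with $r\le\pi_X(q')$ is compatible with $q'$ in $\mathbb{P}$, is an $M$-stationary subset of $[\mathbb{P}]^\kappa$. *)

theory Defs
  imports Main "HOL-Library.Equipollence"
begin

text \<open>A type of class \<open>zfc_universe\<close> is a universe of sets: \<open>elts x\<close> is the extension of the set \<open>x\<close>.
  The class parameters of the separation and replacement schemes are arbitrary HOL predicates and
  functions. Consequently every HOL subset of \<open>elts x\<close> is the extension of a set, and
  equipollence of extensions is the same as the existence of a bijection inside the universe.\<close>

class zfc_universe =
  fixes elts :: "'a \<Rightarrow> 'a set"
  assumes ZFC_extensionality: "elts x = elts y \<Longrightarrow> x = y"
    and ZFC_foundation: "elts x \<noteq> {} \<Longrightarrow> \<exists>y\<in>elts x. elts y \<inter> elts x = {}"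
    and ZFC_pairing: "\<exists>z. elts z = {x, y}"
    and ZFC_union: "\<exists>z. elts z = (\<Union>y\<in>elts x. elts y)"
    and ZFC_powerset: "\<exists>z. elts z = {y. elts y \<subseteq> elts x}"
    and ZFC_infinity: "\<exists>z. (\<exists>e\<in>elts z. elts e = {}) \<and>
                     (\<forall>x\<in>elts z. \<exists>y\<in>elts z. elts y = insert x (elts x))"
    and ZFC_separation: "\<exists>z. elts z = {y \<in> elts x. Q y}"
    and ZFC_replacement: "\<exists>z. elts z = f ` elts x"
    and ZFC_choice: "\<lbrakk>\<forall>y\<in>elts x. elts y \<noteq> {};
                  \<forall>y\<in>elts x. \<forall>z\<in>elts x. y \<noteq> z \<longrightarrow> elts y \<inter> elts z = {}\<rbrakk>
                 \<Longrightarrow> \<exists>c. \<forall>y\<in>elts x. \<exists>!z. z \<in> elts c \<inter> elts y"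


section \<open>Sets, functions, cardinals\<close>

text \<open>Only meaningful if \<open>X\<close> is the extension of a set.\<close>

definition vset :: "'v::zfc_universe set \<Rightarrow> 'v"
  where "vset X = (THE x. elts x = X)"

definition opair :: "'v::zfc_universe \<Rightarrow> 'v \<Rightarrow> 'v"
  where "opair x y = vset {vset {x}, vset {x, y}}"

definition funs :: "'v::zfc_universe \<Rightarrow> 'v \<Rightarrow> 'v set"
  where "funs a b = {vset ((\<lambda>x. opair x (g x)) ` elts a) | g. g ` elts a \<subseteq> elts b}"

definition app :: "'v::zfc_universe \<Rightarrow> 'v \<Rightarrow> 'v"
  where "app f x = (THE y. opair x y \<in> elts f)"

definition transitive_set :: "'v::zfc_universe \<Rightarrow> bool"
  where "transitive_set x \<longleftrightarrow> (\<forall>y\<in>elts x. elts y \<subseteq> elts x)"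

definition Ord :: "'v::zfc_universe \<Rightarrow> bool"
  where "Ord x \<longleftrightarrow> transitive_set x \<and> (\<forall>y\<in>elts x. transitive_set y)"

definition Card :: "'v::zfc_universe \<Rightarrow> bool"
  where "Card \<kappa> \<longleftrightarrow> Ord \<kappa> \<and> (\<forall>\<alpha>\<in>elts \<kappa>. elts \<alpha> \<prec> elts \<kappa>)"

definition omega :: "'v::zfc_universe"
  where "omega = vset {n. Ord n \<and> finite (elts n)}"

text \<open>For ordinals, \<open>\<alpha> \<le> \<beta>\<close> is written \<open>elts \<alpha> \<subseteq> elts \<beta>\<close>, and \<open>\<alpha> < \<beta>\<close> is \<open>\<alpha> \<in> elts \<beta>\<close>.\<close>

definition card_succ :: "'v::zfc_universe \<Rightarrow> 'v"
  where "card_succ \<kappa> = (THE \<mu>. Card \<mu> \<and> \<kappa> \<in> elts \<mu> \<and>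
                              (\<forall>\<nu>. Card \<nu> \<and> \<kappa> \<in> elts \<nu> \<longrightarrow> elts \<mu> \<subseteq> elts \<nu>))"

text \<open>\<open>[A]\<^sup>\<kappa>\<close> and \<open>[x]\<^sup><\<^sup>\<omega>\<close>; the latter is a set since it is the domain of functions.\<close>

definition subsets_of_size :: "'v::zfc_universe set \<Rightarrow> 'v \<Rightarrow> 'v set"
  where "subsets_of_size A \<kappa> = {N. elts N \<subseteq> A \<and> elts N \<approx> elts \<kappa>}"

definition finite_subsets :: "'v::zfc_universe \<Rightarrow> 'v"
  where "finite_subsets x = vset {a. elts a \<subseteq> elts x \<and> finite (elts a)}"


section \<open>Elementary submodels of \<open>H(\<theta>)\<close>\<close>

definition trcl :: "'v::zfc_universe \<Rightarrow> 'v set"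
  where "trcl x = {y. (y, x) \<in> {(u, w). u \<in> elts w}\<^sup>+}"

definition H :: "'v::zfc_universe \<Rightarrow> 'v set"
  where "H \<theta> = {x. trcl x \<prec> elts \<theta>}"

datatype fm = Mem nat nat | Eq nat nat | Neg fm | Conj fm fm | Exists nat fm

primrec sat :: "'v::zfc_universe set \<Rightarrow> (nat \<Rightarrow> 'v) \<Rightarrow> fm \<Rightarrow> bool" where
  "sat A s (Mem i j) \<longleftrightarrow> s i \<in> elts (s j)"
| "sat A s (Eq i j) \<longleftrightarrow> s i = s j"
| "sat A s (Neg \<phi>) \<longleftrightarrow> \<not> sat A s \<phi>"
| "sat A s (Conj \<phi> \<psi>) \<longleftrightarrow> sat A s \<phi> \<and> sat A s \<psi>"
| "sat A s (Exists i \<phi>) \<longleftrightarrow> (\<exists>x\<in>A. sat A (s(i := x)) \<phi>)"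

definition elementary_submodel :: "'v::zfc_universe set \<Rightarrow> 'v set \<Rightarrow> bool"
  where "elementary_submodel A B \<longleftrightarrow> A \<subseteq> B \<and> (\<forall>\<phi> s. range s \<subseteq> A \<longrightarrow> (sat A s \<phi> \<longleftrightarrow> sat B s \<phi>))"

definition closed_model :: "'v::zfc_universe \<Rightarrow> 'v \<Rightarrow> bool"
  where "closed_model \<kappa> M \<longleftrightarrow> (\<forall>\<alpha>\<in>elts \<kappa>. funs \<alpha> M \<subseteq> elts M)"

definition M_stationary :: "'v::zfc_universe \<Rightarrow> 'v \<Rightarrow> 'v \<Rightarrow> 'v set \<Rightarrow> bool"
  where "M_stationary M \<kappa> X S \<longleftrightarrow> S \<subseteq> subsets_of_size (elts X) \<kappa> \<and>
    (\<forall>F \<in> funs (finite_subsets X) X \<inter> elts M.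
       \<exists>N \<in> S \<inter> elts M. app F ` elts (finite_subsets N) \<subseteq> elts N)"


section \<open>Forcing\<close>

text \<open>A forcing notion is a single set: the ordered pair of its set of conditions and its preorder.\<close>

definition vfst :: "'v::zfc_universe \<Rightarrow> 'v"
  where "vfst P = (THE A. \<exists>R. P = opair A R)"

definition vsnd :: "'v::zfc_universe \<Rightarrow> 'v"
  where "vsnd P = (THE R. \<exists>A. P = opair A R)"

abbreviation conds :: "'v::zfc_universe \<Rightarrow> 'v set"
  where "conds P \<equiv> elts (vfst P)"

text \<open>\<open>fle P q p\<close>: the condition \<open>q\<close> extends \<open>p\<close>.\<close>

definition fle :: "'v::zfc_universe \<Rightarrow> 'v \<Rightarrow> 'v \<Rightarrow> bool"
  where "fle P q p \<longleftrightarrow> opair q p \<in> elts (vsnd P)"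

definition forcing_notion :: "'v::zfc_universe \<Rightarrow> bool"
  where "forcing_notion P \<longleftrightarrow> (\<exists>A R. P = opair A R \<and> elts A \<noteq> {} \<and>
    elts R \<subseteq> {opair q p | q p. q \<in> elts A \<and> p \<in> elts A} \<and>
    preorder_on (elts A) {(q, p). opair q p \<in> elts R})"

definition compat :: "'v::zfc_universe \<Rightarrow> 'v \<Rightarrow> 'v \<Rightarrow> bool"
  where "compat P p q \<longleftrightarrow> (\<exists>r\<in>conds P. fle P r p \<and> fle P r q)"

definition dense_in :: "'v::zfc_universe \<Rightarrow> 'v set \<Rightarrow> bool"
  where "dense_in P D \<longleftrightarrow> D \<subseteq> conds P \<and> (\<forall>p\<in>conds P. \<exists>d\<in>D. fle P d p)"

definition filter_on :: "'v::zfc_universe \<Rightarrow> 'v set \<Rightarrow> bool"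
  where "filter_on P G \<longleftrightarrow> G \<subseteq> conds P \<and> G \<noteq> {} \<and>
    (\<forall>q\<in>G. \<forall>p\<in>conds P. fle P q p \<longrightarrow> p \<in> G) \<and>
    (\<forall>p\<in>G. \<forall>q\<in>G. \<exists>r\<in>G. fle P r p \<and> fle P r q)"

definition FA :: "'v::zfc_universe \<Rightarrow> 'v set \<Rightarrow> bool"
  where "FA \<mu> \<Gamma> \<longleftrightarrow> (\<forall>P\<in>\<Gamma>. \<forall>D :: 'v \<Rightarrow> 'v set.
    (\<forall>\<alpha>\<in>elts \<mu>. dense_in P (D \<alpha>)) \<longrightarrow>
    (\<exists>G. filter_on P G \<and> (\<forall>\<alpha>\<in>elts \<mu>. G \<inter> D \<alpha> \<noteq> {})))"

definition greatest_lower_bound :: "'v::zfc_universe \<Rightarrow> 'v set \<Rightarrow> 'v \<Rightarrow> bool"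
  where "greatest_lower_bound P S g \<longleftrightarrow> g \<in> conds P \<and> (\<forall>s\<in>S. fle P g s) \<and>
    (\<forall>h\<in>conds P. (\<forall>s\<in>S. fle P h s) \<longrightarrow> fle P h g)"

definition lattice_forcing :: "'v::zfc_universe \<Rightarrow> 'v \<Rightarrow> bool"
  where "lattice_forcing \<kappa> P \<longleftrightarrow> (\<forall>S. S \<subseteq> conds P \<and> S \<prec> elts \<kappa> \<and>
    (\<forall>p\<in>S. \<forall>q\<in>S. compat P p q) \<longrightarrow> (\<exists>g. greatest_lower_bound P S g))"

text \<open>The set of all \<open>X \<in> [P \<inter> M]\<^sup>\<kappa>\<close> admitting a projection of \<open>q\<close> to \<open>X\<close>.\<close>

definition projection_sets :: "'v::zfc_universe \<Rightarrow> 'v \<Rightarrow> 'v \<Rightarrow> 'v \<Rightarrow> 'v set"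
  where "projection_sets \<kappa> P M q = {X \<in> subsets_of_size (conds P \<inter> elts M) \<kappa>.
    \<exists>w \<in> conds P \<inter> elts X. \<forall>r\<in>elts X. fle P r w \<longrightarrow> compat P r q}"

definition MRP_strongly_proper :: "'v::zfc_universe \<Rightarrow> 'v \<Rightarrow> bool"
  where "MRP_strongly_proper \<kappa> P \<longleftrightarrow> (\<exists>\<theta>\<^sub>0. Card \<theta>\<^sub>0 \<and> (\<forall>\<theta>. Card \<theta> \<and> elts \<theta>\<^sub>0 \<subseteq> elts \<theta> \<longrightarrow>
    (\<forall>M. closed_model \<kappa> M \<and> elementary_submodel (elts M) (H \<theta>) \<and>
         elts M \<approx> elts \<kappa> \<and> P \<in> elts M \<longrightarrow>
      (\<forall>p \<in> conds P \<inter> elts M. \<exists>q\<in>conds P. fle P q p \<and>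
        (\<forall>q'\<in>conds P. fle P q' q \<longrightarrow>
           M_stationary M \<kappa> (vfst P) (projection_sets \<kappa> P M q'))))))"

end

theory Submission
  imports Defs
begin

text \<open>
  Let \<open>S\<close> be the set of ordinals below \<open>\<kappa>\<^sup>+\<close> of cofinality \<open>\<kappa>\<close>. Given a ladder \<open>c \<delta>\<close>
  (cofinal of order type \<open>\<kappa>\<close>) for each \<open>\<delta>\<close> in \<open>S\<close>, consider the conditions \<open>(a, b)\<close> where \<open>a\<close> and
  \<open>b\<close> have size less than \<open>\<kappa>\<close>, \<open>a\<close> is a set of ordinals below \<open>\<kappa>\<^sup>+\<close>, and \<open>b\<close> is a set of closed
  intervals and tails of ladders that are disjoint from \<open>a\<close>. Pairwise compatible conditions have
  their union as greatest lower bound. For a \<open>\<kappa>\<close>-closed model \<open>M\<close> with supremum \<open>\<delta>\<close>, adding the point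
  \<open>\<delta>\<close> to a condition prevents later intervals from crossing \<open>\<delta>\<close>; a condition \<open>q\<close> containing \<open>\<delta>\<close>
  then reduces to the set of conditions below \<open>\<gamma>\<close> for every sufficiently large \<open>\<gamma> < \<delta>\<close>, because each
  tail of a ladder in \<open>q\<close> has fewer than \<open>\<kappa>\<close> points below \<open>\<gamma>\<close>. So the forcing is
  \<open>\<kappa>\<close>-MRP-strongly proper, and the forcing axiom yields an unbounded \<open>E\<close> that contains each of its
  limit points \<open>\<delta>\<close> in \<open>S\<close> and meets \<open>c \<delta>\<close> in a bounded set. Since \<open>\<kappa>\<close> is uncountable this contradicts
  Shelah's club guessing: otherwise choose a decreasing sequence of clubs \<open>E n\<close> such that \<open>E (n + 1)\<close>
  avoids the ladders that are obtained from walks projected to \<open>E n\<close>; walks projected to the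
  intersection of all \<open>E n\<close> are eventually constant in \<open>n\<close> and end in that intersection.
\<close>

section \<open>Cardinal arithmetic\<close>

text \<open>One application of the forcing axiom handles one ladder system. The club guessing
  argument asks for countably many ladder systems in succession, each computed from the club
  obtained before, so a forcing is attached to every ladder system. The obstacle is properness. A
  model M is known to contain \<open>P\<close>, but not the ladders or the ordinals below
  \<open>\<kappa>\<^sup>+\<close>, and for an arbitrary cardinal \<theta> the structure
  \<open>H \<theta>\<close> is not known to satisfy any comprehension or replacement. Whatever M has
  to find must therefore be an element, or a subset of an element, of the transitive closure of
  \<open>P\<close>, and must be described by a formula that is absolute for transitive sets. This is
  why enumerations are hidden inside the code of the top condition. The hypothesis on powers of
  \<kappa> enters through the regularity of \<kappa> and through the count of conditions below a
  given \<gamma>. Uncountability of \<kappa> enters where countably many walk steps, or countably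
  many bounds below \<delta>, are collected.\<close>

context
  includes cardinal_syntax
begin

lemma lepoll_iff_card_of: "A \<lesssim> B \<longleftrightarrow> |A| \<le>o |B|"
  unfolding lepoll_def card_of_ordLeq[symmetric] by simp

lemma lesspoll_iff_card_of: "A \<prec> B \<longleftrightarrow> |A| <o |B|"
  unfolding lesspoll_def lepoll_iff_card_of eqpoll_iff_card_of_ordIso
  using ordLeq_iff_ordLess_or_ordIso not_ordLess_ordIso by blast

lemma not_lesspoll_iff: "\<not> A \<prec> B \<longleftrightarrow> B \<lesssim> A"
  unfolding lesspoll_iff_card_of lepoll_iff_card_of
  by (rule not_ordLess_iff_ordLeq) (rule card_of_Well_order)+

lemma lepoll_UN_infinite:
  assumes "infinite C" "I \<lesssim> C" "\<And>i. i \<in> I \<Longrightarrow> A i \<lesssim> C"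
  shows "(\<Union>i\<in>I. A i) \<lesssim> C"
  using assms card_of_UNION_ordLeq_infinite[of C I A] by (simp add: lepoll_iff_card_of)

lemma lepoll_Times_infinite:
  assumes "infinite C" "A \<lesssim> C" "B \<lesssim> C"
  shows "A \<times> B \<lesssim> C"
proof -
  have "C \<times> C \<lesssim> C"
    using card_of_Times_same_infinite[OF assms(1)] ordIso_imp_ordLeq by (simp add: lepoll_iff_card_of)
  then show ?thesis
    by (rule lepoll_trans[OF times_lepoll_mono[OF assms(2,3)]])
qed

lemma lepoll_Un_infinite:
  assumes "infinite C" "A \<lesssim> C" "B \<lesssim> C"
  shows "A \<union> B \<lesssim> C"
proof -
  have "(UNIV :: bool set) \<lesssim> C"
    by (rule finite_lepoll_infinite[OF assms(1)]) simp
  then have "(\<Union>i\<in>UNIV. if i then A else B) \<lesssim> C"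
    using assms by (intro lepoll_UN_infinite) auto
  then show ?thesis
    by (simp add: UNIV_bool Un_commute)
qed

lemma lesspoll_Un_infinite:
  assumes "infinite C" "A \<prec> C" "B \<prec> C"
  shows "A \<union> B \<prec> C"
  using assms card_of_Un_ordLess_infinite[of C A B] by (simp add: lesspoll_iff_card_of)

end

lemma lesspoll_Times_infinite:
  assumes C: "infinite C" and A: "A \<prec> C" and B: "B \<prec> C"
  shows "A \<times> B \<prec> C"
proof (cases "finite A \<and> finite B")
  case True
  then show ?thesis by (intro finite_lesspoll_infinite[OF C]) simp
next
  case False
  have "A \<lesssim> B \<or> B \<lesssim> A"
    using not_lesspoll_iff[of A B] lesspoll_imp_lepoll[of A B] by blast
  then show ?thesis
  proof
    assume AB: "A \<lesssim> B"
    then have "infinite B"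
      using False inj_on_finite AB unfolding lepoll_def by metis
    then have "A \<times> B \<lesssim> B"
      using AB lepoll_Times_infinite[of B A B] by simp
    then show ?thesis
      using B by (rule lesspoll_trans1)
  next
    assume BA: "B \<lesssim> A"
    then have "infinite A"
      using False inj_on_finite BA unfolding lepoll_def by metis
    then have "A \<times> B \<lesssim> A"
      using BA lepoll_Times_infinite[of A A B] by simp
    then show ?thesis
      using A by (rule lesspoll_trans1)
  qed
qed

text \<open>The order-theoretic content of \<kappa> and \<open>\<kappa>\<^sup>+\<close>, detached
  from the universe of sets. \<open>small_subsets_K\<close> carries the hypothesis on powers of
  \<kappa>; regularity of K is derived from it in \<open>K_regular\<close>.\<close>

locale regular_successor =
  fixes K L :: "'a::wellorder"
  assumes K_less_L: "K < L"
    and nat_lesspoll_K: "(UNIV::nat set) \<prec> {..<K}"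
    and K_initial: "x < K \<Longrightarrow> {..<x} \<prec> {..<K}"
    and small_subsets_K: "{X. X \<subseteq> {..<K} \<and> X \<prec> {..<K}} \<lesssim> {..<K}"
    and below_L: "x < L \<Longrightarrow> {..<x} \<lesssim> {..<K}"
    and L_regular: "\<lbrakk>X \<subseteq> {..<L}; X \<lesssim> {..<K}\<rbrakk> \<Longrightarrow> \<exists>b<L. X \<subseteq> {..<b}"
begin

abbreviation small :: "'b set \<Rightarrow> bool"
  where "small X \<equiv> X \<prec> {..<K}"

lemma infinite_K: "infinite {..<K}"
  using lesspoll_imp_lepoll[OF nat_lesspoll_K] unfolding infinite_le_lepoll .

lemma small_finite: "finite X \<Longrightarrow> small X"
  by (rule finite_lesspoll_infinite[OF infinite_K])

lemma small_countable:
  fixes f :: "nat \<Rightarrow> 'b"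
  shows "small (range f)"
  by (rule lesspoll_trans1[OF image_lepoll nat_lesspoll_K])

lemma small_image: "small X \<Longrightarrow> small (f ` X)"
  by (rule lesspoll_trans1[OF image_lepoll])

lemma small_subset: "\<lbrakk>small X; Y \<subseteq> X\<rbrakk> \<Longrightarrow> small Y"
  by (rule lesspoll_trans1[OF subset_imp_lepoll])

lemma small_Un: "\<lbrakk>small X; small Y\<rbrakk> \<Longrightarrow> small (X \<union> Y)"
  by (rule lesspoll_Un_infinite[OF infinite_K])

lemma small_insert: "small X \<Longrightarrow> small (insert x X)"
  using small_Un[of "{x}" X] small_finite[of "{x}"] by simp

lemma small_subsets_lepoll:
  assumes "A \<lesssim> {..<K}"
  shows "{X. X \<subseteq> A \<and> small X} \<lesssim> {..<K}"
proof -
  obtain f where f: "inj_on f A" "f ` A \<subseteq> {..<K}"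
    using assms unfolding lepoll_def by blast
  have "inj_on ((`) f) {X. X \<subseteq> A \<and> small X}"
    by (rule inj_on_subset[OF inj_on_image_Pow[OF f(1)]]) auto
  moreover have "(`) f ` {X. X \<subseteq> A \<and> small X} \<subseteq> {X. X \<subseteq> {..<K} \<and> small X}"
    using f(2) by (auto simp: small_image)
  ultimately have "{X. X \<subseteq> A \<and> small X} \<lesssim> {X. X \<subseteq> {..<K} \<and> small X}"
    unfolding lepoll_def by (intro exI conjI)
  then show ?thesis
    using small_subsets_K by (rule lepoll_trans)
qed

text \<open>Koenig's diagonal argument: an unbounded small subset of \<open>K\<close> would yield a small partial
  function on it that differs from every member of a given list of \<open>K\<close> many.\<close>

lemma K_regular:
  assumes X: "X \<subseteq> {..<K}" "small X"
  shows "\<exists>b<K. X \<subseteq> {..<b}"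
proof (rule ccontr)
  assume unb: "\<not> ?thesis"
  have "{Y. Y \<subseteq> {..<K} \<times> {..<K} \<and> small Y} \<lesssim> {..<K}"
    using infinite_K by (intro small_subsets_lepoll lepoll_Times_infinite) auto
  then obtain G where G: "{Y. Y \<subseteq> {..<K} \<times> {..<K} \<and> small Y} \<subseteq> G ` {..<K}"
    unfolding lepoll_iff by (elim exE)
  define v where "v j x = (SOME y. (x, y) \<in> G j)" for j x :: 'a
  have "\<exists>y<K. y \<notin> (\<lambda>j. v j x) ` {..x}" if "x < K" for x
  proof -
    have "{..x} = insert x {..<x}"
      by auto
    then have "small ((\<lambda>j. v j x) ` {..x})"
      by (simp add: small_image small_insert K_initial[OF that] del: image_insert)
    then have "\<not> {..<K} \<subseteq> (\<lambda>j. v j x) ` {..x}"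
      using not_lesspoll_iff subset_imp_lepoll by metis
    then show ?thesis by blast
  qed
  then obtain g where g: "\<And>x. x < K \<Longrightarrow> g x < K \<and> g x \<notin> (\<lambda>j. v j x) ` {..x}"
    by metis
  define Y where "Y = (\<lambda>x. (x, g x)) ` X"
  have "Y \<subseteq> {..<K} \<times> {..<K}"
    using g X unfolding Y_def by auto
  moreover have "small Y"
    unfolding Y_def by (rule small_image[OF X(2)])
  ultimately obtain j where j: "j < K" "Y = G j"
    using G by blast
  obtain x where x: "x \<in> X" "j \<le> x"
    using unb j(1) by force
  have "v j x = g x"
    unfolding v_def j(2)[symmetric] Y_def using x(1) by (auto intro!: some_equality)
  then show False
    using g[of x] x X(1) by force
qed

text \<open>By regularity a single \<open>c < K\<close> bounds the sizes of all \<open>A i\<close>,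
  so the union is an image of a subset of a product of two small sets.\<close>

lemma small_UN:
  assumes I: "small I" and A: "\<And>i. i \<in> I \<Longrightarrow> small (A i)"
  shows "small (\<Union>i\<in>I. A i)"
proof -
  have "\<exists>b<K. A i \<lesssim> {..<b}" if i: "i \<in> I" for i
  proof -
    obtain f where f: "inj_on f (A i)" "f ` A i \<subseteq> {..<K}"
      using lesspoll_imp_lepoll[OF A[OF i]] unfolding lepoll_def by blast
    then obtain b where "b < K" "f ` A i \<subseteq> {..<b}"
      using K_regular[OF f(2) small_image[OF A[OF i]]] by blast
    then show ?thesis
      using f(1) unfolding lepoll_def by auto
  qed
  then obtain b where b: "\<And>i. i \<in> I \<Longrightarrow> b i < K \<and> A i \<lesssim> {..<b i}"
    by metis
  then obtain c where c: "c < K" "b ` I \<subseteq> {..<c}"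
    using K_regular[OF _ small_image[OF I], of b] by blast
  have "A i \<lesssim> {..<c}" if "i \<in> I" for i
  proof -
    have "{..<b i} \<subseteq> {..<c}" using c(2) that by auto
    then show ?thesis using b[OF that] lepoll_trans[OF _ subset_imp_lepoll] by blast
  qed
  then have "Sigma I A \<lesssim> I \<times> {..<c}"
    by (intro Sigma_lepoll_mono) auto
  moreover have "(\<Union>i\<in>I. A i) = snd ` Sigma I A"
    by force
  ultimately show ?thesis
    using lesspoll_Times_infinite[OF infinite_K I K_initial[OF c(1)]]
      lesspoll_trans1[OF image_lepoll] lesspoll_trans1 by metis
qed

end

section \<open>Ladders and closure points\<close>

context regular_successor
begin

text \<open>Cofinality K is expressed by boundedness of small subsets, since below L a cofinality of
  at least K equals K. The empty set and the singletons exclude zero and successors.\<close>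

definition S :: "'a set"
  where "S = {\<delta>. \<delta> < L \<and> (\<forall>X. X \<subseteq> {..<\<delta>} \<and> small X \<longrightarrow> (\<exists>b<\<delta>. X \<subseteq> {..<b}))}"

lemma S_less: "\<delta> \<in> S \<Longrightarrow> \<delta> < L"
  by (simp add: S_def)

lemma S_bounded: "\<lbrakk>\<delta> \<in> S; X \<subseteq> {..<\<delta>}; small X\<rbrakk> \<Longrightarrow> \<exists>b<\<delta>. X \<subseteq> {..<b}"
  by (simp add: S_def)

lemma S_limit: "\<lbrakk>\<delta> \<in> S; x < \<delta>\<rbrakk> \<Longrightarrow> \<exists>b<\<delta>. x < b"
  using S_bounded[of \<delta> "{x}"] small_finite[of "{x}"] by auto

lemma L_limit: "x < L \<Longrightarrow> \<exists>b<L. x < b"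
  using L_regular[of "{x}"] finite_lepoll_infinite[OF infinite_K, of "{x}"] by auto

lemma not_S_small_cofinal:
  assumes "x < L" "x \<notin> S"
  shows "\<exists>X. X \<subseteq> {..<x} \<and> small X \<and> (\<forall>b<x. \<exists>y\<in>X. b \<le> y)"
  using assms unfolding S_def by force

text \<open>The ladder consists of the values that exceed all earlier ones in an enumeration of
  \<open>\<delta>\<close> in type \<open>K\<close>.\<close>

lemma cofinal_ladder:
  assumes "\<delta> < L"
  shows "\<exists>X. X \<subseteq> {..<\<delta>} \<and> (\<forall>b<\<delta>. \<exists>y\<in>X. b \<le> y) \<and> (\<forall>\<gamma><\<delta>. small (X \<inter> {..<\<gamma>}))"
proof -
  obtain g where g: "{..<\<delta>} \<subseteq> g ` {..<K}"
    using below_L[OF assms] unfolding lepoll_iff by blast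
  define X where "X = {g i | i. i < K \<and> g i < \<delta> \<and> (\<forall>j<i. g j < \<delta> \<longrightarrow> g j < g i)}"
  have "\<exists>y\<in>X. b \<le> y" if "b < \<delta>" for b
  proof -
    define P where "P i \<longleftrightarrow> i < K \<and> g i < \<delta> \<and> b \<le> g i" for i
    have "\<exists>i. P i" using g that unfolding P_def by force
    then have P: "P (LEAST i. P i)" by (rule LeastI_ex)
    have "g j < g (LEAST i. P i)" if "j < (LEAST i. P i)" "g j < \<delta>" for j
      using P not_less_Least[OF that(1)] that unfolding P_def by (meson leI less_le_trans less_trans)
    then have "g (LEAST i. P i) \<in> X" using P unfolding X_def P_def by blast
    then show ?thesis using P unfolding P_def by blast
  qed
  moreover have "small (X \<inter> {..<\<gamma>})" if "\<gamma> < \<delta>" for \<gamma>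
  proof -
    have "\<gamma> \<in> g ` {..<K}" using g that by auto
    then obtain i0 where i0: "i0 < K" "\<gamma> = g i0" by auto
    have "X \<inter> {..<\<gamma>} \<subseteq> g ` {..<i0}"
    proof
      fix y assume "y \<in> X \<inter> {..<\<gamma>}"
      then obtain i where i: "y = g i" "\<forall>j<i. g j < \<delta> \<longrightarrow> g j < g i" "g i < g i0"
        using i0 unfolding X_def by auto
      then have "\<not> i0 < i" "i \<noteq> i0" using that i0(2) by (auto dest: less_asym)
      then show "y \<in> g ` {..<i0}" using i(1) by auto
    qed
    then show ?thesis
      using small_image[OF K_initial[OF i0(1)], of g] small_subset by metis
  qed
  moreover have "X \<subseteq> {..<\<delta>}" unfolding X_def by auto
  ultimately show ?thesis by blast
qed

text \<open>The supremum of an increasing K-sequence whose terms exceed the values of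
  \<open>g\<close> at all earlier terms. As \<open>g\<close> is controlled only along the sequence,
  closure is stated for cofinally many arguments.\<close>

lemma S_closure_point:
  assumes g: "\<And>x. x < L \<Longrightarrow> g x < L" and \<beta>: "\<beta> < L"
  shows "\<exists>\<gamma>\<in>S. \<beta> < \<gamma> \<and> (\<forall>x<\<gamma>. \<exists>y<\<gamma>. x \<le> y \<and> g y < \<gamma>)"
proof -
  define R where "R h i r \<longleftrightarrow> r < L \<and> \<beta> < r \<and> (\<forall>j<i. h j < r \<and> g (h j) < r)" 
    for h :: "'a \<Rightarrow> 'a" and i r
  \<comment> \<open>The recursion runs over the whole type; from K onwards nothing is
    demanded.\<close>
  define R' where "R' h i r \<longleftrightarrow> (i < K \<longrightarrow> R h i r)" for h :: "'a \<Rightarrow> 'a" and i r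
  have "\<exists>h. \<forall>i. R' h i (h i)"
  proof (rule dependent_wf_choice[OF wf])
    fix i and h :: "'a \<Rightarrow> 'a"
    assume h: "\<And>j. (j, i) \<in> {(x, y). x < y} \<Longrightarrow> R' h j (h j)"
    show "\<exists>r. R' h i r"
    proof (cases "i < K")
      case True
      then have h': "h j < L" if "j < i" for j
        using h[of j] that unfolding R'_def R_def by auto
      define X where "X = insert \<beta> (h ` {..<i} \<union> (g \<circ> h) ` {..<i})"
      have "small X"
        unfolding X_def using K_initial[OF True] by (intro small_insert small_Un) (rule small_image, assumption)+
      moreover have "X \<subseteq> {..<L}"
        unfolding X_def using h' g \<beta> by auto
      ultimately obtain b where "b < L" "X \<subseteq> {..<b}"
        using L_regular lesspoll_imp_lepoll by blast
      then have "R' h i b" unfolding R'_def R_def X_def by auto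
      then show ?thesis ..
    qed (simp add: R'_def)
  qed (auto simp: R'_def R_def)
  then obtain h where "\<And>i. R' h i (h i)" by blast
  then have h: "\<And>i. i < K \<Longrightarrow> h i < L \<and> \<beta> < h i" "\<And>i j. \<lbrakk>i < K; j < i\<rbrakk> \<Longrightarrow> h j < h i \<and> g (h j) < h i"
    unfolding R'_def R_def by auto
  have "\<exists>b<L. h ` {..<K} \<subseteq> {..<b}"
    using h(1) by (intro L_regular image_lepoll) auto
  then have ex: "\<exists>b. b < L \<and> h ` {..<K} \<subseteq> {..<b}"
    by blast
  \<comment> \<open>The supremum of the sequence, which exists below L by regularity of L.\<close>
  define \<gamma> where "\<gamma> = (LEAST b. b < L \<and> h ` {..<K} \<subseteq> {..<b})"
  have \<gamma>: "\<gamma> < L" "h ` {..<K} \<subseteq> {..<\<gamma>}"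
    using LeastI_ex[OF ex] unfolding \<gamma>_def by auto
  have K_lim: "\<exists>j<K. i < j" if "i < K" for i
    using K_regular[of "{i}"] small_finite[of "{i}"] that by auto
  have cof: "\<exists>i<K. x < h i" if x: "x < \<gamma>" for x
  proof -
    have "\<not> h ` {..<K} \<subseteq> {..<x}"
      using x \<gamma>(1) not_less_Least[of x] unfolding \<gamma>_def by (metis (lifting) less_trans)
    then obtain i where i: "i < K" "x \<le> h i" by force
    then show ?thesis using K_lim[OF i(1)] h(2) by (metis le_less_trans)
  qed
  have "\<gamma> \<in> S"
    unfolding S_def
  proof (intro CollectI conjI allI impI)
    fix X assume X: "X \<subseteq> {..<\<gamma>} \<and> small X"
    then have "\<forall>x\<in>X. \<exists>i<K. x < h i" using cof by auto
    then obtain i where i: "\<And>x. x \<in> X \<Longrightarrow> i x < K \<and> x < h (i x)" by metis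
    then have "i ` X \<subseteq> {..<K}" by auto
    then obtain j where j: "j < K" "i ` X \<subseteq> {..<j}"
      using K_regular small_image X by metis
    have "X \<subseteq> {..<h j}"
    proof
      fix x assume "x \<in> X"
      then have "i x < j" "x < h (i x)" using i j(2) by auto
      then show "x \<in> {..<h j}" using h(2)[OF j(1)] less_trans by auto
    qed
    then show "\<exists>b<\<gamma>. X \<subseteq> {..<b}" using \<gamma>(2) j(1) by auto
  qed (rule \<gamma>(1))
  moreover have "\<beta> < \<gamma>"
  proof -
    have "{..<K} \<noteq> {}" using infinite_K by (metis finite.emptyI)
    then obtain i where "i < K" by auto
    then show ?thesis using h(1) \<gamma>(2) by (metis image_subset_iff lessThan_iff less_trans)
  qed
  moreover have "\<exists>y<\<gamma>. x \<le> y \<and> g y < \<gamma>" if x: "x < \<gamma>" for x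
  proof -
    obtain i where i: "i < K" "x < h i" using cof[OF x] by blast
    moreover obtain j where "j < K" "i < j" using K_lim i(1) by blast
    moreover have "h i < \<gamma>" "h j < \<gamma>" if "j < K" for j
      using \<gamma>(2) i(1) that by auto
    ultimately have "h i < \<gamma>" "g (h i) < \<gamma>"
      using h(2)[of j i] less_trans by blast+
    then show ?thesis using i by auto
  qed
  ultimately show ?thesis by blast
qed

end

section \<open>Club guessing\<close>

context regular_successor
begin

text \<open>The first conjunct excludes the least ordinal, for which the second is vacuous.\<close>

definition acc :: "'a set \<Rightarrow> 'a \<Rightarrow> bool"
  where "acc E x \<longleftrightarrow> E \<inter> {..<x} \<noteq> {} \<and> (\<forall>b<x. \<exists>y\<in>E. b < y \<and> y < x)"

definition club :: "'a set \<Rightarrow> bool"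
  where "club E \<longleftrightarrow> E \<subseteq> {..<L} \<and> (\<forall>x<L. \<exists>y\<in>E. x < y) \<and> (\<forall>x<L. acc E x \<longrightarrow> x \<in> E)"

definition ladder :: "'a \<Rightarrow> 'a set \<Rightarrow> bool"
  where "ladder \<delta> X \<longleftrightarrow> X \<subseteq> {..<\<delta>} \<and> (\<forall>b<\<delta>. \<exists>y\<in>X. b \<le> y) \<and> (\<forall>\<gamma><\<delta>. small (X \<inter> {..<\<gamma>}))"

text \<open>A closure point of a function that dominates the next-element functions of all
  \<open>A n\<close> is a limit point of every \<open>A n\<close>. Taking it from
  \<open>S_closure_point\<close> places it in \<open>S\<close>.\<close>

lemma club_Inter:
  fixes A :: "nat \<Rightarrow> 'a set"
  assumes A: "\<And>n. club (A n)" and \<beta>: "\<beta> < L"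
  shows "\<exists>\<gamma>\<in>S. \<beta> < \<gamma> \<and> (\<forall>n. \<gamma> \<in> A n)"
proof -
  have "\<forall>n x. \<exists>y. x < L \<longrightarrow> y \<in> A n \<and> x < y \<and> y < L"
    using A unfolding club_def by blast
  then obtain f where f: "\<And>n x. x < L \<Longrightarrow> f n x \<in> A n \<and> x < f n x \<and> f n x < L"
    by metis
  have "\<exists>b<L. (\<lambda>n. f n x) ` UNIV \<subseteq> {..<b}" if "x < L" for x
    using f[OF that] lesspoll_imp_lepoll[OF small_countable] by (intro L_regular) auto
  then obtain g where g: "\<And>x. x < L \<Longrightarrow> g x < L \<and> (\<forall>n. f n x < g x)"
    by (metis image_subset_iff lessThan_iff UNIV_I)
  obtain \<gamma> where \<gamma>: "\<gamma> \<in> S" "\<beta> < \<gamma>" "\<And>x. x < \<gamma> \<Longrightarrow> \<exists>y<\<gamma>. x \<le> y \<and> g y < \<gamma>"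
    using S_closure_point[of g \<beta>] g \<beta> by blast
  have 1: "\<exists>y\<in>A n. b < y \<and> y < \<gamma>" if b: "b < \<gamma>" for b n
  proof -
    obtain y where y: "y < \<gamma>" "b \<le> y" "g y < \<gamma>" using \<gamma>(3)[OF b] by blast
    then have "f n y \<in> A n" "y < f n y" "f n y < g y" using f g S_less[OF \<gamma>(1)] less_trans by blast+
    then show ?thesis using y less_trans le_less_trans by blast
  qed
  then have "acc (A n) \<gamma>" for n
    unfolding acc_def using \<gamma>(2) by blast
  then have "\<gamma> \<in> A n" for n
    using A[of n] S_less[OF \<gamma>(1)] unfolding club_def by blast
  then show ?thesis using \<gamma>(1,2) by blast
qed

lemma club_Int:
  assumes "club A" "club B"
  shows "club (A \<inter> B)"
proof -
  have "\<exists>y\<in>A \<inter> B. x < y" if x: "x < L" for x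
  proof -
    have "club (if n = 0 then A else B)" for n :: nat
      using assms by simp
    from club_Inter[of "\<lambda>n. if n = 0 then A else B", OF this x] obtain y where y: "x < y" "\<forall>n::nat. y \<in> (if n = 0 then A else B)"
      by blast
    show ?thesis using y(1) spec[OF y(2), of 0] spec[OF y(2), of 1] by auto
  qed
  moreover have "acc A x \<and> acc B x" if "acc (A \<inter> B) x" for x
    using that unfolding acc_def by blast
  ultimately show ?thesis
    using assms unfolding club_def by blast
qed

lemma acc_ex: "acc E x \<Longrightarrow> \<exists>y\<in>E. y < x"
  unfolding acc_def by auto

lemma acc_between: "\<lbrakk>acc E x; b < x\<rbrakk> \<Longrightarrow> \<exists>y\<in>E. b < y \<and> y < x"
  unfolding acc_def by blast

lemma acc_closure:
  assumes "acc (E \<union> {x. x < L \<and> acc E x}) x"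
  shows "acc E x"
proof -
  obtain z where "z \<in> E \<or> acc E z" "z < x"
    using acc_ex[OF assms] by blast
  then have "\<exists>y\<in>E. y < x"
    using acc_ex[of E z] less_trans by blast
  then have "E \<inter> {..<x} \<noteq> {}" by auto
  moreover have "\<exists>y\<in>E. b < y \<and> y < x" if b: "b < x" for b
  proof -
    obtain z where z: "z \<in> E \<or> acc E z" "b < z" "z < x"
      using acc_between[OF assms b] by blast
    then show ?thesis
      using acc_between[of E z b] less_trans by blast
  qed
  ultimately show ?thesis unfolding acc_def by simp
qed

lemma club_closure:
  assumes "E \<subseteq> {..<L}" "\<forall>x<L. \<exists>y\<in>E. x < y"
  shows "club (E \<union> {x. x < L \<and> acc E x})"
  unfolding club_def
proof (intro conjI allI impI)
  fix x assume "x < L"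
  then show "\<exists>y\<in>E \<union> {x. x < L \<and> acc E x}. x < y" using assms(2) by auto
next
  fix x assume "x < L" "acc (E \<union> {x. x < L \<and> acc E x}) x"
  then show "x \<in> E \<union> {x. x < L \<and> acc E x}" using acc_closure by blast
qed (use assms(1) in auto)

section \<open>Projected walks along ladders\<close>

definition proj :: "'a set \<Rightarrow> 'a \<Rightarrow> 'a"
  where "proj E \<alpha> = (SOME y. y \<in> E \<and> y \<le> \<alpha> \<and> (\<forall>z\<in>E. z \<le> \<alpha> \<longrightarrow> z \<le> y))"

text \<open>The least upper bound of the elements of \<open>E\<close> up to \<alpha> is in
  \<open>E\<close> or a limit point of \<open>E\<close>. Where \<open>E\<close> has no such element
  the projection is an arbitrary value, hence the guards in \<open>walk\<close> and
  \<open>guesses\<close>.\<close>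

lemma proj:
  assumes E: "club E" and \<alpha>: "\<alpha> < L" and z: "z \<in> E" "z \<le> \<alpha>"
  shows "proj E \<alpha> \<in> E" "proj E \<alpha> \<le> \<alpha>" "\<And>z. \<lbrakk>z \<in> E; z \<le> \<alpha>\<rbrakk> \<Longrightarrow> z \<le> proj E \<alpha>"
proof -
  define P where "P s \<longleftrightarrow> (\<forall>y\<in>E. y \<le> \<alpha> \<longrightarrow> y \<le> s)" for s
  define s where "s = (LEAST s. P s)"
  have P: "P \<alpha>" unfolding P_def by blast
  then have s: "P s" "s \<le> \<alpha>" unfolding s_def by (auto intro: LeastI Least_le)
  have "s \<in> E"
  proof (rule ccontr)
    assume "s \<notin> E"
    have 1: "\<exists>y\<in>E. b < y \<and> y < s" if "b < s" for b
    proof -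
      have "\<not> P b" using that not_less_Least unfolding s_def by blast
      then obtain y where "y \<in> E" "y \<le> \<alpha>" "b < y" unfolding P_def by (auto simp: not_le)
      moreover from this have "y < s" using s \<open>s \<notin> E\<close> unfolding P_def by (metis order_le_less)
      ultimately show ?thesis by blast
    qed
    have "z < s" using z s(1) \<open>s \<notin> E\<close> unfolding P_def by (metis order_le_less)
    then have "acc E s" unfolding acc_def using 1 z by blast
    then show False using E s(2) \<alpha> \<open>s \<notin> E\<close> unfolding club_def by (meson le_less_trans)
  qed
  then have "\<exists>y. y \<in> E \<and> y \<le> \<alpha> \<and> (\<forall>z\<in>E. z \<le> \<alpha> \<longrightarrow> z \<le> y)"
    using s unfolding P_def by blast
  from someI_ex[OF this] show "proj E \<alpha> \<in> E" "proj E \<alpha> \<le> \<alpha>" "\<And>z. \<lbrakk>z \<in> E; z \<le> \<alpha>\<rbrakk> \<Longrightarrow> z \<le> proj E \<alpha>"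
    unfolding proj_def by blast+
qed

text \<open>The ordinals visited by walks that start at \<open>\<beta>\<close>, step down along the ladders \<open>e\<close>, project
  every step to \<open>E\<close>, and stop at \<open>S\<close>.\<close>

primrec walk :: "('a \<Rightarrow> 'a set) \<Rightarrow> 'a set \<Rightarrow> 'a \<Rightarrow> nat \<Rightarrow> 'a set" where
  "walk e E \<beta> 0 = {\<beta>}"
| "walk e E \<beta> (Suc n) = (\<Union>x\<in>walk e E \<beta> n - S. proj E ` {\<alpha> \<in> e x. E \<inter> {..\<alpha>} \<noteq> {}})"

definition walks :: "('a \<Rightarrow> 'a set) \<Rightarrow> 'a set \<Rightarrow> 'a \<Rightarrow> 'a set"
  where "walks e E \<beta> = (\<Union>n. walk e E \<beta> n)"

lemma walks_refl: "\<beta> \<in> walks e E \<beta>"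
  unfolding walks_def using walk.simps(1) by blast

lemma walks_step:
  assumes "x \<in> walks e E \<beta>" "x \<notin> S" "\<alpha> \<in> e x" "z \<in> E" "z \<le> \<alpha>"
  shows "proj E \<alpha> \<in> walks e E \<beta>"
proof -
  obtain n where "x \<in> walk e E \<beta> n" using assms(1) unfolding walks_def by blast
  then have "proj E \<alpha> \<in> walk e E \<beta> (Suc n)" using assms by auto
  then show ?thesis unfolding walks_def by blast
qed

text \<open>Requiring z to exceed all rungs before \<alpha> makes an initial segment of the result
  depend on few rungs. The rungs \<open>e \<delta>\<close> themselves are kept so that the set is
  cofinal.\<close>

definition guesses :: "('a \<Rightarrow> 'a set) \<Rightarrow> 'a set \<Rightarrow> 'a \<Rightarrow> 'a set"
  where "guesses e E \<delta> = e \<delta> \<union>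
    {z. \<exists>\<alpha>\<in>e \<delta>. E \<inter> {..\<alpha>} \<noteq> {} \<and> z \<in> walks e E (proj E \<alpha>) \<and> (\<forall>\<alpha>'\<in>e \<delta>. \<alpha>' < \<alpha> \<longrightarrow> \<alpha>' < z)}"

context
  fixes e :: "'a \<Rightarrow> 'a set"
  assumes e_sub: "\<And>x. x < L \<Longrightarrow> e x \<subseteq> {..<x}"
    and e_cofinal: "\<And>x b. \<lbrakk>x < L; b < x\<rbrakk> \<Longrightarrow> \<exists>y\<in>e x. b \<le> y"
    and e_small: "\<And>x. \<lbrakk>x < L; x \<notin> S\<rbrakk> \<Longrightarrow> small (e x)"
    and e_ladder: "\<And>x. x \<in> S \<Longrightarrow> ladder x (e x)"
begin

lemma walk_le:
  assumes E: "club E" and \<beta>: "\<beta> < L"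
  shows "x \<in> walk e E \<beta> n \<Longrightarrow> x \<le> \<beta>"
proof (induction n arbitrary: x)
  case (Suc n)
  then obtain y \<alpha> where y: "y \<in> walk e E \<beta> n" "\<alpha> \<in> e y" "E \<inter> {..\<alpha>} \<noteq> {}" "x = proj E \<alpha>"
    by auto
  then have "y \<le> \<beta>" using Suc.IH by blast
  then have "y < L" using \<beta> by auto
  then have "\<alpha> < y" "\<alpha> < L" using y(2) e_sub[of y] by auto
  moreover from this have "x \<le> \<alpha>" using proj(2)[OF E] y(3,4) by blast
  ultimately show ?case using \<open>y \<le> \<beta>\<close> by auto
qed simp

text \<open>Walks continue only from points outside \<open>S\<close>, where \<open>e\<close> is
  small, so each step branches fewer than K times; countably many steps stay small because K is
  regular and uncountable.\<close>

lemma small_walks: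
  assumes E: "club E" and \<beta>: "\<beta> < L"
  shows "small (walks e E \<beta>)"
proof -
  have "small (walk e E \<beta> n)" for n
  proof (induction n)
    case (Suc n)
    have "small (proj E ` {\<alpha> \<in> e x. E \<inter> {..\<alpha>} \<noteq> {}})" if "x \<in> walk e E \<beta> n - S" for x
    proof -
      have "x < L" using walk_le[OF E \<beta>] that \<beta> by (meson DiffD1 le_less_trans)
      then have "small (e x)" using e_small that by blast
      then show ?thesis
        by (intro small_image) (rule small_subset, assumption, blast)
    qed
    moreover have "small (walk e E \<beta> n - S)"
      by (rule small_subset[OF Suc]) auto
    ultimately show ?case unfolding walk.simps by (rule small_UN[rotated])
  qed (simp add: small_finite)
  then show ?thesis
    unfolding walks_def by (intro small_UN nat_lesspoll_K)
qed

text \<open>Fix a rung at or above \<gamma>. A point below \<gamma> that comes from a walk exceeds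
  all rungs before the start of that walk, so the start is not beyond the fixed rung. Hence fewer
  than K walks matter, and each is small.\<close>

lemma ladder_guesses:
  assumes E: "club E" and \<delta>: "\<delta> \<in> S"
  shows "ladder \<delta> (guesses e E \<delta>)"
proof -
  have \<delta>L: "\<delta> < L" using S_less[OF \<delta>] .
  have "guesses e E \<delta> \<subseteq> {..<\<delta>}"
  proof -
    have "z < \<delta>" if \<alpha>: "\<alpha> \<in> e \<delta>" "E \<inter> {..\<alpha>} \<noteq> {}" "z \<in> walks e E (proj E \<alpha>)" for z \<alpha>
    proof -
      have "\<alpha> < \<delta>" using \<alpha>(1) e_sub[OF \<delta>L] by auto
      then have p: "proj E \<alpha> \<le> \<alpha>" using \<alpha>(2) proj(2)[OF E] \<delta>L less_trans by blast
      then have "proj E \<alpha> < L" using \<open>\<alpha> < \<delta>\<close> \<delta>L by auto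
      then have "z \<le> proj E \<alpha>" using \<alpha>(3) walk_le[OF E] unfolding walks_def by blast
      then show ?thesis using p \<open>\<alpha> < \<delta>\<close> by auto
    qed
    then show ?thesis unfolding guesses_def using e_sub[OF \<delta>L] by blast
  qed
  moreover have "small (guesses e E \<delta> \<inter> {..<\<gamma>})" if \<gamma>: "\<gamma> < \<delta>" for \<gamma>
  proof -
    obtain \<alpha>\<^sub>\<gamma> where \<alpha>\<^sub>\<gamma>: "\<alpha>\<^sub>\<gamma> \<in> e \<delta>" "\<gamma> \<le> \<alpha>\<^sub>\<gamma>" using e_cofinal[OF \<delta>L \<gamma>] by blast
    define A where "A = insert \<alpha>\<^sub>\<gamma> (e \<delta> \<inter> {..<\<alpha>\<^sub>\<gamma>})"
    have "\<alpha>\<^sub>\<gamma> < \<delta>" using \<alpha>\<^sub>\<gamma>(1) e_sub[OF \<delta>L] by auto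
    then have "small A"
      unfolding A_def using e_ladder[OF \<delta>] unfolding ladder_def by (intro small_insert) blast
    moreover have "proj E \<alpha> < L" if "\<alpha> \<in> {\<alpha> \<in> A. E \<inter> {..\<alpha>} \<noteq> {}}" for \<alpha>
    proof -
      have "\<alpha> < L" using that \<open>\<alpha>\<^sub>\<gamma> < \<delta>\<close> \<delta>L unfolding A_def by auto
      then show ?thesis using proj(2)[OF E] that by (metis (mono_tags, lifting) Int_emptyI atMost_iff le_less_trans mem_Collect_eq)
    qed
    ultimately have "small (\<Union>\<alpha>\<in>{\<alpha> \<in> A. E \<inter> {..\<alpha>} \<noteq> {}}. walks e E (proj E \<alpha>))"
      by (intro small_UN small_walks[OF E]) (rule small_subset[of A], auto)
    moreover have "small (e \<delta> \<inter> {..<\<gamma>})"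
      using e_ladder[OF \<delta>] \<gamma> unfolding ladder_def by blast
    moreover have "guesses e E \<delta> \<inter> {..<\<gamma>} \<subseteq> 
        (e \<delta> \<inter> {..<\<gamma>}) \<union> (\<Union>\<alpha>\<in>{\<alpha> \<in> A. E \<inter> {..\<alpha>} \<noteq> {}}. walks e E (proj E \<alpha>))"
    proof -
      have "\<alpha> \<in> A" if "\<alpha> \<in> e \<delta>" "\<forall>\<alpha>'\<in>e \<delta>. \<alpha>' < \<alpha> \<longrightarrow> \<alpha>' < z" "z < \<gamma>" for z \<alpha>
      proof -
        have "\<not> \<alpha>\<^sub>\<gamma> < \<alpha>" using that \<alpha>\<^sub>\<gamma> by (meson leD less_le_trans less_imp_le)
        then show ?thesis using that(1) unfolding A_def by auto
      qed
      then show ?thesis unfolding guesses_def by blast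
    qed
    ultimately show ?thesis
      using small_subset[OF small_Un] by blast
  qed
  moreover have "\<exists>y\<in>guesses e E \<delta>. b \<le> y" if "b < \<delta>" for b
    using e_cofinal[OF \<delta>L that] unfolding guesses_def by auto
  ultimately show ?thesis
    unfolding ladder_def by simp
qed

text \<open>Let \<delta> in \<open>S\<close> be a limit of points of \<open>S\<close> common to all
  \<open>E n\<close>. Some common point b lies above all the bounds that the avoidance yields at
  \<delta>. Descending from the first rung of \<open>e \<delta>\<close> at or above b, walks
  projected to the \<open>E n\<close> reach a point of \<open>S\<close> not below b; that point was
  guessed and should have been avoided.\<close>

lemma no_avoiding_clubs:
  assumes avoid: "\<And>E. club E \<Longrightarrow>
    \<exists>E'. club E' \<and> (\<forall>\<delta>\<in>S. acc E' \<delta> \<longrightarrow> (\<exists>\<zeta><\<delta>. \<forall>x\<in>E' \<inter> S \<inter> guesses e E \<delta>. x < \<zeta>))"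
  shows False
proof -
  define av where "av E = (SOME E'. club E' \<and>
    (\<forall>\<delta>\<in>S. acc E' \<delta> \<longrightarrow> (\<exists>\<zeta><\<delta>. \<forall>x\<in>E' \<inter> S \<inter> guesses e E \<delta>. x < \<zeta>)))" for E
  have av: "club (av E)" "\<And>\<delta>. \<lbrakk>\<delta> \<in> S; acc (av E) \<delta>\<rbrakk> \<Longrightarrow> \<exists>\<zeta><\<delta>. \<forall>x\<in>av E \<inter> S \<inter> guesses e E \<delta>. x < \<zeta>"
    if "club E" for E
    using someI_ex[OF avoid[OF that]] unfolding av_def by blast+
  define E :: "nat \<Rightarrow> 'a set" where "E = rec_nat {..<L} (\<lambda>n X. X \<inter> av X)"
  have E_Suc: "E (Suc n) = E n \<inter> av (E n)" for n unfolding E_def by simp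
  have "club {..<L}" unfolding club_def using L_limit by auto
  then have E: "club (E n)" for n
    by (induction n) (simp_all add: E_Suc club_Int av(1), simp add: E_def)
  have E_mono: "E n \<subseteq> E m" if "m \<le> n" for m n
    using that by (induction rule: dec_induct) (auto simp: E_Suc)
  define X where "X = {x \<in> S. \<forall>n. x \<in> E n}"
  have X_unb: "\<exists>x\<in>X. b < x" if "b < L" for b
    using club_Inter[of E, OF E that] unfolding X_def by blast
  have XL: "X \<subseteq> {..<L}" using S_less unfolding X_def by auto
  obtain \<delta> where \<delta>: "\<delta> \<in> S" "acc X \<delta>"
  proof -
    have "club (X \<union> {x. x < L \<and> acc X x})"
      using XL X_unb by (intro club_closure) auto
    then have C: "club ((\<lambda>n::nat. X \<union> {x. x < L \<and> acc X x}) n)" for n :: nat by simp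
    obtain x where "x < L" using K_less_L by blast
    from club_Inter[OF C this] obtain x' where x': "x' \<in> S" "x < x'" by blast
    obtain g where g: "\<And>b. b < L \<Longrightarrow> g b \<in> X \<and> b < g b"
      using X_unb by metis
    then have "\<And>b. b < L \<Longrightarrow> g b < L" using XL by auto
    from S_closure_point[of g, OF this K_less_L] obtain \<gamma> where
      \<gamma>: "\<gamma> \<in> S" "K < \<gamma>" "\<And>b. b < \<gamma> \<Longrightarrow> \<exists>y<\<gamma>. b \<le> y \<and> g y < \<gamma>" by blast
    have "\<exists>y\<in>X. b < y \<and> y < \<gamma>" if b: "b < \<gamma>" for b
    proof -
      obtain y where y: "y < \<gamma>" "b \<le> y" "g y < \<gamma>" using \<gamma>(3)[OF b] by blast
      then have "y < L" using S_less[OF \<gamma>(1)] by auto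
      then show ?thesis using g[of y] y by (meson le_less_trans)
    qed
    then have "acc X \<gamma>" unfolding acc_def using \<gamma>(2) by blast
    then show thesis using that \<gamma>(1) by blast
  qed
  have \<delta>L: "\<delta> < L" using S_less[OF \<delta>(1)] .
  have "acc (av (E n)) \<delta>" for n
  proof -
    have "X \<subseteq> av (E n)" unfolding X_def using E_Suc[of n] by blast
    then show ?thesis using \<delta>(2) unfolding acc_def by blast
  qed
  then have "\<exists>\<zeta><\<delta>. \<forall>x\<in>av (E n) \<inter> S \<inter> guesses e (E n) \<delta>. x < \<zeta>" for n
    using av(2)[OF E \<delta>(1)] by blast
  then obtain \<zeta> where \<zeta>: "\<And>n. \<zeta> n < \<delta> \<and> (\<forall>x\<in>av (E n) \<inter> S \<inter> guesses e (E n) \<delta>. x < \<zeta> n)"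
    by metis
  have "range \<zeta> \<subseteq> {..<\<delta>}" using \<zeta> by auto
  then obtain z where z: "z < \<delta>" "range \<zeta> \<subseteq> {..<z}"
    using S_bounded[OF \<delta>(1)] small_countable by meson
  obtain b where b: "b \<in> X" "z < b" "b < \<delta>"
    using acc_between[OF \<delta>(2) z(1)] by blast
  then have b': "b \<in> S" "\<And>n. b \<in> E n" unfolding X_def by auto

  have stable: "\<exists>x n0. b \<le> x \<and> x \<le> \<alpha> \<and> (\<forall>n. x \<in> E n) \<and> (\<forall>n\<ge>n0. proj (E n) \<alpha> = x)"
    if \<alpha>: "b \<le> \<alpha>" "\<alpha> < L" for \<alpha>
  proof -
    have p: "proj (E n) \<alpha> \<in> E n" "proj (E n) \<alpha> \<le> \<alpha>" "\<And>z. \<lbrakk>z \<in> E n; z \<le> \<alpha>\<rbrakk> \<Longrightarrow> z \<le> proj (E n) \<alpha>" for n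
      using proj[OF E \<alpha>(2) b'(2) \<alpha>(1)] by blast+
    \<comment> \<open>Projections to shrinking clubs decrease with n, so their least value is also
      the eventual one.\<close>
    define x where "x = (LEAST x. \<exists>n. x = proj (E n) \<alpha>)"
    have "\<exists>n. x = proj (E n) \<alpha>" unfolding x_def by (rule LeastI_ex) blast
    then obtain n0 where n0: "x = proj (E n0) \<alpha>" by blast
    have "proj (E n) \<alpha> = x" if "n \<ge> n0" for n
    proof (rule antisym)
      have "proj (E n) \<alpha> \<in> E n0" using p(1)[of n] E_mono[OF that] by blast
      then show "proj (E n) \<alpha> \<le> x" using p(2,3) n0 by blast
      show "x \<le> proj (E n) \<alpha>" unfolding x_def by (rule Least_le) blast
    qed
    moreover from this have "x \<in> E n" for n
      using p(1)[of "max n n0"] E_mono[of n "max n n0"] by auto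
    moreover have "b \<le> x" "x \<le> \<alpha>" using p(2)[of n0] p(3)[OF b'(2) \<alpha>(1)] n0 by auto
    ultimately show ?thesis by blast
  qed
  \<comment> \<open>The first rung at or above b: all earlier rungs are below b, hence below any
    point that a walk staying at or above b reaches. This is the last clause of
    \<open>guesses\<close>.\<close>
  obtain \<alpha>0 where \<alpha>0: "\<alpha>0 \<in> e \<delta>" "b \<le> \<alpha>0" "\<And>\<alpha>'. \<lbrakk>\<alpha>' \<in> e \<delta>; \<alpha>' < \<alpha>0\<rbrakk> \<Longrightarrow> \<alpha>' < b"
  proof -
    define \<alpha>0 where "\<alpha>0 = (LEAST \<alpha>. \<alpha> \<in> e \<delta> \<and> b \<le> \<alpha>)"
    have "\<exists>\<alpha>. \<alpha> \<in> e \<delta> \<and> b \<le> \<alpha>" using e_cofinal[OF \<delta>L b(3)] by blast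
    from LeastI_ex[OF this] have "\<alpha>0 \<in> e \<delta>" "b \<le> \<alpha>0" unfolding \<alpha>0_def by auto
    moreover have "\<alpha>' < b" if "\<alpha>' \<in> e \<delta>" "\<alpha>' < \<alpha>0" for \<alpha>'
      using not_less_Least[OF that(2)[unfolded \<alpha>0_def]] that(1) by auto
    ultimately show thesis using that by blast
  qed
  have "\<alpha>0 < \<delta>" using \<alpha>0(1) e_sub[OF \<delta>L] by auto
  then have \<alpha>0L: "\<alpha>0 < L" using \<delta>L by auto
  \<comment> \<open>Points that walks reach for all large n. Rather than following one walk, take
    the least such point: outside \<open>S\<close> one more step would produce a smaller
    one.\<close>
  define Q where "Q x \<longleftrightarrow> b \<le> x \<and> x \<le> \<alpha>0 \<and> (\<forall>n. x \<in> E n) \<and>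
    (\<exists>n0. \<forall>n\<ge>n0. x \<in> walks e (E n) (proj (E n) \<alpha>0))" for x
  have "\<exists>x. Q x"
  proof -
    obtain x n0 where x: "b \<le> x" "x \<le> \<alpha>0" "\<forall>n. x \<in> E n" "\<forall>n\<ge>n0. proj (E n) \<alpha>0 = x"
      using stable[OF \<alpha>0(2) \<alpha>0L] by blast
    then have "\<forall>n\<ge>n0. x \<in> walks e (E n) (proj (E n) \<alpha>0)" using walks_refl by simp
    then show ?thesis using x unfolding Q_def by blast
  qed
  define x where "x = (LEAST x. Q x)"
  have Q: "Q x" unfolding x_def using \<open>\<exists>x. Q x\<close> by (rule LeastI_ex)
  then obtain n0 where x: "b \<le> x" "x \<le> \<alpha>0" "\<And>n. x \<in> E n" "\<And>n. n \<ge> n0 \<Longrightarrow> x \<in> walks e (E n) (proj (E n) \<alpha>0)"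
    unfolding Q_def by blast
  have xL: "x < L" using x(2) \<alpha>0L by auto
  have "x \<in> S"
  proof (rule ccontr)
    assume xS: "x \<notin> S"
    \<comment> \<open>Equality is excluded because b lies in \<open>S\<close>; strictness leaves
      room for a rung of \<open>e x\<close> at or above b.\<close>
    then have "b < x" using x(1) b'(1) by (metis order_le_less)
    then obtain \<alpha> where \<alpha>: "\<alpha> \<in> e x" "b \<le> \<alpha>" using e_cofinal[OF xL] by blast
    then have "\<alpha> < x" using e_sub[OF xL] by auto
    then obtain y n1 where y: "b \<le> y" "y \<le> \<alpha>" "\<forall>n. y \<in> E n" "\<forall>n\<ge>n1. proj (E n) \<alpha> = y"
      using stable[OF \<alpha>(2)] xL by (meson less_trans)
    have "y \<in> walks e (E n) (proj (E n) \<alpha>0)" if "n \<ge> max n0 n1" for n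
      using walks_step[OF x(4) xS \<alpha>(1) b'(2) \<alpha>(2)] y(4) that by auto
    then have "Q y" unfolding Q_def using y \<open>\<alpha> < x\<close> x(2) by (meson less_imp_le order_trans)
    moreover have "y < x" using y(2) \<open>\<alpha> < x\<close> by auto
    ultimately show False using not_less_Least unfolding x_def by blast
  qed
  moreover have "x \<in> guesses e (E n0) \<delta>"
  proof -
    have "E n0 \<inter> {..\<alpha>0} \<noteq> {}" using b'(2) \<alpha>0(2) by blast
    moreover have "\<forall>\<alpha>'\<in>e \<delta>. \<alpha>' < \<alpha>0 \<longrightarrow> \<alpha>' < x" using \<alpha>0(3) x(1) by (meson less_le_trans)
    ultimately show ?thesis unfolding guesses_def using \<alpha>0(1) x(4)[of n0] by blast
  qed
  moreover have "x \<in> av (E n0)" using x(3)[of "Suc n0"] E_Suc by auto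
  ultimately have "x < \<zeta> n0" using \<zeta> by blast
  moreover have "\<zeta> n0 < z" using z(2) by auto
  ultimately show False using b(2) x(1) by auto
qed

end

theorem no_avoiding_sets:
  assumes avoid: "\<And>c. (\<And>\<delta>. \<delta> \<in> S \<Longrightarrow> ladder \<delta> (c \<delta>)) \<Longrightarrow>
    \<exists>E. E \<subseteq> {..<L} \<and> (\<forall>x<L. \<exists>y\<in>E. x < y) \<and>
      (\<forall>\<delta>\<in>S. acc E \<delta> \<longrightarrow> \<delta> \<in> E \<and> (\<exists>\<zeta><\<delta>. \<forall>x\<in>E \<inter> c \<delta>. x < \<zeta>))"
  shows False
proof -
  have "\<forall>x. \<exists>X. x < L \<longrightarrow> X \<subseteq> {..<x} \<and> (\<forall>b<x. \<exists>y\<in>X. b \<le> y) \<and>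
     (x \<notin> S \<longrightarrow> small X) \<and> (x \<in> S \<longrightarrow> ladder x X)"
  proof
    fix x
    show "\<exists>X. x < L \<longrightarrow> X \<subseteq> {..<x} \<and> (\<forall>b<x. \<exists>y\<in>X. b \<le> y) \<and>
     (x \<notin> S \<longrightarrow> small X) \<and> (x \<in> S \<longrightarrow> ladder x X)"
    proof (cases "x \<in> S")
      case True
      then show ?thesis using cofinal_ladder[of x] unfolding ladder_def by blast
    next
      case False
      then show ?thesis using not_S_small_cofinal[of x] by blast
    qed
  qed
  then obtain e where e: "\<And>x. x < L \<Longrightarrow> e x \<subseteq> {..<x} \<and> (\<forall>b<x. \<exists>y\<in>e x. b \<le> y) \<and>
     (x \<notin> S \<longrightarrow> small (e x)) \<and> (x \<in> S \<longrightarrow> ladder x (e x))"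
    by metis
  show False
  proof (rule no_avoiding_clubs[of e])
    fix E assume E: "club E"
    have "ladder \<delta> (guesses e E \<delta>)" if "\<delta> \<in> S" for \<delta>
      using that e S_less by (intro ladder_guesses[OF _ _ _ _ E]) auto
    then obtain E' where E': "E' \<subseteq> {..<L}" "\<forall>x<L. \<exists>y\<in>E'. x < y"
      "\<And>\<delta>. \<lbrakk>\<delta> \<in> S; acc E' \<delta>\<rbrakk> \<Longrightarrow> \<delta> \<in> E' \<and> (\<exists>\<zeta><\<delta>. \<forall>x\<in>E' \<inter> guesses e E \<delta>. x < \<zeta>)"
      using avoid[of "guesses e E"] by blast
    let ?C = "E' \<union> {x. x < L \<and> acc E' x}"
    \<comment> \<open>Taking limit points adds nothing inside \<open>S\<close>, so the avoidance for
      \<open>E'\<close> carries over to its closure.\<close>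
    have "?C \<inter> S \<subseteq> E'" using E'(3) by blast
    then have "\<exists>\<zeta><\<delta>. \<forall>x\<in>?C \<inter> S \<inter> guesses e E \<delta>. x < \<zeta>" if "\<delta> \<in> S" "acc ?C \<delta>" for \<delta>
      using E'(3)[OF that(1) acc_closure[OF that(2)]] by blast
    then show "\<exists>E'. club E' \<and> (\<forall>\<delta>\<in>S. acc E' \<delta> \<longrightarrow> (\<exists>\<zeta><\<delta>. \<forall>x\<in>E' \<inter> S \<inter> guesses e E \<delta>. x < \<zeta>))"
      using club_closure[OF E'(1,2)] by blast
  next
    fix x b assume "x < L"
    then show "e x \<subseteq> {..<x}" "b < x \<Longrightarrow> \<exists>y\<in>e x. b \<le> y" "x \<notin> S \<Longrightarrow> small (e x)"
      using e by blast+
  next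
    fix x assume "x \<in> S"
    then show "ladder x (e x)" using e S_less by blast
  qed
qed

end

section \<open>The forcing notion\<close>

context regular_successor
begin

text \<open>An interval ending in a point of \<open>S\<close> keeps that point from being a limit of
  the generic set, and singletons, as degenerate intervals, let \<open>reduction\<close> forbid
  points one by one. Intervals are nonempty so that a bound on the set bounds both endpoints in
  \<open>below_lepoll\<close>.\<close>

definition obstacles :: "('a \<Rightarrow> 'a set) \<Rightarrow> 'a set set"
  where "obstacles c = {{\<alpha>..\<beta>} | \<alpha> \<beta>. \<alpha> \<le> \<beta> \<and> \<beta> < L} \<union> {c \<delta> - {..<\<zeta>} | \<delta> \<zeta>. \<delta> \<in> S \<and> \<zeta> < \<delta>}"

text \<open>A condition \<open>(a, b)\<close> promises that the generic set contains \<open>a\<close> and avoids every member of \<open>b\<close>.\<close>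

definition conditions :: "('a \<Rightarrow> 'a set) \<Rightarrow> ('a set \<times> 'a set set) set"
  where "conditions c = {p. fst p \<subseteq> {..<L} \<and> small (fst p) \<and> snd p \<subseteq> obstacles c \<and> small (snd p) \<and>
    (\<forall>x\<in>fst p. \<forall>D\<in>snd p. x \<notin> D)}"

definition extends :: "'a set \<times> 'a set set \<Rightarrow> 'a set \<times> 'a set set \<Rightarrow> bool"
  where "extends q p \<longleftrightarrow> fst p \<subseteq> fst q \<and> snd p \<subseteq> snd q"

definition merge :: "('a set \<times> 'a set set) set \<Rightarrow> 'a set \<times> 'a set set"
  where "merge X = (\<Union>(fst ` X), \<Union>(snd ` X))"

definition below :: "('a \<Rightarrow> 'a set) \<Rightarrow> 'a \<Rightarrow> ('a set \<times> 'a set set) set"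
  where "below c \<gamma> = {p \<in> conditions c. fst p \<subseteq> {..<\<gamma>} \<and> (\<forall>D\<in>snd p. \<exists>\<beta><\<gamma>. D \<subseteq> {..\<beta>})}"

text \<open>For \<alpha> in \<open>S\<close> the condition decides: either \<alpha> joins the
  generic set and a tail of its ladder is forbidden, or an interval up to \<alpha> is forbidden and
  \<alpha> is no limit point.\<close>

definition requirement :: "('a \<Rightarrow> 'a set) \<Rightarrow> 'a \<Rightarrow> ('a set \<times> 'a set set) set"
  where "requirement c \<alpha> = {p \<in> conditions c. (\<exists>x\<in>fst p. \<alpha> < x) \<and>
    (\<alpha> \<in> S \<longrightarrow> (\<alpha> \<in> fst p \<and> (\<exists>\<zeta><\<alpha>. c \<alpha> - {..<\<zeta>} \<in> snd p)) \<or> (\<exists>x<\<alpha>. {x..\<alpha>} \<in> snd p))}"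

lemma extends_refl: "extends p p"
  by (simp add: extends_def)

lemma extends_trans: "\<lbrakk>extends r q; extends q p\<rbrakk> \<Longrightarrow> extends r p"
  unfolding extends_def by blast

lemma conditionsD:
  assumes "p \<in> conditions c"
  shows "fst p \<subseteq> {..<L}" "small (fst p)" "snd p \<subseteq> obstacles c" "small (snd p)"
    "\<And>x D. \<lbrakk>x \<in> fst p; D \<in> snd p\<rbrakk> \<Longrightarrow> x \<notin> D"
  using assms unfolding conditions_def by blast+

lemma conditionsI:
  assumes "a \<subseteq> {..<L}" "small a" "b \<subseteq> obstacles c" "small b" "\<And>x D. \<lbrakk>x \<in> a; D \<in> b\<rbrakk> \<Longrightarrow> x \<notin> D"
  shows "(a, b) \<in> conditions c"
  using assms unfolding conditions_def by simp

lemma belowD: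
  assumes "p \<in> below c \<gamma>"
  shows "p \<in> conditions c" "fst p \<subseteq> {..<\<gamma>}" "\<And>D. D \<in> snd p \<Longrightarrow> \<exists>\<beta><\<gamma>. D \<subseteq> {..\<beta>}"
  using assms unfolding below_def by blast+

lemma below_conditions: "below c \<gamma> \<subseteq> conditions c"
  unfolding below_def by auto

lemma below_mono: "\<gamma> \<le> \<gamma>' \<Longrightarrow> below c \<gamma> \<subseteq> below c \<gamma>'"
  unfolding below_def by (auto dest: less_le_trans) (meson less_le_trans)

lemma empty_condition: "({}, {}) \<in> below c \<gamma>"
  unfolding below_def conditions_def by (simp add: small_finite)

lemma singleton_obstacle: "\<eta> < L \<Longrightarrow> {\<eta>} \<in> obstacles c"
  unfolding obstacles_def by (intro UnI1 CollectI exI[of _ \<eta>]) auto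

text \<open>Pairwise compatibility is enough because the clause linking the two parts of a condition
  involves one point and one obstacle at a time; sizes are handled by regularity of K.\<close>

lemma merge_conditions:
  assumes X: "X \<subseteq> conditions c" "small X"
    and compat: "\<And>p q. \<lbrakk>p \<in> X; q \<in> X\<rbrakk> \<Longrightarrow> \<exists>r\<in>conditions c. extends r p \<and> extends r q"
  shows "merge X \<in> conditions c"
proof -
  have X1: "fst p \<subseteq> {..<L}" "small (fst p)" "snd p \<subseteq> obstacles c" "small (snd p)" if "p \<in> X" for p
    using X(1) that conditionsD by blast+
  have disj: "x \<notin> D" if pq: "p \<in> X" "q \<in> X" "x \<in> fst p" "D \<in> snd q" for p q x D
  proof -
    obtain r where "r \<in> conditions c" "fst p \<subseteq> fst r" "snd q \<subseteq> snd r"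
      using compat[OF pq(1,2)] unfolding extends_def by blast
    then show ?thesis using pq(3,4) conditionsD(5) by blast
  qed
  show ?thesis
    unfolding merge_def
  proof (rule conditionsI)
    show "small (\<Union>(fst ` X))" "small (\<Union>(snd ` X))"
      using X(2) X1 by (auto intro!: small_UN)
  qed (use X1 disj in blast)+
qed

lemma compatible_if:
  assumes p: "p \<in> conditions c" and q: "q \<in> conditions c"
    and "\<And>x D. \<lbrakk>x \<in> fst p; D \<in> snd q\<rbrakk> \<Longrightarrow> x \<notin> D" "\<And>x D. \<lbrakk>x \<in> fst q; D \<in> snd p\<rbrakk> \<Longrightarrow> x \<notin> D"
  shows "\<exists>r\<in>conditions c. extends r p \<and> extends r q"
proof
  show "(fst p \<union> fst q, snd p \<union> snd q) \<in> conditions c"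
    using assms(3,4) conditionsD[OF p] conditionsD[OF q] by (intro conditionsI small_Un) blast+
qed (simp add: extends_def)

lemma merge_glb:
  "p \<in> X \<Longrightarrow> extends (merge X) p"
  "(\<And>p. p \<in> X \<Longrightarrow> extends h p) \<Longrightarrow> extends h (merge X)"
  unfolding extends_def merge_def by auto

section \<open>Conditions over a fixed ladder system: size, closure, reduction, density\<close>

context
  fixes c :: "'a \<Rightarrow> 'a set"
  assumes c: "\<And>\<delta>. \<delta> \<in> S \<Longrightarrow> ladder \<delta> (c \<delta>)"
begin

text \<open>A tail is still cofinal in \<delta>. Consequently an obstacle below \<gamma> can only
  come from ladders at points below \<gamma>, which limits the number of obstacles.\<close>

lemma ladder_tail_bound:
  assumes \<delta>: "\<delta> \<in> S" and \<zeta>: "\<zeta> < \<delta>" and sub: "c \<delta> - {..<\<zeta>} \<subseteq> {..\<beta>}"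
  shows "\<delta> \<le> \<beta>"
proof (rule ccontr)
  assume "\<not> \<delta> \<le> \<beta>"
  then obtain b where b: "max \<beta> \<zeta> < b" "b < \<delta>"
    using S_limit[OF \<delta>, of "max \<beta> \<zeta>"] \<zeta> by (metis max_less_iff_conj not_le)
  then obtain y where "y \<in> c \<delta>" "b \<le> y"
    using c[OF \<delta>] unfolding ladder_def by blast
  then show False using sub b(1) by auto
qed

lemma obstacle_bounded: "D \<in> obstacles c \<Longrightarrow> \<exists>\<beta><L. D \<subseteq> {..\<beta>}"
  unfolding obstacles_def using c S_less unfolding ladder_def by fastforce

text \<open>An interval missing \<delta> lies on one side of it. A ladder tail belongs either to a
  point below \<delta>, which bounds it, or to a point not below \<delta>, and then its initial
  segments below \<delta> are small.\<close>

lemma obstacle_cases: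
  assumes D: "D \<in> obstacles c" and \<delta>: "\<delta> \<in> S" "\<delta> \<notin> D"
  shows "(\<exists>\<beta><\<delta>. D \<subseteq> {..\<beta>}) \<or> (\<forall>\<gamma><\<delta>. small (D \<inter> {..<\<gamma>}))"
  using D unfolding obstacles_def
proof (elim UnE CollectE exE conjE)
  fix \<alpha> \<beta> assume D: "D = {\<alpha>..\<beta>}"
  then have "\<beta> < \<delta> \<or> D \<inter> {..<\<delta>} = {}" using \<delta>(2) by auto
  then have "\<beta> < \<delta> \<or> (\<forall>\<gamma><\<delta>. D \<inter> {..<\<gamma>} = {})" using less_trans by blast
  then show ?thesis using D small_finite[OF finite.emptyI] by auto
next
  fix \<epsilon> \<zeta> assume D: "D = c \<epsilon> - {..<\<zeta>}" and \<epsilon>: "\<epsilon> \<in> S"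
  show ?thesis
  proof (cases "\<epsilon> < \<delta>")
    case True
    moreover have "D \<subseteq> {..\<epsilon>}" using D c[OF \<epsilon>] unfolding ladder_def by auto
    ultimately show ?thesis by blast
  next
    case False
    have "small (D \<inter> {..<\<gamma>})" if "\<gamma> < \<delta>" for \<gamma>
    proof (rule small_subset)
      show "small (c \<epsilon> \<inter> {..<\<gamma>})" using c[OF \<epsilon>] that False unfolding ladder_def by auto
    qed (use D in blast)
    then show ?thesis by blast
  qed
qed

lemma small_imp_bounded_L: "\<lbrakk>X \<subseteq> {..<L}; small X\<rbrakk> \<Longrightarrow> \<exists>b<L. X \<subseteq> {..<b}"
  using L_regular lesspoll_imp_lepoll by blast

text \<open>Turns separate bounds for the obstacles into one bound for the condition. Leaving
  \<delta> general covers both L and the points of \<open>S\<close>.\<close>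

lemma bounded_imp_below:
  assumes p: "p \<in> conditions c" and \<delta>: "\<And>X. \<lbrakk>X \<subseteq> {..<\<delta>}; small X\<rbrakk> \<Longrightarrow> \<exists>b<\<delta>. X \<subseteq> {..<b}"
    and bounds: "fst p \<subseteq> {..<\<delta>}" "\<And>D. D \<in> snd p \<Longrightarrow> \<exists>\<beta><\<delta>. D \<subseteq> {..\<beta>}"
  shows "\<exists>\<gamma><\<delta>. p \<in> below c \<gamma>"
proof -
  obtain \<beta> where \<beta>: "\<And>D. D \<in> snd p \<Longrightarrow> \<beta> D < \<delta> \<and> D \<subseteq> {..\<beta> D}"
    using bounds(2) by metis
  note sm = conditionsD(2,4)[OF p]
  obtain x where x: "x < \<delta>" "fst p \<subseteq> {..<x}" using \<delta>[OF bounds(1) sm(1)] by blast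
  obtain y where y: "y < \<delta>" "\<beta> ` snd p \<subseteq> {..<y}"
    using \<delta>[of "\<beta> ` snd p"] \<beta> small_image[OF sm(2)] by blast
  have "\<exists>\<beta><max x y. D \<subseteq> {..\<beta>}" if "D \<in> snd p" for D
    using \<beta>[OF that] y(2) that by (intro exI[of _ "\<beta> D"]) (auto simp: less_max_iff_disj)
  moreover have "fst p \<subseteq> {..<max x y}" using x(2) by (auto simp: less_max_iff_disj)
  ultimately have "p \<in> below c (max x y)" using p unfolding below_def by simp
  then show ?thesis using x(1) y(1) by (intro exI[of _ "max x y"]) simp
qed

lemma condition_below:
  assumes "p \<in> conditions c"
  shows "\<exists>\<gamma><L. p \<in> below c \<gamma>"
proof (rule bounded_imp_below[OF assms])
  show "fst p \<subseteq> {..<L}" by (rule conditionsD(1)[OF assms])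
  show "\<exists>\<beta><L. D \<subseteq> {..\<beta>}" if "D \<in> snd p" for D
    using that conditionsD(3)[OF assms] obstacle_bounded by blast
qed (rule small_imp_bounded_L)

lemma below_S:
  assumes "\<gamma> \<in> S" "p \<in> below c \<gamma>"
  shows "\<exists>\<beta><\<gamma>. p \<in> below c \<beta>"
proof (rule bounded_imp_below)
  show "p \<in> conditions c" "fst p \<subseteq> {..<\<gamma>}" using belowD[OF assms(2)] by auto
  show "\<exists>\<beta><\<gamma>. D \<subseteq> {..\<beta>}" if "D \<in> snd p" for D
    using that belowD(3)[OF assms(2)] by blast
qed (rule S_bounded[OF assms(1)])

text \<open>There are at most K obstacles below \<gamma>, as each is given by two ordinals below
  \<gamma>; the hypothesis on powers of \<kappa> then bounds the small sets of obstacles and of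
  ordinals.\<close>

lemma below_lepoll:
  assumes \<gamma>: "\<gamma> < L"
  shows "below c \<gamma> \<lesssim> {..<K}"
proof -
  define O\<^sub>\<gamma> where "O\<^sub>\<gamma> = {D \<in> obstacles c. \<exists>\<beta><\<gamma>. D \<subseteq> {..\<beta>}}"
  have "O\<^sub>\<gamma> \<subseteq> (\<lambda>(\<alpha>, \<beta>). {\<alpha>..\<beta>}) ` ({..<\<gamma>} \<times> {..<\<gamma>}) \<union> (\<lambda>(\<delta>, \<zeta>). c \<delta> - {..<\<zeta>}) ` ({..<\<gamma>} \<times> {..<\<gamma>})"
  proof
    fix D assume "D \<in> O\<^sub>\<gamma>"
    then obtain \<beta>' where D: "D \<in> obstacles c" and \<beta>': "\<beta>' < \<gamma>" "D \<subseteq> {..\<beta>'}"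
      unfolding O\<^sub>\<gamma>_def by blast
    from D consider (1) \<alpha> \<beta> where "D = {\<alpha>..\<beta>}" "\<alpha> \<le> \<beta>" | (2) \<delta> \<zeta> where "D = c \<delta> - {..<\<zeta>}" "\<delta> \<in> S" "\<zeta> < \<delta>"
      unfolding obstacles_def by blast
    then show "D \<in> (\<lambda>(\<alpha>, \<beta>). {\<alpha>..\<beta>}) ` ({..<\<gamma>} \<times> {..<\<gamma>}) \<union> (\<lambda>(\<delta>, \<zeta>). c \<delta> - {..<\<zeta>}) ` ({..<\<gamma>} \<times> {..<\<gamma>})"
    proof cases
      case 1
      then have "\<beta> < \<gamma>" "\<alpha> < \<gamma>" using \<beta>' by auto
      then show ?thesis using 1 by auto
    next
      case 2
      then have "\<delta> < \<gamma>" "\<zeta> < \<gamma>" using ladder_tail_bound[of \<delta> \<zeta> \<beta>'] \<beta>' by auto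
      then show ?thesis using 2 by auto
    qed
  qed
  moreover have sq: "{..<\<gamma>} \<times> {..<\<gamma>} \<lesssim> {..<K}"
    by (intro lepoll_Times_infinite infinite_K below_L \<gamma>)
  ultimately have O: "O\<^sub>\<gamma> \<lesssim> {..<K}"
    using lepoll_trans[OF subset_imp_lepoll lepoll_Un_infinite[OF infinite_K lepoll_trans[OF image_lepoll sq] lepoll_trans[OF image_lepoll sq]]]
    by blast
  have "below c \<gamma> \<subseteq> {a. a \<subseteq> {..<\<gamma>} \<and> small a} \<times> {b. b \<subseteq> O\<^sub>\<gamma> \<and> small b}"
    unfolding below_def conditions_def O\<^sub>\<gamma>_def by (auto simp: mem_Times_iff)
  then show ?thesis
    using lepoll_trans[OF subset_imp_lepoll lepoll_Times_infinite[OF infinite_K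
          small_subsets_lepoll[OF below_L[OF \<gamma>]] small_subsets_lepoll[OF O]]] by blast
qed

text \<open>The top is left out because its code will be built from enumerations of the other
  conditions.\<close>

lemma lepoll_below:
  assumes "K \<le> \<gamma>" "\<gamma> < L"
  shows "{..<K} \<lesssim> below c \<gamma> - {({}, {})}"
proof -
  have "inj_on (\<lambda>\<eta>. ({\<eta>}, {} :: 'a set set)) {..<K}" by (auto simp: inj_on_def)
  moreover have "(\<lambda>\<eta>. ({\<eta>}, {})) ` {..<K} \<subseteq> below c \<gamma> - {({}, {})}"
    using assms unfolding below_def conditions_def by (auto simp: small_finite)
  ultimately show ?thesis unfolding lepoll_def by blast
qed

text \<open>Each level has at most K finite subsets, so their values under \<open>F\<close> lie
  below some next level \<open>g \<gamma>\<close>. At a closure point of \<open>g\<close> in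
  \<open>S\<close> a finite set of conditions already lies at an earlier level.\<close>

lemma below_closure:
  assumes F: "\<And>A. A \<subseteq> conditions c \<Longrightarrow> F A \<in> conditions c"
    and X: "X \<subseteq> conditions c" "X \<lesssim> {..<K}"
  shows "\<exists>\<gamma>\<in>S. K < \<gamma> \<and> X \<subseteq> below c \<gamma> \<and> (\<forall>A. A \<subseteq> below c \<gamma> \<and> finite A \<longrightarrow> F A \<in> below c \<gamma>)"
proof -
  obtain h where h: "\<And>p. p \<in> conditions c \<Longrightarrow> h p < L \<and> p \<in> below c (h p)"
    using condition_below by metis
  have bound: "\<exists>\<gamma><L. Y \<subseteq> below c \<gamma>" if Y: "Y \<subseteq> conditions c" "Y \<lesssim> {..<K}" for Y
  proof -
    have "h ` Y \<subseteq> {..<L}" using h Y(1) by blast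
    moreover have "h ` Y \<lesssim> {..<K}" using image_lepoll Y(2) lepoll_trans by blast
    ultimately obtain \<gamma> where \<gamma>: "\<gamma> < L" "h ` Y \<subseteq> {..<\<gamma>}" using L_regular by blast
    have "p \<in> below c \<gamma>" if "p \<in> Y" for p
    proof -
      have "h p < \<gamma>" "p \<in> below c (h p)" using \<gamma>(2) h[of p] Y(1) that by blast+
      then have "h p \<le> \<gamma>" "p \<in> below c (h p)" by simp_all
      then show ?thesis using below_mono by blast
    qed
    then show ?thesis using \<gamma>(1) by blast
  qed
  obtain \<beta> where \<beta>: "\<beta> < L" "X \<subseteq> below c \<beta>" using bound[OF X] by blast
  have "\<exists>\<gamma>'<L. F ` {A. A \<subseteq> below c \<gamma> \<and> finite A} \<subseteq> below c \<gamma>'" if \<gamma>: "\<gamma> < L" for \<gamma>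
  proof (rule bound)
    show "F ` {A. A \<subseteq> below c \<gamma> \<and> finite A} \<subseteq> conditions c"
      using F below_conditions by blast
    have "{A. A \<subseteq> below c \<gamma> \<and> finite A} \<subseteq> {A. A \<subseteq> below c \<gamma> \<and> small A}"
      using small_finite by blast
    then show "F ` {A. A \<subseteq> below c \<gamma> \<and> finite A} \<lesssim> {..<K}"
      using small_subsets_lepoll[OF below_lepoll[OF \<gamma>]]
      by (meson image_lepoll subset_imp_lepoll lepoll_trans)
  qed
  then have "\<forall>\<gamma>. \<exists>\<gamma>'. \<gamma> < L \<longrightarrow> \<gamma>' < L \<and> F ` {A. A \<subseteq> below c \<gamma> \<and> finite A} \<subseteq> below c \<gamma>'"
    by blast
  from choice[OF this] obtain g
    where g: "\<And>\<gamma>. \<gamma> < L \<Longrightarrow> g \<gamma> < L \<and> F ` {A. A \<subseteq> below c \<gamma> \<and> finite A} \<subseteq> below c (g \<gamma>)"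
    by blast
  then have "\<And>\<gamma>. \<gamma> < L \<Longrightarrow> g \<gamma> < L" by blast
  moreover have "max \<beta> K < L" using \<beta>(1) K_less_L by simp
  ultimately obtain \<gamma> where \<gamma>: "\<gamma> \<in> S" "max \<beta> K < \<gamma>" "\<And>x. x < \<gamma> \<Longrightarrow> \<exists>y<\<gamma>. x \<le> y \<and> g y < \<gamma>"
    using S_closure_point[of g "max \<beta> K"] by blast
  have "F A \<in> below c \<gamma>" if A: "A \<subseteq> below c \<gamma>" "finite A" for A
  proof -
    obtain k where k: "\<And>p. p \<in> A \<Longrightarrow> k p < \<gamma> \<and> p \<in> below c (k p)"
      using below_S[OF \<gamma>(1)] A(1) by (metis subsetD)
    have "k ` A \<subseteq> {..<\<gamma>}" "small (k ` A)" using k A(2) by (auto simp: small_finite)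
    then obtain x where x: "x < \<gamma>" "k ` A \<subseteq> {..<x}"
      using S_bounded[OF \<gamma>(1)] by blast
    obtain y where y: "y < \<gamma>" "x \<le> y" "g y < \<gamma>" using \<gamma>(3)[OF x(1)] by blast
    have "A \<subseteq> below c y"
    proof
      fix p assume "p \<in> A"
      then have "k p < x" "p \<in> below c (k p)" using k x(2) by blast+
      then have "k p \<le> y" "p \<in> below c (k p)" using y(2) by simp_all
      then show "p \<in> below c y" using below_mono by blast
    qed
    moreover have "y < L" using y(1) S_less[OF \<gamma>(1)] by auto
    ultimately have "F A \<in> below c (g y)" using g A(2) by blast
    then show ?thesis using below_mono[OF less_imp_le[OF y(3)]] by blast
  qed
  moreover have "\<beta> \<le> \<gamma>" using \<gamma>(2) by auto
  then have "X \<subseteq> below c \<gamma>" using \<beta>(2) below_mono by blast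
  moreover have "K < \<gamma>" using \<gamma>(2) by simp
  ultimately show ?thesis using \<gamma>(1) by blast
qed

lemma insert_point:
  assumes "\<delta> \<in> S" "p \<in> below c \<delta>"
  shows "(insert \<delta> (fst p), snd p) \<in> conditions c"
proof (rule conditionsI)
  note p = belowD[OF assms(2)]
  show "insert \<delta> (fst p) \<subseteq> {..<L}" "small (insert \<delta> (fst p))" "snd p \<subseteq> obstacles c" "small (snd p)"
    using S_less[OF assms(1)] conditionsD[OF p(1)] by (auto simp: small_insert)
  show "x \<notin> D" if "x \<in> insert \<delta> (fst p)" "D \<in> snd p" for x D
  proof (cases "x = \<delta>")
    case True
    then show ?thesis using p(3)[OF that(2)] by auto
  qed (use that conditionsD(5)[OF p(1)] in auto)
qed

text \<open>Obstacles that are unbounded below \<open>\<delta>\<close> meet \<open>\<gamma>\<close> in a small set, so that \<open>w\<close> can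
  forbid each of these points separately.\<close>

lemma reduction:
  assumes \<delta>: "\<delta> \<in> S" and q: "q \<in> conditions c" "\<delta> \<in> fst q"
  shows "\<exists>\<beta><\<delta>. \<forall>\<gamma>. \<beta> \<le> \<gamma> \<and> \<gamma> < \<delta> \<longrightarrow>
    (\<exists>w\<in>below c \<gamma>. \<forall>r\<in>below c \<gamma>. extends r w \<longrightarrow> (\<exists>s\<in>conditions c. extends s r \<and> extends s q))"
proof -
  define b1 where "b1 = {D \<in> snd q. \<exists>\<beta><\<delta>. D \<subseteq> {..\<beta>}}"
  note q' = conditionsD[OF q(1)]
  have b2: "small (D \<inter> {..<\<gamma>})" if "D \<in> snd q - b1" "\<gamma> < \<delta>" for D \<gamma>
  proof -
    have "\<delta> \<notin> D" using that(1) q'(5)[OF q(2)] by blast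
    then show ?thesis using obstacle_cases[OF _ \<delta>] that q'(3) unfolding b1_def by blast
  qed
  have sm: "small b1" "small (fst q \<inter> {..<\<delta>})" "small (snd q - b1)"
    unfolding b1_def by (rule small_subset[OF q'(4)] small_subset[OF q'(2)], blast)+
  have "(fst q \<inter> {..<\<delta>}, b1) \<in> conditions c"
    using q'(1,3,5) sm unfolding b1_def by (intro conditionsI) auto
  then have "\<exists>\<beta><\<delta>. (fst q \<inter> {..<\<delta>}, b1) \<in> below c \<beta>"
    by (rule bounded_imp_below[OF _ S_bounded[OF \<delta>]]) (auto simp: b1_def)
  then obtain \<beta> where \<beta>: "\<beta> < \<delta>" "(fst q \<inter> {..<\<delta>}, b1) \<in> below c \<beta>"
    by blast
  have "\<exists>w\<in>below c \<gamma>. \<forall>r\<in>below c \<gamma>. extends r w \<longrightarrow> (\<exists>s\<in>conditions c. extends s r \<and> extends s q)"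
    if \<gamma>: "\<beta> \<le> \<gamma>" "\<gamma> < \<delta>" for \<gamma>
  proof -
    define b where "b = (\<Union>D\<in>snd q - b1. (\<lambda>\<eta>. {\<eta>}) ` (D \<inter> {..<\<gamma>}))"
    have \<gamma>L: "\<gamma> < L" using \<gamma>(2) S_less[OF \<delta>] by auto
    have b1\<gamma>: "\<exists>\<beta><\<gamma>. D \<subseteq> {..\<beta>}" if "D \<in> b1" for D
      using belowD(3)[OF \<beta>(2), of D] that less_le_trans[OF _ \<gamma>(1)] by auto
    have a: "fst q \<inter> {..<\<delta>} \<subseteq> {..<\<gamma>}"
      using belowD(2)[OF \<beta>(2)] \<gamma>(1) by auto
    have "small b"
      unfolding b_def using b2[OF _ \<gamma>(2)] sm(3) by (intro small_UN small_image)
    moreover have "b \<subseteq> obstacles c"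
      unfolding b_def using singleton_obstacle \<gamma>L by auto
    moreover have "x \<notin> D" if "x \<in> fst q \<inter> {..<\<delta>}" "D \<in> b1 \<union> b" for x D
      using q'(5)[of x] that unfolding b_def b1_def by blast
    moreover have "b1 \<subseteq> obstacles c"
      using q'(3) unfolding b1_def by blast
    ultimately have "(fst q \<inter> {..<\<delta>}, b1 \<union> b) \<in> conditions c"
      using q'(1) sm(1,2) by (intro conditionsI small_Un) blast+
    then have w: "(fst q \<inter> {..<\<delta>}, b1 \<union> b) \<in> below c \<gamma>"
      unfolding below_def using a b1\<gamma> by (auto simp: b_def)
    have "\<exists>s\<in>conditions c. extends s r \<and> extends s q"
      if r: "r \<in> below c \<gamma>" "extends r (fst q \<inter> {..<\<delta>}, b1 \<union> b)" for r
    proof -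
      have r1: "r \<in> conditions c" "fst r \<subseteq> {..<\<gamma>}" "\<And>D. D \<in> snd r \<Longrightarrow> \<exists>\<beta><\<gamma>. D \<subseteq> {..\<beta>}"
        using belowD[OF r(1)] by blast+
      note r2 = conditionsD(5)[OF r1(1)]
      have r3: "fst q \<inter> {..<\<delta>} \<subseteq> fst r" "b1 \<union> b \<subseteq> snd r" using r(2) unfolding extends_def by auto
      have "x \<notin> D" if x: "x \<in> fst r" "D \<in> snd q" for x D
      proof (cases "D \<in> b1")
        case True
        then show ?thesis using r2 r3(2) x(1) by blast
      next
        case False
        show ?thesis
        proof
          assume "x \<in> D"
          then have "{x} \<in> b" unfolding b_def using False x r1(2) by blast
          then show False using r2 r3(2) x(1) by blast
        qed
      qed
      \<comment> \<open>The points of q from \<delta> on cannot conflict with r, whose obstacles are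
        bounded below \<gamma>; those below \<delta> are already in w.\<close>
      moreover have "x \<notin> D" if x: "x \<in> fst q" "D \<in> snd r" for x D
      proof
        assume "x \<in> D"
        then have "x < \<gamma>" using r1(3)[OF x(2)] by auto
        then have "x \<in> fst r" using r3(1) x(1) \<gamma>(2) by auto
        then show False using r2 x(2) \<open>x \<in> D\<close> by blast
      qed
      ultimately show ?thesis
        by (intro compatible_if r1(1) q(1)) blast+
    qed
    then show ?thesis using w by blast
  qed
  then show ?thesis using \<beta>(1) by blast
qed

lemma requirement_dense:
  assumes \<alpha>: "\<alpha> < L" and p: "p \<in> conditions c"
  shows "\<exists>q\<in>requirement c \<alpha>. extends q p"
proof -
  obtain \<gamma> where \<gamma>: "\<gamma> < L" "p \<in> below c \<gamma>" using condition_below[OF p] by blast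
  have "max \<alpha> \<gamma> < L" using \<alpha> \<gamma>(1) by simp
  \<comment> \<open>Beyond \<gamma> no obstacle of p interferes, and beyond \<alpha> the new point
    gives unboundedness.\<close>
  then obtain x where x: "x < L" "max \<alpha> \<gamma> < x" using L_limit by blast
  define a where "a = insert x (fst p)"
  note p' = conditionsD[OF p]
  have "x \<notin> D" if "D \<in> snd p" for D
  proof -
    have "\<exists>\<beta><\<gamma>. D \<subseteq> {..\<beta>}" using belowD(3)[OF \<gamma>(2) that] .
    then show ?thesis using x(2) by auto
  qed
  then have a: "(a, snd p) \<in> conditions c"
    unfolding a_def using p' x(1) by (intro conditionsI small_insert) auto
  show ?thesis
  proof (cases "\<alpha> \<in> S")
    case False
    then have "(a, snd p) \<in> requirement c \<alpha>"
      unfolding requirement_def using a x(2) unfolding a_def by auto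
    then show ?thesis unfolding extends_def a_def by (rule bexI[rotated]) auto
  next
    case \<alpha>S: True
    have "small (a \<inter> {..<\<alpha>})" using small_subset[OF conditionsD(2)[OF a]] by auto
    \<comment> \<open>The condition is bounded below \<alpha> by cofinality, so both the tail and
      the interval starting at \<zeta> miss what lies below \<alpha>.\<close>
    then obtain \<zeta> where \<zeta>: "\<zeta> < \<alpha>" "a \<inter> {..<\<alpha>} \<subseteq> {..<\<zeta>}"
      using S_bounded[OF \<alpha>S, of "a \<inter> {..<\<alpha>}"] by blast
    have "\<exists>D\<in>obstacles c. a \<inter> D = {} \<and> (\<alpha> \<in> a \<and> D = c \<alpha> - {..<\<zeta>} \<or> D = {\<zeta>..\<alpha>})"
    proof (cases "\<alpha> \<in> a")
      case True
      have "c \<alpha> \<subseteq> {..<\<alpha>}" using c[OF \<alpha>S] unfolding ladder_def by blast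
      then have "a \<inter> (c \<alpha> - {..<\<zeta>}) = {}" using \<zeta>(2) by blast
      moreover have "c \<alpha> - {..<\<zeta>} \<in> obstacles c" unfolding obstacles_def using \<alpha>S \<zeta>(1) by blast
      ultimately show ?thesis using True by blast
    next
      case False
      have "x \<notin> {\<zeta>..\<alpha>}" if "x \<in> a" for x
      proof
        assume x: "x \<in> {\<zeta>..\<alpha>}"
        then have "x < \<alpha>" using that False by (cases "x = \<alpha>") auto
        then show False using \<zeta>(2) that x by auto
      qed
      then have "a \<inter> {\<zeta>..\<alpha>} = {}" by blast
      moreover have "{\<zeta>..\<alpha>} \<in> obstacles c" unfolding obstacles_def using \<alpha> \<zeta>(1) less_imp_le by blast
      ultimately show ?thesis by blast
    qed
    then obtain D where D: "D \<in> obstacles c" "a \<inter> D = {}" "\<alpha> \<in> a \<and> D = c \<alpha> - {..<\<zeta>} \<or> D = {\<zeta>..\<alpha>}"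
      by blast
    have "(a, insert D (snd p)) \<in> conditions c"
      using conditionsD[OF a] D(1,2) by (intro conditionsI small_insert) auto
    then have "(a, insert D (snd p)) \<in> requirement c \<alpha>"
      unfolding requirement_def using D(3) \<zeta>(1) x(2) unfolding a_def by auto
    then show ?thesis unfolding extends_def a_def by (rule bexI[rotated]) auto
  qed
qed

end

lemma generic_set:
  assumes G: "G \<subseteq> conditions c" "\<And>p q. \<lbrakk>p \<in> G; q \<in> G\<rbrakk> \<Longrightarrow> \<exists>r\<in>G. extends r p \<and> extends r q"
    and meets: "\<And>\<alpha>. \<alpha> < L \<Longrightarrow> G \<inter> requirement c \<alpha> \<noteq> {}"
  shows "\<exists>E. E \<subseteq> {..<L} \<and> (\<forall>x<L. \<exists>y\<in>E. x < y) \<and>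
      (\<forall>\<delta>\<in>S. acc E \<delta> \<longrightarrow> \<delta> \<in> E \<and> (\<exists>\<zeta><\<delta>. \<forall>x\<in>E \<inter> c \<delta>. x < \<zeta>))"
proof (intro exI[of _ "\<Union>(fst ` G)"] conjI ballI impI allI)
  show "\<Union>(fst ` G) \<subseteq> {..<L}" using G(1) conditionsD(1) by blast
  show "\<exists>y\<in>\<Union>(fst ` G). x < y" if "x < L" for x
    using meets[OF that] unfolding requirement_def by fastforce
  have avoid: "x \<notin> D" if x: "x \<in> \<Union>(fst ` G)" "D \<in> \<Union>(snd ` G)" for x D
  proof -
    obtain p q where pq: "p \<in> G" "q \<in> G" "x \<in> fst p" "D \<in> snd q" using x by blast
    from G(2)[OF pq(1,2)] obtain r where "r \<in> G" "x \<in> fst r" "D \<in> snd r"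
      using pq(3,4) unfolding extends_def by blast
    then show ?thesis using G(1) conditionsD(5) by blast
  qed
  fix \<delta> assume \<delta>: "\<delta> \<in> S" "acc (\<Union>(fst ` G)) \<delta>"
  obtain p where p: "p \<in> G" "p \<in> requirement c \<delta>" using meets[OF S_less[OF \<delta>(1)]] by blast
  then consider (1) \<zeta> where "\<delta> \<in> fst p" "\<zeta> < \<delta>" "c \<delta> - {..<\<zeta>} \<in> snd p" | (2) x where "x < \<delta>" "{x..\<delta>} \<in> snd p"
    using \<delta>(1) unfolding requirement_def by force
  then have "\<delta> \<in> \<Union>(fst ` G) \<and> (\<exists>\<zeta><\<delta>. \<forall>x\<in>\<Union>(fst ` G) \<inter> c \<delta>. x < \<zeta>)"
  proof cases
    case 1
    then have "c \<delta> - {..<\<zeta>} \<in> \<Union>(snd ` G)" "\<delta> \<in> \<Union>(fst ` G)" using p(1) by blast+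
    moreover have "x < \<zeta>" if "x \<in> \<Union>(fst ` G)" "x \<in> c \<delta>" for x
      using avoid[OF that(1) calculation(1)] that(2) by auto
    ultimately show ?thesis using 1(2) by blast
  next
    case 2
    \<comment> \<open>A forbidden interval up to \<delta> contradicts that \<delta> is a limit of
      the generic set.\<close>
    obtain y where y: "y \<in> \<Union>(fst ` G)" "x < y" "y < \<delta>" using acc_between[OF \<delta>(2) 2(1)] by blast
    moreover have "{x..\<delta>} \<in> \<Union>(snd ` G)" using 2(2) p(1) by blast
    ultimately show ?thesis using avoid[of y "{x..\<delta>}"] by auto
  qed
  then show "\<delta> \<in> \<Union>(fst ` G)" "\<exists>\<zeta><\<delta>. \<forall>x\<in>\<Union>(fst ` G) \<inter> c \<delta>. x < \<zeta>" by blast+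
qed

end

section \<open>Ordinals in a universe of sets\<close>

definition vsmall :: "'v::zfc_universe set \<Rightarrow> bool"
  where "vsmall X \<longleftrightarrow> (\<exists>x. elts x = X)"

lemma elts_inject: "elts x = elts y \<longleftrightarrow> x = y"
  using ZFC_extensionality by blast

lemma vset_elts [simp]: "vset (elts x) = x"
  unfolding vset_def by (simp add: elts_inject)

lemma elts_vset: "vsmall X \<Longrightarrow> elts (vset X) = X"
  unfolding vsmall_def by auto

lemma vsmall_elts [simp]: "vsmall (elts x)"
  unfolding vsmall_def by blast

lemma vsmall_image:
  fixes f :: "'v::zfc_universe \<Rightarrow> 'v"
  assumes "vsmall X"
  shows "vsmall (f ` X)"
proof -
  obtain x where x: "elts x = X" using assms unfolding vsmall_def by blast
  show ?thesis unfolding vsmall_def x[symmetric] by (rule ZFC_replacement)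
qed

lemma vsmall_subset:
  assumes "vsmall X" "Y \<subseteq> X"
  shows "vsmall Y"
proof -
  obtain x where x: "elts x = X" using assms(1) unfolding vsmall_def by blast
  obtain y where "elts y = {u \<in> elts x. u \<in> Y}" using ZFC_separation[of x "\<lambda>u. u \<in> Y"] by blast
  then have "elts y = Y" using x assms(2) by blast
  then show ?thesis unfolding vsmall_def by blast
qed

lemma vsmall_UN:
  fixes f :: "'v::zfc_universe \<Rightarrow> 'v set"
  assumes "vsmall X" "\<And>x. x \<in> X \<Longrightarrow> vsmall (f x)"
  shows "vsmall (\<Union>x\<in>X. f x)"
proof -
  obtain a where a: "elts a = (\<lambda>x. vset (f x)) ` X"
    using vsmall_image[OF assms(1), of "\<lambda>x. vset (f x)"] unfolding vsmall_def by blast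
  have "(\<Union>y\<in>elts a. elts y) = (\<Union>x\<in>X. f x)"
    unfolding a using elts_vset[OF assms(2)] by simp
  then show ?thesis using ZFC_union[of a] unfolding vsmall_def by simp
qed

lemma vsmall_pair: "vsmall {x, y}"
  unfolding vsmall_def by (rule ZFC_pairing)

lemma vsmall_singleton [simp]: "vsmall {x}"
  using vsmall_pair[of x x] by simp

lemma vsmall_empty [simp]: "vsmall {}"
  using vsmall_subset[OF vsmall_singleton] by blast

lemma vsmall_Un:
  assumes "vsmall X" "vsmall Y"
  shows "vsmall (X \<union> Y)"
proof -
  have "vsmall (\<Union>u\<in>{vset X, vset Y}. elts u)"
    by (intro vsmall_UN vsmall_pair) simp
  then show ?thesis using assms by (simp add: elts_vset)
qed

lemma vsmall_insert: "vsmall X \<Longrightarrow> vsmall (insert x X)"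
  using vsmall_Un[OF vsmall_singleton] by simp

text \<open>Replacement along arbitrary HOL functions makes size the criterion for being a
  set.\<close>

lemma vsmall_lepoll:
  fixes X :: "'v::zfc_universe set" and x :: 'v
  assumes "X \<lesssim> elts x"
  shows "vsmall X"
proof -
  obtain g where g: "X \<subseteq> g ` elts x" using assms unfolding lepoll_iff by (elim exE)
  have "vsmall (g ` elts x)" by (rule vsmall_image[OF vsmall_elts])
  then show ?thesis by (rule vsmall_subset[OF _ g])
qed

lemma elts_singleton [simp]: "elts (vset {x}) = {x}"
  by (simp add: elts_vset)

lemma elts_pair [simp]: "elts (vset {x, y}) = {x, y}"
  by (simp add: elts_vset vsmall_pair)

lemma elts_opair: "elts (opair x y) = {vset {x}, vset {x, y}}"
  by (simp add: opair_def)

lemma opair_inject [simp]: "opair x y = opair x' y' \<longleftrightarrow> x = x' \<and> y = y'"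
proof
  have vs: "vset {a, b} = vset {a', b'} \<longleftrightarrow> {a, b} = {a', b'}" for a b a' b' :: 'a
    by (metis elts_pair)
  assume "opair x y = opair x' y'"
  then have "{vset {x, x}, vset {x, y}} = {vset {x', x'}, vset {x', y'}}"
    by (metis elts_opair insert_absorb2)
  then show "x = x' \<and> y = y'"
    unfolding doubleton_eq_iff vs by blast
qed simp

text \<open>Conditions are HOL pairs, not elements of the universe. They receive codes once their
  number is bounded by the extension of a set; this lemma and the next give such bounds.\<close>

lemma Times_lepoll_elts:
  assumes "X \<lesssim> elts (x :: 'v::zfc_universe)" "Y \<lesssim> elts (y :: 'v)"
  shows "\<exists>z :: 'v. X \<times> Y \<lesssim> elts z"
proof -
  let ?P = "\<Union>u\<in>elts x. opair u ` elts y"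
  have "vsmall ?P" by (intro vsmall_UN vsmall_image) simp_all
  then obtain z where z: "elts z = ?P" unfolding vsmall_def by blast
  have "(\<lambda>(u, v). opair u v) ` (elts x \<times> elts y) \<subseteq> elts z" unfolding z by auto
  moreover have "inj_on (\<lambda>(u, v). opair u v) (elts x \<times> elts y)" by (auto simp: inj_on_def)
  ultimately have "elts x \<times> elts y \<lesssim> elts z" unfolding lepoll_def by auto
  then show ?thesis using times_lepoll_mono[OF assms] lepoll_trans by auto
qed

lemma Pow_lepoll_elts:
  assumes "X \<lesssim> elts (x :: 'v::zfc_universe)"
  shows "\<exists>z :: 'v. Pow X \<lesssim> elts z"
proof -
  obtain z where z: "elts z = {y. elts y \<subseteq> elts x}" using ZFC_powerset by blast
  obtain f where f: "inj_on f X" "f ` X \<subseteq> elts x" using assms unfolding lepoll_def by blast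
  have sm: "vsmall (f ` A)" if "A \<in> Pow X" for A
    by (rule vsmall_subset[of "elts x"]) (use that f(2) in auto)
  have "inj_on (\<lambda>A. vset (f ` A)) (Pow X)"
  proof (rule inj_onI)
    fix A B assume AB: "A \<in> Pow X" "B \<in> Pow X" "vset (f ` A) = vset (f ` B)"
    then have "f ` A = f ` B" using elts_vset[OF sm] by metis
    then show "A = B" using AB(1,2) f(1) by (meson PowD inj_on_image_eq_iff)
  qed
  moreover have "(\<lambda>A. vset (f ` A)) ` Pow X \<subseteq> elts z"
    unfolding z using f(2) by (auto simp: elts_vset[OF sm]) blast
  ultimately show ?thesis unfolding lepoll_def by blast
qed

text \<open>Length four is the cycle that arises when a value of a function contains the function:
  value, unordered pair, ordered pair, graph.\<close>

lemma mem_acyclic: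
  "\<not> (a \<in> elts b \<and> b \<in> elts c \<and> c \<in> elts d \<and> d \<in> elts a)"
proof
  assume A: "a \<in> elts b \<and> b \<in> elts c \<and> c \<in> elts d \<and> d \<in> elts a"
  obtain x where x: "elts x = {a, b, c, d}"
    using vsmall_insert[OF vsmall_insert[OF vsmall_pair[of c d]]] unfolding vsmall_def by blast
  then have "\<exists>y\<in>elts x. elts y \<inter> elts x = {}" by (intro ZFC_foundation) simp
  then show False using A x by auto
qed

lemma mem_irrefl: "x \<notin> elts x"
  using mem_acyclic[of x x x x] by blast

definition graph :: "('v::zfc_universe \<Rightarrow> 'v) \<Rightarrow> 'v \<Rightarrow> 'v"
  where "graph g a = vset ((\<lambda>x. opair x (g x)) ` elts a)"

lemma elts_graph: "elts (graph g a) = (\<lambda>x. opair x (g x)) ` elts a"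
  unfolding graph_def by (rule elts_vset[OF vsmall_image]) simp

lemma opair_graph [simp]: "opair x y \<in> elts (graph g a) \<longleftrightarrow> x \<in> elts a \<and> y = g x"
  unfolding elts_graph by auto

lemma funs_eq: "funs a b = {graph g a | g. g ` elts a \<subseteq> elts b}"
  unfolding funs_def graph_def ..

lemma app_graph: "x \<in> elts a \<Longrightarrow> app (graph g a) x = g x"
  unfolding app_def by simp

lemma elts_finite_subsets: "elts (finite_subsets x) = {a. elts a \<subseteq> elts x \<and> finite (elts a)}"
proof -
  obtain z where z: "elts z = {y. elts y \<subseteq> elts x}" using ZFC_powerset by blast
  then show ?thesis
    unfolding finite_subsets_def by (intro elts_vset vsmall_subset[OF vsmall_elts[of z]]) auto
qed

lemma Ord_transitive: "\<lbrakk>Ord x; y \<in> elts x; z \<in> elts y\<rbrakk> \<Longrightarrow> z \<in> elts x"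
  unfolding Ord_def transitive_set_def by blast

lemma Ord_elem: "\<lbrakk>Ord x; y \<in> elts x\<rbrakk> \<Longrightarrow> Ord y"
  unfolding Ord_def transitive_set_def by blast

lemma Ord_induct [consumes 1]:
  assumes "Ord x" and step: "\<And>x. \<lbrakk>Ord x; \<And>y. y \<in> elts x \<Longrightarrow> P y\<rbrakk> \<Longrightarrow> P x"
  shows "P x"
proof (rule ccontr)
  assume "\<not> P x"
  obtain s where s: "elts s = {y \<in> elts x. \<not> P y}"
    using ZFC_separation[of x "\<lambda>y. \<not> P y"] by blast
  have "elts s \<noteq> {}" using step[OF assms(1)] \<open>\<not> P x\<close> unfolding s by blast
  then obtain y where y: "y \<in> elts s" "elts y \<inter> elts s = {}" using ZFC_foundation by blast
  then have "y \<in> elts x" "\<not> P y" unfolding s by auto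
  moreover have "P z" if "z \<in> elts y" for z
    using that y(2) Ord_transitive[OF assms(1) \<open>y \<in> elts x\<close>] unfolding s by blast
  ultimately show False using step Ord_elem[OF assms(1)] by blast
qed

lemma Ord_linear:
  assumes "Ord x" "Ord y"
  shows "x \<in> elts y \<or> x = y \<or> y \<in> elts x"
  using assms
proof (induction x arbitrary: y rule: Ord_induct)
  case outer: (1 x)
  show ?case
    using outer(3)
  proof (induction y rule: Ord_induct)
    case inner: (1 y)
    show ?case
    proof (rule ccontr)
      assume N: "\<not> ?thesis"
      have "u \<in> elts y" if u: "u \<in> elts x" for u
      proof -
        have "u \<in> elts y \<or> u = y \<or> y \<in> elts u" using outer(2)[OF u inner(1)] .
        moreover have "y \<notin> elts u" using N Ord_transitive[OF outer(1) u] by blast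
        ultimately show ?thesis using N u by blast
      qed
      moreover have "v \<in> elts x" if v: "v \<in> elts y" for v
      proof -
        have "x \<in> elts v \<or> x = v \<or> v \<in> elts x" using inner(2)[OF v] .
        moreover have "x \<notin> elts v" using N Ord_transitive[OF inner(1) v] by blast
        ultimately show ?thesis using N v by blast
      qed
      ultimately have "elts x = elts y" by blast
      then show False using N elts_inject by blast
    qed
  qed
qed

section \<open>Ordinals of the universe as a wellordered type\<close>

typedef (overloaded) 'v vord = "{x :: 'v::zfc_universe. Ord x}"
  by (rule exI[of _ "vset {}"]) (simp add: Ord_def transitive_set_def elts_vset)

lemma Ord_Rep [simp]: "Ord (Rep_vord x)"
  using Rep_vord by blast

lemma Rep_Abs [simp]: "Ord x \<Longrightarrow> Rep_vord (Abs_vord x) = x"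
  by (simp add: Abs_vord_inverse)

instantiation vord :: (zfc_universe) wellorder
begin

definition "less_eq_vord x y \<longleftrightarrow> Rep_vord x = Rep_vord y \<or> Rep_vord x \<in> elts (Rep_vord y)"
definition "less_vord x y \<longleftrightarrow> Rep_vord x \<in> elts (Rep_vord y)"

instance
proof
  fix x y z :: "'a vord"
  have asym: "Rep_vord y \<notin> elts (Rep_vord x)" if "Rep_vord x \<in> elts (Rep_vord y)"
    using that mem_irrefl Ord_transitive[OF Ord_Rep] by blast
  then show "x < y \<longleftrightarrow> x \<le> y \<and> \<not> y \<le> x"
    unfolding less_eq_vord_def less_vord_def using mem_irrefl by metis
  show "x \<le> x" unfolding less_eq_vord_def by simp
  show "x \<le> z" if "x \<le> y" "y \<le> z"
    using that Ord_transitive[OF Ord_Rep[of z]] unfolding less_eq_vord_def by metis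
  show "x = y" if "x \<le> y" "y \<le> x"
    using that asym unfolding less_eq_vord_def by (metis Rep_vord_inject)
  show "x \<le> y \<or> y \<le> x"
    using Ord_linear[OF Ord_Rep[of x] Ord_Rep[of y]] unfolding less_eq_vord_def by auto
next
  fix P and a :: "'a vord"
  assume step: "\<And>x. (\<And>y. y < x \<Longrightarrow> P y) \<Longrightarrow> P (x :: 'a vord)"
  have "P (Abs_vord x)" if "Ord x" for x
    using that
  proof (induction x rule: Ord_induct)
    case (1 x)
    show ?case
    proof (rule step)
      fix y assume "y < Abs_vord x"
      then have "Rep_vord y \<in> elts x" unfolding less_vord_def using 1(1) by simp
      from 1(2)[OF this] show "P y" by (simp add: Rep_vord_inverse)
    qed
  qed
  from this[OF Ord_Rep[of a]] show "P a" by (simp add: Rep_vord_inverse)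
qed

end

lemma Rep_image_lessThan: "Rep_vord ` {..<x} = elts (Rep_vord x)"
proof
  show "elts (Rep_vord x) \<subseteq> Rep_vord ` {..<x}"
  proof
    fix y assume y: "y \<in> elts (Rep_vord x)"
    then have "Ord y" using Ord_elem[OF Ord_Rep] by blast
    then have "y = Rep_vord (Abs_vord y)" "Abs_vord y < x" unfolding less_vord_def using y by simp_all
    then show "y \<in> Rep_vord ` {..<x}" by blast
  qed
qed (auto simp: less_vord_def)

lemma inj_Rep: "inj_on Rep_vord X"
  by (simp add: inj_on_def Rep_vord_inject)

lemma elts_Rep_eqpoll: "elts (Rep_vord x) \<approx> {..<x}"
  using inj_on_image_eqpoll_self[OF inj_Rep] unfolding Rep_image_lessThan[symmetric] .

lemma elts_subset_iff: "elts (Rep_vord x) \<subseteq> elts (Rep_vord y) \<longleftrightarrow> x \<le> y"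
proof -
  have "elts (Rep_vord x) \<subseteq> elts (Rep_vord y) \<longleftrightarrow> {..<x} \<subseteq> {..<y}"
    unfolding Rep_image_lessThan[symmetric] by (rule inj_image_subset_iff[OF inj_Rep])
  then show ?thesis by simp
qed

lemma lepoll_elts_Rep: "X \<lesssim> elts (Rep_vord x) \<longleftrightarrow> X \<lesssim> {..<x}"
  using lepoll_trans2[OF _ elts_Rep_eqpoll] lepoll_trans2[OF _ eqpoll_sym[OF elts_Rep_eqpoll]] by (rule iffI)

lemma lesspoll_elts_Rep: "X \<prec> elts (Rep_vord x) \<longleftrightarrow> X \<prec> {..<x}"
  using lesspoll_eq_trans[OF _ elts_Rep_eqpoll] lesspoll_eq_trans[OF _ eqpoll_sym[OF elts_Rep_eqpoll]] by (rule iffI)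

lemma elts_Rep_lesspoll: "elts (Rep_vord x) \<prec> X \<longleftrightarrow> {..<x} \<prec> X"
  using eq_lesspoll_trans[OF eqpoll_sym[OF elts_Rep_eqpoll]] eq_lesspoll_trans[OF elts_Rep_eqpoll] by (rule iffI)

lemma Card_Rep: "Card (Rep_vord x) \<longleftrightarrow> (\<forall>y<x. {..<y} \<prec> {..<x})"
proof -
  have "Card (Rep_vord x) \<longleftrightarrow> (\<forall>\<alpha>\<in>Rep_vord ` {..<x}. elts \<alpha> \<prec> elts (Rep_vord x))"
    unfolding Card_def Rep_image_lessThan by simp
  then show ?thesis
    by (auto simp: elts_Rep_lesspoll lesspoll_elts_Rep)
qed

lemma vord_unbounded: "vsmall (Rep_vord ` X) \<Longrightarrow> \<exists>b. X \<subseteq> {..<b}"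
proof -
  assume "vsmall (Rep_vord ` X)"
  then have sm: "vsmall (\<Union>x\<in>Rep_vord ` X. insert x (elts x))"
    by (intro vsmall_UN vsmall_insert) simp_all
  define u where "u = vset (\<Union>x\<in>Rep_vord ` X. insert x (elts x))"
  have u: "elts u = (\<Union>x\<in>Rep_vord ` X. insert x (elts x))" unfolding u_def by (rule elts_vset[OF sm])
  have "Ord y" if "y \<in> elts u" for y
    using that Ord_elem[OF Ord_Rep] unfolding u by auto
  moreover have "transitive_set u"
    unfolding transitive_set_def u using Ord_transitive[OF Ord_Rep] by blast
  ultimately have "Ord u" unfolding Ord_def by blast
  then have "x < Abs_vord u" if "x \<in> X" for x
    unfolding less_vord_def using that u by auto
  then show ?thesis by blast
qed

lemma order_embedding_ge:
  fixes h :: "'a::wellorder \<Rightarrow> 'a"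
  assumes "\<And>x y. \<lbrakk>x < y; y < b\<rbrakk> \<Longrightarrow> h x < h y" "x < b"
  shows "x \<le> h x"
  using assms(2)
proof (induction x rule: less_induct)
  case (less x)
  show ?case
  proof (rule ccontr)
    assume "\<not> x \<le> h x"
    then have lt: "h x < x" by simp
    then have "h x \<le> h (h x)" using less by (meson less_trans)
    moreover have "h (h x) < h x" using assms(1)[OF lt less(2)] .
    ultimately show False by simp
  qed
qed

text \<open>Ordinals of size at most \<open>K\<close> are determined by the well-orders that they induce on \<open>K\<close>.\<close>

lemma hartogs:
  fixes K :: "'v::zfc_universe vord"
  shows "\<exists>L :: 'v vord. \<forall>\<alpha>. \<alpha> < L \<longleftrightarrow> {..<\<alpha>} \<lesssim> {..<K}"
proof -
  define Hs where "Hs = {\<alpha> :: 'v vord. {..<\<alpha>} \<lesssim> {..<K}}"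
  have "\<forall>\<alpha>. \<exists>f. \<alpha> \<in> Hs \<longrightarrow> inj_on f {..<\<alpha>} \<and> f ` {..<\<alpha>} \<subseteq> {..<K}"
    unfolding Hs_def lepoll_def by blast
  then obtain f where f: "\<And>\<alpha>. \<alpha> \<in> Hs \<Longrightarrow> inj_on (f \<alpha>) {..<\<alpha>} \<and> f \<alpha> ` {..<\<alpha>} \<subseteq> {..<K}"
    by metis
  define r where "r \<alpha> = {(f \<alpha> x, f \<alpha> y) | x y. x \<le> y \<and> y < \<alpha>}" for \<alpha> :: "'v vord"
  have r_less: False if ab: "\<alpha> \<in> Hs" "\<beta> \<in> Hs" "\<alpha> < \<beta>" "r \<alpha> = r \<beta>" for \<alpha> \<beta> :: "'v vord"
  proof -
    have "\<exists>y<\<alpha>. f \<alpha> y = f \<beta> x" if x: "x < \<beta>" for x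
    proof -
      have "(f \<beta> x, f \<beta> x) \<in> r \<beta>" unfolding r_def using x by blast
      then have "(f \<beta> x, f \<beta> x) \<in> r \<alpha>" unfolding ab(4) .
      then show ?thesis unfolding r_def by auto
    qed
    then obtain h where h: "\<And>x. x < \<beta> \<Longrightarrow> h x < \<alpha> \<and> f \<alpha> (h x) = f \<beta> x" by metis
    have "h x < h y" if xy: "x < y" "y < \<beta>" for x y
    proof -
      have xb: "x < \<beta>" using xy by simp
      have "(f \<alpha> (h x), f \<alpha> (h y)) \<in> r \<beta>"
        using h[OF xb] h[OF xy(2)] xy unfolding r_def by (auto intro: less_imp_le)
      then have "(f \<alpha> (h x), f \<alpha> (h y)) \<in> r \<alpha>" unfolding ab(4) .
      then obtain u v where "f \<alpha> (h x) = f \<alpha> u" "f \<alpha> (h y) = f \<alpha> v" "u \<le> v" "v < \<alpha>"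
        unfolding r_def by blast
      then have "h x \<le> h y"
        using f[OF ab(1)] h[OF xb] h[OF xy(2)] by (metis inj_onD lessThan_iff le_less_trans)
      moreover have "h x \<noteq> h y"
        using h[OF xb] h[OF xy(2)] f[OF ab(2)] xy xb by (metis inj_onD lessThan_iff less_irrefl)
      ultimately show ?thesis by simp
    qed
    \<comment> \<open>Equal codes would embed \<beta> into the smaller ordinal \<alpha> in an
      order-preserving way.\<close>
    then have "\<alpha> \<le> h \<alpha>" using order_embedding_ge[of \<beta> h \<alpha>] ab(3) by blast
    then show False using h[OF ab(3)] by auto
  qed
  have "inj_on r Hs"
    by (rule inj_onI) (metis r_less linorder_neqE)
  moreover have "r ` Hs \<subseteq> Pow ({..<K} \<times> {..<K})"
  proof -
    have "r \<alpha> \<subseteq> {..<K} \<times> {..<K}" if "\<alpha> \<in> Hs" for \<alpha>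
      unfolding r_def using f[OF that] by (auto dest: le_less_trans)
    then show ?thesis by blast
  qed
  ultimately have 1: "Hs \<lesssim> Pow ({..<K} \<times> {..<K})" unfolding lepoll_def by blast
  have "{..<K} \<lesssim> elts (Rep_vord K)" using lepoll_elts_Rep by blast
  then obtain x :: 'v where "{..<K} \<times> {..<K} \<lesssim> elts x" using Times_lepoll_elts by blast
  then obtain z :: 'v where "Pow ({..<K} \<times> {..<K}) \<lesssim> elts z" using Pow_lepoll_elts by blast
  then have "Hs \<lesssim> elts z" using 1 lepoll_trans by blast
  then have "vsmall (Rep_vord ` Hs)"
    using vsmall_lepoll[of "Rep_vord ` Hs" z] inj_on_image_lepoll_1[OF inj_Rep] by blast
  then obtain b where "Hs \<subseteq> {..<b}" using vord_unbounded by blast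
  then have "b \<notin> Hs" by blast
  define L where "L = (LEAST b. b \<notin> Hs)"
  have L: "L \<notin> Hs" unfolding L_def using \<open>b \<notin> Hs\<close> by (rule LeastI)
  have "\<alpha> < L \<longleftrightarrow> \<alpha> \<in> Hs" for \<alpha>
  proof
    show "\<alpha> \<in> Hs" if "\<alpha> < L" using that not_less_Least unfolding L_def by blast
    show "\<alpha> < L" if "\<alpha> \<in> Hs"
    proof (rule ccontr)
      assume "\<not> \<alpha> < L"
      then have "{..<L} \<subseteq> {..<\<alpha>}" by auto
      then have "L \<in> Hs" using that lepoll_trans[OF subset_imp_lepoll] unfolding Hs_def by blast
      then show False using L by blast
    qed
  qed
  then show ?thesis unfolding Hs_def by blast
qed

section \<open>Cardinal successor, omega, and short enumerations\<close>

lemma card_succ_Rep: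
  fixes K L :: "'v::zfc_universe vord"
  assumes L: "\<And>\<alpha>. \<alpha> < L \<longleftrightarrow> {..<\<alpha>} \<lesssim> {..<K}"
  shows "card_succ (Rep_vord K) = Rep_vord L"
proof -
  have L_not: "\<not> {..<L} \<lesssim> {..<K}" using L[of L] by blast
  have KL: "K < L" using L lepoll_refl by blast
  have least: "L \<le> N" if "Card (Rep_vord N)" "K < N" for N
    using that L[of N] unfolding Card_Rep by (meson not_le not_lesspoll_iff)
  have card: "Card (Rep_vord L)"
    unfolding Card_Rep using L L_not by (meson lepoll_trans not_lesspoll_iff)
  show ?thesis
    unfolding card_succ_def
  proof (rule the_equality)
    show "Card (Rep_vord L) \<and> Rep_vord K \<in> elts (Rep_vord L) \<and>
      (\<forall>\<nu>. Card \<nu> \<and> Rep_vord K \<in> elts \<nu> \<longrightarrow> elts (Rep_vord L) \<subseteq> elts \<nu>)"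
    proof (intro conjI allI impI card)
      show "Rep_vord K \<in> elts (Rep_vord L)" using KL by (simp add: less_vord_def)
      fix \<nu> assume \<nu>: "Card \<nu> \<and> Rep_vord K \<in> elts \<nu>"
      then have "\<nu> = Rep_vord (Abs_vord \<nu>)" unfolding Card_def by simp
      then show "elts (Rep_vord L) \<subseteq> elts \<nu>"
        using least[of "Abs_vord \<nu>"] \<nu> elts_subset_iff less_vord_def by metis
    qed
    fix \<mu> assume \<mu>: "Card \<mu> \<and> Rep_vord K \<in> elts \<mu> \<and>
      (\<forall>\<nu>. Card \<nu> \<and> Rep_vord K \<in> elts \<nu> \<longrightarrow> elts \<mu> \<subseteq> elts \<nu>)"
    then have eq: "\<mu> = Rep_vord (Abs_vord \<mu>)" unfolding Card_def by simp
    then have "L \<le> Abs_vord \<mu>"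
      using least[of "Abs_vord \<mu>"] \<mu> less_vord_def by metis
    moreover have "Abs_vord \<mu> \<le> L"
      using \<mu> card KL eq elts_subset_iff less_vord_def by metis
    ultimately show "\<mu> = Rep_vord L" using eq by simp
  qed
qed

text \<open>The axiom of infinity provides only some inductive set z. Induction places every finite
  ordinal in z, so the finite ordinals form a set and the \<open>vset\<close> in the definition is
  meaningful.\<close>

lemma omega_Rep: "\<exists>W :: 'v::zfc_universe vord. omega = Rep_vord W \<and> infinite {..<W}"
proof -
  define F where "F = {n :: 'v vord. finite {..<n}}"
  obtain z e :: 'v where e: "e \<in> elts z" "elts e = {}"
    and z: "\<And>x. x \<in> elts z \<Longrightarrow> \<exists>y\<in>elts z. elts y = insert x (elts x)"
    using ZFC_infinity[where 'a = 'v] by (elim exE conjE bexE) (rule that, auto)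
  have in_z: "Rep_vord n \<in> elts z" if "finite {..<n}" for n
    using that
  proof (induction n rule: less_induct)
    case (less n)
    show ?case
    proof (cases "{..<n} = {}")
      case True
      then have "elts (Rep_vord n) = {}" by (metis Rep_image_lessThan image_empty)
      then show ?thesis using e elts_inject by metis
    next
      case False
      define m where "m = Max {..<n}"
      have m: "m < n" "\<And>y. y < n \<Longrightarrow> y \<le> m"
        unfolding m_def using Max_in[OF less(2) False] Max_ge[OF less(2)] by auto
      then have "{..<n} = insert m {..<m}" by (auto simp: order_le_less)
      then have n: "elts (Rep_vord n) = insert (Rep_vord m) (elts (Rep_vord m))"
        by (metis Rep_image_lessThan image_insert)
      have "finite {..<m}" by (rule finite_subset[OF _ less(2)]) (use m(1) in auto)
      then have "Rep_vord m \<in> elts z" using less(1) m(1) by blast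
      then show ?thesis using z n elts_inject by metis
    qed
  qed
  have down: "m \<in> F" if "m \<le> n" "n \<in> F" for m n
    using that finite_subset[of "{..<m}" "{..<n}"] unfolding F_def by auto
  have "{n. Ord n \<and> finite (elts n)} = Rep_vord ` F"
  proof
    show "Rep_vord ` F \<subseteq> {n. Ord n \<and> finite (elts n)}"
      unfolding F_def by (auto simp: Rep_image_lessThan[symmetric])
    show "{n. Ord n \<and> finite (elts n)} \<subseteq> Rep_vord ` F"
    proof
      fix n :: 'v assume n: "n \<in> {n. Ord n \<and> finite (elts n)}"
      then have "n = Rep_vord (Abs_vord n)" by simp
      moreover from this have "Abs_vord n \<in> F"
        unfolding F_def using n Rep_image_lessThan[of "Abs_vord n"] finite_image_iff[OF inj_Rep] by (metis mem_Collect_eq)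
      ultimately show "n \<in> Rep_vord ` F" by blast
    qed
  qed
  moreover have "vsmall (Rep_vord ` F)"
    by (rule vsmall_subset[OF vsmall_elts[of z]]) (use in_z in \<open>auto simp: F_def\<close>)
  ultimately have om: "elts omega = Rep_vord ` F"
    unfolding omega_def using elts_vset by simp
  obtain b where b: "F \<subseteq> {..<b}" using vord_unbounded \<open>vsmall (Rep_vord ` F)\<close> by blast
  define W where "W = (LEAST b. b \<notin> F)"
  have W: "W \<notin> F" unfolding W_def by (rule LeastI[of _ b]) (use b in blast)
  have "{..<W} = F"
  proof
    show "{..<W} \<subseteq> F" using not_less_Least unfolding W_def by blast
    show "F \<subseteq> {..<W}" using W down by (metis lessThan_iff not_le subsetI)
  qed
  then have "elts omega = elts (Rep_vord W)" using om Rep_image_lessThan by metis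
  then show ?thesis using W elts_inject unfolding F_def by blast
qed

text \<open>The cardinal of X lies strictly below the well-order on \<open>{..<K}\<close>, hence is
  isomorphic to a proper initial segment of it.\<close>

lemma lesspoll_imp_lepoll_initial:
  fixes K :: "'a::wellorder"
  assumes "X \<prec> {..<K}"
  shows "\<exists>\<alpha><K. X \<lesssim> {..<\<alpha>}"
proof -
  define r where "r = {(x, y). x \<le> y \<and> y < K}"
  have Field: "Field r = {..<K}" unfolding r_def Field_def by (auto dest: le_less_trans)
  have "well_order_on {..<K} r"
    unfolding well_order_on_def linear_order_on_def partial_order_on_def preorder_on_def
  proof (intro conjI)
    show "r \<subseteq> {..<K} \<times> {..<K}" "refl_on {..<K} r" "trans r" "antisym r" "total_on {..<K} r"
      unfolding r_def refl_on_def trans_def antisym_def total_on_def by (auto dest: le_less_trans)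
    show "wf (r - Id)"
      by (rule wf_subset[OF wf]) (auto simp: r_def)
  qed
  then have wo: "Well_order r" "well_order_on {..<K} r" using Field by simp_all
  have "ordLeq3 (card_of {..<K}) r" using card_of_least[OF wo(2)] .
  then have "(card_of X, r) \<in> ordLess"
    using assms lesspoll_iff_card_of ordLess_ordLeq_trans by blast
  then obtain a where a: "a \<in> Field r" "(card_of X, Restr r (underS r a)) \<in> ordIso"
    using ordLess_iff_ordIso_Restr[OF wo(1) card_of_Well_order] by blast
  have "Field (Restr r (underS r a)) \<subseteq> {..<a}"
    unfolding Field_def underS_def r_def by auto
  moreover obtain f where "bij_betw f X (Field (Restr r (underS r a)))"
    using a(2) Field_card_of[of X] unfolding ordIso_def iso_def by auto
  ultimately have "X \<lesssim> {..<a}"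
    using subset_imp_lepoll eqpoll_imp_lepoll lepoll_trans unfolding eqpoll_def by metis
  then show ?thesis using a(1) Field by blast
qed

lemma lesspoll_enumeration:
  fixes K :: "'a::wellorder"
  assumes "X \<prec> {..<K}"
  shows "\<exists>\<beta><K. \<exists>g. g ` {..<\<beta>} = X"
proof (cases "X = {}")
  case True
  have "{..<K} \<noteq> {}" using assms not_lesspoll_empty by metis
  then obtain k where k: "k < K" by auto
  \<comment> \<open>Ordinal zero, the length of an enumeration of the empty set.\<close>
  define m where "m = (LEAST x :: 'a. True)"
  have "m \<le> k" "{..<m} = {}" unfolding m_def by (auto intro: Least_le dest: not_less_Least)
  then show ?thesis using True k by (intro exI[of _ m] conjI exI[of _ undefined]) auto
next
  case False
  then obtain x where x: "x \<in> X" by blast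
  obtain \<alpha> where \<alpha>: "\<alpha> < K" "X \<lesssim> {..<\<alpha>}" using lesspoll_imp_lepoll_initial[OF assms] by blast
  obtain g where g: "X \<subseteq> g ` {..<\<alpha>}" using \<alpha>(2) unfolding lepoll_iff by blast
  have "(\<lambda>i. if g i \<in> X then g i else x) ` {..<\<alpha>} = X" using g x by auto
  then show ?thesis using \<alpha>(1) by blast
qed

theorem regular_successor_universe:
  fixes \<kappa> :: "'v::zfc_universe"
  assumes card: "Card \<kappa>" and unc: "elts (card_succ (omega :: 'v)) \<subseteq> elts \<kappa>"
    and pow: "(\<Union>\<alpha>\<in>elts \<kappa>. funs \<alpha> \<kappa>) \<approx> elts \<kappa>"
  shows "\<exists>K L. \<kappa> = Rep_vord K \<and> card_succ \<kappa> = Rep_vord L \<and> regular_successor K L"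
proof -
  define K where "K = Abs_vord \<kappa>"
  have \<kappa>: "\<kappa> = Rep_vord K" using card unfolding K_def Card_def by simp
  obtain L :: "'v vord" where L: "\<And>\<alpha>. \<alpha> < L \<longleftrightarrow> {..<\<alpha>} \<lesssim> {..<K}" using hartogs by blast
  have L_not: "\<not> {..<L} \<lesssim> {..<K}" using L[of L] by blast
  obtain W :: "'v vord" where W: "omega = Rep_vord W" "infinite {..<W}" using omega_Rep by blast
  obtain W1 :: "'v vord" where W1: "\<And>\<alpha>. \<alpha> < W1 \<longleftrightarrow> {..<\<alpha>} \<lesssim> {..<W}" using hartogs by blast
  have W1K: "W1 \<le> K" using unc unfolding W(1) card_succ_Rep[OF W1] \<kappa> elts_subset_iff .
  have natK: "(UNIV :: nat set) \<prec> {..<K}"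
  proof (rule ccontr)
    assume "\<not> ?thesis"
    then have "{..<K} \<lesssim> (UNIV :: nat set)" unfolding not_lesspoll_iff .
    then have "{..<K} \<lesssim> {..<W}" using W(2) lepoll_trans unfolding infinite_le_lepoll by blast
    then show False using W1[of K] W1K by simp
  qed
  then have inf: "infinite {..<K}" using lesspoll_imp_lepoll unfolding infinite_le_lepoll by blast
  have "regular_successor K L"
  proof
    show "K < L" using L lepoll_refl by blast
    show "(UNIV :: nat set) \<prec> {..<K}" by (rule natK)
    show "{..<x} \<prec> {..<K}" if "x < K" for x using card that unfolding \<kappa> Card_Rep by blast
    show "{..<x} \<lesssim> {..<K}" if "x < L" for x using L that by blast
    show "\<exists>b<L. X \<subseteq> {..<b}" if X: "X \<subseteq> {..<L}" "X \<lesssim> {..<K}" for X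
    proof (rule ccontr)
      assume N: "\<not> ?thesis"
      have "{..<L} \<subseteq> (\<Union>x\<in>X. {..x})"
      proof
        fix b assume "b \<in> {..<L}"
        then obtain x where "x \<in> X" "\<not> x < b" using N by blast
        moreover from this have "b \<le> x" by simp
        ultimately show "b \<in> (\<Union>x\<in>X. {..x})" by blast
      qed
      moreover have "{..x} \<lesssim> {..<K}" if "x \<in> X" for x
      proof -
        have "{..x} = insert x {..<x}" by auto
        moreover have "{..<x} \<lesssim> {..<K}" using X(1) L that by blast
        ultimately show ?thesis
          using lepoll_Un_infinite[OF inf finite_lepoll_infinite[OF inf], of "{x}" "{..<x}"] by simp
      qed
      ultimately have "{..<L} \<lesssim> {..<K}"
        using lepoll_UN_infinite[OF inf X(2), of "\<lambda>x. {..x}"] subset_imp_lepoll lepoll_trans by blast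
      then show False using L_not by blast
    qed
    show "{X. X \<subseteq> {..<K} \<and> X \<prec> {..<K}} \<lesssim> {..<K}"
    proof -
      \<comment> \<open>Sends a function to its set of values; every small subset of K is the range
        of a short sequence, so there are at most as many small subsets as sequences.\<close>
      define R where "R f = {y. \<exists>x. opair x (Rep_vord y) \<in> elts f}" for f :: 'v
      have "X \<in> R ` (\<Union>\<alpha>\<in>elts \<kappa>. funs \<alpha> \<kappa>)" if X: "X \<subseteq> {..<K}" "X \<prec> {..<K}" for X
      proof -
        obtain \<beta> g where \<beta>: "\<beta> < K" "g ` {..<\<beta>} = X"
          using lesspoll_enumeration[OF X(2)] by blast
        define G where "G u = Rep_vord (g (Abs_vord u))" for u
        have "G ` elts (Rep_vord \<beta>) = Rep_vord ` X"
          unfolding Rep_image_lessThan[symmetric] \<beta>(2)[symmetric] G_def image_image Rep_vord_inverse ..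
        then have "graph G (Rep_vord \<beta>) \<in> funs (Rep_vord \<beta>) \<kappa>"
          unfolding funs_eq \<kappa> using X(1) Rep_image_lessThan[of K] by (intro CollectI exI[of _ G]) auto
        moreover have "Rep_vord \<beta> \<in> elts \<kappa>" using \<beta>(1) unfolding \<kappa> less_vord_def .
        moreover have "R (graph G (Rep_vord \<beta>)) = X"
        proof -
          have "R (graph G (Rep_vord \<beta>)) = {y. Rep_vord y \<in> G ` elts (Rep_vord \<beta>)}"
            unfolding R_def by auto
          also have "\<dots> = X"
            unfolding \<open>G ` elts (Rep_vord \<beta>) = Rep_vord ` X\<close> by (auto simp: Rep_vord_inject)
          finally show ?thesis .
        qed
        ultimately show ?thesis by blast
      qed
      then have "{X. X \<subseteq> {..<K} \<and> X \<prec> {..<K}} \<lesssim> (\<Union>\<alpha>\<in>elts \<kappa>. funs \<alpha> \<kappa>)"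
        by (intro subset_image_lepoll) blast
      then have "{X. X \<subseteq> {..<K} \<and> X \<prec> {..<K}} \<lesssim> elts \<kappa>" using pow by (rule lepoll_trans2)
      then show ?thesis unfolding \<kappa> lepoll_elts_Rep .
    qed
  qed
  then show ?thesis using \<kappa> card_succ_Rep[OF L] by blast
qed

section \<open>Formulas and coded forcing notions\<close>

definition forcing_of :: "('p \<Rightarrow> 'v::zfc_universe) \<Rightarrow> 'p set \<Rightarrow> ('p \<Rightarrow> 'p \<Rightarrow> bool) \<Rightarrow> 'v"
  where "forcing_of code C le = opair (vset (code ` C))
    (vset {opair (code q) (code p) | q p. q \<in> C \<and> p \<in> C \<and> le q p})"

lemma vfst_opair [simp]: "vfst (opair a b) = a"
  unfolding vfst_def by auto

lemma vsnd_opair [simp]: "vsnd (opair a b) = b"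
  unfolding vsnd_def by auto

context
  fixes code :: "'p \<Rightarrow> 'v::zfc_universe" and C :: "'p set" and le :: "'p \<Rightarrow> 'p \<Rightarrow> bool"
  assumes inj: "inj_on code C" and sm: "vsmall (code ` C)"
begin

lemma conds_forcing_of: "conds (forcing_of code C le) = code ` C"
  unfolding forcing_of_def by (simp add: elts_vset sm)

lemma elts_le_forcing_of:
  "elts (vset {opair (code q) (code p) | q p. q \<in> C \<and> p \<in> C \<and> le q p}) =
    {opair (code q) (code p) | q p. q \<in> C \<and> p \<in> C \<and> le q p}"
proof (rule elts_vset, rule vsmall_subset)
  show "vsmall (\<Union>u\<in>code ` C. opair u ` (code ` C))"
    by (intro vsmall_UN vsmall_image sm)
qed auto

lemma fle_forcing_of: "\<lbrakk>q \<in> C; p \<in> C\<rbrakk> \<Longrightarrow> fle (forcing_of code C le) (code q) (code p) \<longleftrightarrow> le q p"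
  unfolding fle_def forcing_of_def vsnd_opair elts_le_forcing_of using inj by (auto dest: inj_onD)

lemma compat_forcing_of:
  "\<lbrakk>q \<in> C; p \<in> C\<rbrakk> \<Longrightarrow> compat (forcing_of code C le) (code q) (code p) \<longleftrightarrow> (\<exists>r\<in>C. le r q \<and> le r p)"
  unfolding compat_def conds_forcing_of by (auto simp: fle_forcing_of)

lemma forcing_notion_forcing_of:
  assumes "C \<noteq> {}" "\<And>p. le p p" "\<And>p q r. \<lbrakk>le r q; le q p\<rbrakk> \<Longrightarrow> le r p"
  shows "forcing_notion (forcing_of code C le)"
  unfolding forcing_notion_def
proof (intro exI conjI)
  show "forcing_of code C le = opair (vset (code ` C))
    (vset {opair (code q) (code p) | q p. q \<in> C \<and> p \<in> C \<and> le q p})"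
    by (rule forcing_of_def)
  show "elts (vset (code ` C)) \<noteq> {}" using assms(1) by (simp add: elts_vset sm)
  show "elts (vset {opair (code q) (code p) | q p. q \<in> C \<and> p \<in> C \<and> le q p})
    \<subseteq> {opair q p |q p. q \<in> elts (vset (code ` C)) \<and> p \<in> elts (vset (code ` C))}"
    unfolding elts_le_forcing_of by (auto simp: elts_vset sm)
  have R: "{(q, p). opair q p \<in> elts (vset {opair (code q) (code p) | q p. q \<in> C \<and> p \<in> C \<and> le q p})}
    = {(code q, code p) | q p. q \<in> C \<and> p \<in> C \<and> le q p}"
    unfolding elts_le_forcing_of by auto
  show "preorder_on (elts (vset (code ` C)))
    {(q, p). opair q p \<in> elts (vset {opair (code q) (code p) | q p. q \<in> C \<and> p \<in> C \<and> le q p})}"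
    unfolding preorder_on_def R elts_vset[OF sm]
  proof (intro conjI)
    show "trans {(code q, code p) | q p. q \<in> C \<and> p \<in> C \<and> le q p}"
      unfolding trans_def using assms(3) inj by (fastforce dest: inj_onD)
  qed (use assms(2) in \<open>auto simp: refl_on_def\<close>)
qed

end

section \<open>Formulas and their absoluteness in transitive classes\<close>

definition Imp_fm :: "fm \<Rightarrow> fm \<Rightarrow> fm" where "Imp_fm \<phi> \<psi> = Neg (Conj \<phi> (Neg \<psi>))"
definition Or_fm :: "fm \<Rightarrow> fm \<Rightarrow> fm" where "Or_fm \<phi> \<psi> = Neg (Conj (Neg \<phi>) (Neg \<psi>))"
definition All_fm :: "nat \<Rightarrow> fm \<Rightarrow> fm" where "All_fm i \<phi> = Neg (Exists i (Neg \<phi>))"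

lemma sat_connectives [simp]:
  "sat A s (Imp_fm \<phi> \<psi>) \<longleftrightarrow> (sat A s \<phi> \<longrightarrow> sat A s \<psi>)"
  "sat A s (Or_fm \<phi> \<psi>) \<longleftrightarrow> sat A s \<phi> \<or> sat A s \<psi>"
  "sat A s (All_fm i \<phi>) \<longleftrightarrow> (\<forall>x\<in>A. sat A (s(i := x)) \<phi>)"
  by (simp_all add: Imp_fm_def Or_fm_def All_fm_def)

text \<open>Kuratowski pairs; the bound variables are 20, 21, 22.\<close>

definition Pair_fm :: "nat \<Rightarrow> nat \<Rightarrow> nat \<Rightarrow> fm" where
  "Pair_fm k i j = Exists 20 (Exists 21 (Conj (Mem 20 k) (Conj (Mem 21 k)
    (Conj (All_fm 22 (Imp_fm (Mem 22 k) (Or_fm (Eq 22 20) (Eq 22 21))))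
    (Conj (Conj (Mem i 20) (All_fm 22 (Imp_fm (Mem 22 20) (Eq 22 i))))
      (Conj (Mem i 21) (Conj (Mem j 21) (All_fm 22 (Imp_fm (Mem 22 21) (Or_fm (Eq 22 i) (Eq 22 j)))))))))))"

definition mem_transitive :: "'v::zfc_universe set \<Rightarrow> bool"
  where "mem_transitive B \<longleftrightarrow> (\<forall>x\<in>B. elts x \<subseteq> B)"

lemma mem_transitiveD: "\<lbrakk>mem_transitive B; x \<in> B; y \<in> elts x\<rbrakk> \<Longrightarrow> y \<in> B"
  unfolding mem_transitive_def by blast

lemma opair_mem_transitive:
  assumes "mem_transitive B" "opair x y \<in> B"
  shows "x \<in> B" "y \<in> B"
proof -
  have "vset {x, y} \<in> B" using mem_transitiveD[OF assms, of "vset {x, y}"] by (simp add: elts_opair)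
  from mem_transitiveD[OF assms(1) this] show "x \<in> B" "y \<in> B" by simp_all
qed

text \<open>All quantifiers are in effect bounded by \<open>s k\<close> and its elements, hence
  absolute. The variables must stay below 20 to avoid capture.\<close>

lemma sat_Pair_fm:
  assumes B: "mem_transitive B" "s i \<in> B" "s j \<in> B" "s k \<in> B" and n: "i < 20" "j < 20" "k < 20"
  shows "sat B s (Pair_fm k i j) \<longleftrightarrow> s k = opair (s i) (s j)"
proof -
  have "sat B s (Pair_fm k i j) \<longleftrightarrow> (\<exists>u\<in>B. \<exists>v\<in>B. u \<in> elts (s k) \<and> v \<in> elts (s k) \<and>
     (\<forall>w\<in>B. w \<in> elts (s k) \<longrightarrow> w = u \<or> w = v) \<and> (s i \<in> elts u \<and> (\<forall>w\<in>B. w \<in> elts u \<longrightarrow> w = s i)) \<and>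
     s i \<in> elts v \<and> s j \<in> elts v \<and> (\<forall>w\<in>B. w \<in> elts v \<longrightarrow> w = s i \<or> w = s j))"
    unfolding Pair_fm_def using n by simp
  also have "\<dots> \<longleftrightarrow> s k = opair (s i) (s j)"
  proof
    assume "\<exists>u\<in>B. \<exists>v\<in>B. u \<in> elts (s k) \<and> v \<in> elts (s k) \<and>
     (\<forall>w\<in>B. w \<in> elts (s k) \<longrightarrow> w = u \<or> w = v) \<and> (s i \<in> elts u \<and> (\<forall>w\<in>B. w \<in> elts u \<longrightarrow> w = s i)) \<and>
     s i \<in> elts v \<and> s j \<in> elts v \<and> (\<forall>w\<in>B. w \<in> elts v \<longrightarrow> w = s i \<or> w = s j)"
    then obtain u v where uv: "u \<in> B" "v \<in> B" "u \<in> elts (s k)" "v \<in> elts (s k)"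
      "\<forall>w\<in>B. w \<in> elts (s k) \<longrightarrow> w = u \<or> w = v" "s i \<in> elts u" "\<forall>w\<in>B. w \<in> elts u \<longrightarrow> w = s i"
      "s i \<in> elts v" "s j \<in> elts v" "\<forall>w\<in>B. w \<in> elts v \<longrightarrow> w = s i \<or> w = s j" by blast
    have "elts u = elts (vset {s i})" using uv mem_transitiveD[OF B(1) uv(1)] by auto
    moreover have "elts v = elts (vset {s i, s j})" using uv mem_transitiveD[OF B(1) uv(2)] by auto
    moreover have "elts (s k) = {u, v}" using uv mem_transitiveD[OF B(1,4)] by blast
    ultimately have "elts (s k) = elts (opair (s i) (s j))" unfolding elts_inject elts_opair by simp
    then show "s k = opair (s i) (s j)" unfolding elts_inject .
  next
    assume "s k = opair (s i) (s j)"
    then have el: "elts (s k) = {vset {s i}, vset {s i, s j}}" by (simp add: elts_opair)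
    then have "vset {s i} \<in> B" "vset {s i, s j} \<in> B" using mem_transitiveD[OF B(1,4)] by auto
    then show "\<exists>u\<in>B. \<exists>v\<in>B. u \<in> elts (s k) \<and> v \<in> elts (s k) \<and>
     (\<forall>w\<in>B. w \<in> elts (s k) \<longrightarrow> w = u \<or> w = v) \<and> (s i \<in> elts u \<and> (\<forall>w\<in>B. w \<in> elts u \<longrightarrow> w = s i)) \<and>
     s i \<in> elts v \<and> s j \<in> elts v \<and> (\<forall>w\<in>B. w \<in> elts v \<longrightarrow> w = s i \<or> w = s j)"
      unfolding el by (intro bexI[of _ "vset {s i}"] bexI[of _ "vset {s i, s j}"]) auto
  qed
  finally show ?thesis .
qed

text \<open>Meaning is computed only in the transitive \<open>H \<theta>\<close>; the model M need
  not be transitive and is reached through elementarity.\<close>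

definition assigns :: "'v::zfc_universe set \<Rightarrow> (nat \<Rightarrow> 'v) \<Rightarrow> bool"
  where "assigns B s \<longleftrightarrow> mem_transitive B \<and> (\<forall>n. s n \<in> B)"

lemma assigns_upd: "\<lbrakk>assigns B s; x \<in> B\<rbrakk> \<Longrightarrow> assigns B (s(n := x))"
  unfolding assigns_def by simp

lemma assigns_elts: "\<lbrakk>assigns B s; y \<in> elts (s n)\<rbrakk> \<Longrightarrow> y \<in> B"
  unfolding assigns_def using mem_transitiveD by blast

lemma assigns_opair:
  assumes "assigns B s" "opair x y \<in> elts (s n)"
  shows "x \<in> B" "y \<in> B"
  using assigns_elts[OF assms] opair_mem_transitive assms(1) unfolding assigns_def by blast+

lemma sat_Pair_fm':
  "\<lbrakk>assigns B s; i < 20; j < 20; k < 20\<rbrakk> \<Longrightarrow> sat B s (Pair_fm k i j) \<longleftrightarrow> s k = opair (s i) (s j)"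
  using sat_Pair_fm unfolding assigns_def by blast

text \<open>Free variables: 0 the forcing \<open>(A, R)\<close>, 1 a function, 2 a function, 3 \<open>A\<close>, 4 \<open>R\<close>,
  5 the top condition, 6 one of its elements, 7 the range of 6 together with 5, 8 a condition.\<close>

definition top_fm :: fm where
  "top_fm = All_fm 9 (Imp_fm (Mem 9 3) (Exists 10 (Conj (Mem 10 4) (Pair_fm 10 9 5))))"

definition in_range_fm :: fm where
  "in_range_fm = Or_fm (Eq 9 5) (Exists 10 (Exists 11 (Conj (Mem 10 6) (Pair_fm 10 11 9))))"

definition range_fm :: fm where
  "range_fm = All_fm 9 (Conj (Imp_fm (Mem 9 7) in_range_fm) (Imp_fm in_range_fm (Mem 9 7)))"

definition maps_fm :: fm where
  "maps_fm = All_fm 9 (Imp_fm (Mem 9 2) (All_fm 10 (All_fm 11 (Imp_fm (Pair_fm 9 10 11) (Mem 11 7)))))"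

definition closed_fm :: fm where
  "closed_fm = All_fm 9 (Imp_fm (Mem 9 1) (All_fm 10 (All_fm 11 (Imp_fm (Pair_fm 9 10 11)
     (Imp_fm (All_fm 12 (Imp_fm (Mem 12 10) (Mem 12 7))) (Mem 11 7))))))"

lemma sat_top_fm:
  assumes s: "assigns B s"
  shows "sat B s top_fm \<longleftrightarrow> (\<forall>u\<in>elts (s 3). opair u (s 5) \<in> elts (s 4))"
proof -
  have "sat B s top_fm \<longleftrightarrow>
    (\<forall>u\<in>B. u \<in> elts (s 3) \<longrightarrow> (\<exists>z\<in>B. z \<in> elts (s 4) \<and> z = opair u (s 5)))"
    unfolding top_fm_def by (simp add: sat_Pair_fm' assigns_upd s cong: ball_cong bex_cong)
  also have "\<dots> \<longleftrightarrow> (\<forall>u\<in>elts (s 3). opair u (s 5) \<in> elts (s 4))"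
    using assigns_elts[OF s] by blast
  finally show ?thesis .
qed

lemma sat_in_range_fm:
  assumes s: "assigns B s"
  shows "sat B s in_range_fm \<longleftrightarrow> s 9 = s 5 \<or> (\<exists>y. opair y (s 9) \<in> elts (s 6))"
proof -
  have "sat B s in_range_fm \<longleftrightarrow>
    s 9 = s 5 \<or> (\<exists>z\<in>B. \<exists>y\<in>B. z \<in> elts (s 6) \<and> z = opair y (s 9))"
    unfolding in_range_fm_def by (simp add: sat_Pair_fm' assigns_upd s cong: ball_cong bex_cong)
  also have "(\<exists>z\<in>B. \<exists>y\<in>B. z \<in> elts (s 6) \<and> z = opair y (s 9)) \<longleftrightarrow> (\<exists>y. opair y (s 9) \<in> elts (s 6))"
    using assigns_elts[OF s, of _ 6] assigns_opair[OF s, of _ "s 9" 6] by auto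
  finally show ?thesis .
qed

lemma sat_range_fm:
  assumes s: "assigns B s"
  shows "sat B s range_fm \<longleftrightarrow>
    (\<forall>u. u \<in> elts (s 7) \<longleftrightarrow> u = s 5 \<or> (\<exists>y. opair y u \<in> elts (s 6)))"
proof -
  have "sat B s range_fm \<longleftrightarrow>
    (\<forall>u\<in>B. u \<in> elts (s 7) \<longleftrightarrow> u = s 5 \<or> (\<exists>y. opair y u \<in> elts (s 6)))"
    unfolding range_fm_def by (auto simp add: sat_in_range_fm assigns_upd s)
  also have "\<dots> \<longleftrightarrow> (\<forall>u. u \<in> elts (s 7) \<longleftrightarrow> u = s 5 \<or> (\<exists>y. opair y u \<in> elts (s 6)))"
    using assigns_elts[OF s, of _ 7] assigns_opair[OF s, of _ _ 6] s unfolding assigns_def by metis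
  finally show ?thesis .
qed

lemma sat_maps_fm:
  assumes s: "assigns B s"
  shows "sat B s maps_fm \<longleftrightarrow> (\<forall>i y. opair i y \<in> elts (s 2) \<longrightarrow> y \<in> elts (s 7))"
proof -
  have "sat B s maps_fm \<longleftrightarrow>
    (\<forall>z\<in>B. z \<in> elts (s 2) \<longrightarrow> (\<forall>i\<in>B. \<forall>y\<in>B. z = opair i y \<longrightarrow> y \<in> elts (s 7)))"
    unfolding maps_fm_def by (simp add: sat_Pair_fm' assigns_upd s cong: ball_cong bex_cong)
  also have "\<dots> \<longleftrightarrow> (\<forall>i y. opair i y \<in> elts (s 2) \<longrightarrow> y \<in> elts (s 7))"
    using assigns_elts[OF s, of _ 2] assigns_opair[OF s, of _ _ 2] by auto
  finally show ?thesis .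
qed

lemma sat_closed_fm:
  assumes s: "assigns B s"
  shows "sat B s closed_fm \<longleftrightarrow>
    (\<forall>a y. opair a y \<in> elts (s 1) \<longrightarrow> elts a \<subseteq> elts (s 7) \<longrightarrow> y \<in> elts (s 7))"
proof -
  have "sat B s closed_fm \<longleftrightarrow>
    (\<forall>z\<in>B. z \<in> elts (s 1) \<longrightarrow> (\<forall>a\<in>B. \<forall>y\<in>B. z = opair a y \<longrightarrow>
      (\<forall>v\<in>B. v \<in> elts a \<longrightarrow> v \<in> elts (s 7)) \<longrightarrow> y \<in> elts (s 7)))"
    unfolding closed_fm_def by (simp add: sat_Pair_fm' assigns_upd s cong: ball_cong bex_cong)
  also have "\<dots> \<longleftrightarrow>
    (\<forall>a\<in>B. \<forall>y\<in>B. opair a y \<in> elts (s 1) \<longrightarrow> (\<forall>v\<in>B. v \<in> elts a \<longrightarrow> v \<in> elts (s 7)) \<longrightarrow> y \<in> elts (s 7))"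
    using assigns_elts[OF s, of _ 1] by auto
  also have "\<dots> \<longleftrightarrow>
    (\<forall>a\<in>B. \<forall>y\<in>B. opair a y \<in> elts (s 1) \<longrightarrow> elts a \<subseteq> elts (s 7) \<longrightarrow> y \<in> elts (s 7))"
  proof (intro ball_cong refl)
    fix a y assume "a \<in> B"
    then have "elts a \<subseteq> B" using s mem_transitiveD unfolding assigns_def by blast
    then show "(opair a y \<in> elts (s 1) \<longrightarrow> (\<forall>v\<in>B. v \<in> elts a \<longrightarrow> v \<in> elts (s 7)) \<longrightarrow> y \<in> elts (s 7)) \<longleftrightarrow>
      (opair a y \<in> elts (s 1) \<longrightarrow> elts a \<subseteq> elts (s 7) \<longrightarrow> y \<in> elts (s 7))" by blast
  qed
  also have "\<dots> \<longleftrightarrow> (\<forall>a y. opair a y \<in> elts (s 1) \<longrightarrow> elts a \<subseteq> elts (s 7) \<longrightarrow> y \<in> elts (s 7))"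
    using assigns_opair[OF s, of _ _ 1] by blast
  finally show ?thesis .
qed

text \<open>Variable 7 will be \<open>node \<gamma>\<close>: it contains the range of function 2 and
  is closed under function 1. Condition 8 outside it ensures that \<gamma> stays below the supremum
  of the model.\<close>

definition closed_set_fm :: fm where
  "closed_set_fm = Conj (Pair_fm 0 3 4) (Conj (Mem 5 3) (Conj top_fm (Conj (Mem 6 5)
    (Conj range_fm (Conj (Mem 8 3) (Conj (Neg (Mem 8 7)) (Conj maps_fm closed_fm)))))))"

lemma sat_closed_set_fm:
  assumes s: "assigns B s"
  shows "sat B s closed_set_fm \<longleftrightarrow> s 0 = opair (s 3) (s 4) \<and> s 5 \<in> elts (s 3) \<and>
    (\<forall>u\<in>elts (s 3). opair u (s 5) \<in> elts (s 4)) \<and> s 6 \<in> elts (s 5) \<and>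
    (\<forall>u. u \<in> elts (s 7) \<longleftrightarrow> u = s 5 \<or> (\<exists>y. opair y u \<in> elts (s 6))) \<and>
    s 8 \<in> elts (s 3) \<and> s 8 \<notin> elts (s 7) \<and>
    (\<forall>i y. opair i y \<in> elts (s 2) \<longrightarrow> y \<in> elts (s 7)) \<and>
    (\<forall>a y. opair a y \<in> elts (s 1) \<longrightarrow> elts a \<subseteq> elts (s 7) \<longrightarrow> y \<in> elts (s 7))"
  unfolding closed_set_fm_def sat.simps sat_Pair_fm'[OF s, simplified] sat_top_fm[OF s]
    sat_range_fm[OF s] sat_maps_fm[OF s] sat_closed_fm[OF s]
  by (simp add: sat_Pair_fm'[OF s])

section \<open>Closure properties of \<open>H \<theta>\<close>\<close>

lemma trcl_mem: "y \<in> elts x \<Longrightarrow> trcl y \<subseteq> trcl x"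
  unfolding trcl_def by (auto intro: trancl_into_trancl)

lemma trcl_subset:
  assumes "elts y \<subseteq> elts x"
  shows "trcl y \<subseteq> trcl x"
proof
  fix z assume "z \<in> trcl y"
  then have "(z, y) \<in> {(u, w). u \<in> elts w}\<^sup>+" unfolding trcl_def by blast
  then have "(z, x) \<in> {(u, w). u \<in> elts w}\<^sup>+"
    by (cases rule: tranclE) (use assms in \<open>auto intro: trancl_into_trancl\<close>)
  then show "z \<in> trcl x" unfolding trcl_def by blast
qed

lemma H_transitive: "mem_transitive (H \<theta>)"
  unfolding mem_transitive_def H_def using lesspoll_trans1[OF subset_imp_lepoll[OF trcl_mem]] by blast

lemma H_subset: "\<lbrakk>x \<in> H \<theta>; elts y \<subseteq> elts x\<rbrakk> \<Longrightarrow> y \<in> H \<theta>"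
  unfolding H_def using lesspoll_trans1[OF subset_imp_lepoll[OF trcl_subset]] by blast

section \<open>Strong properness\<close>

text \<open>Closure of M under short sequences yields these functions at once, whereas membership of
  the ordinals themselves would need further axioms in \<open>H \<theta>\<close>. They serve as
  indices in \<open>h \<gamma>\<close>.\<close>

definition const_graph :: "'v::zfc_universe \<Rightarrow> 'v"
  where "const_graph = graph (\<lambda>_. vset {})"

lemma const_graph_inject: "const_graph x = const_graph y \<longleftrightarrow> x = y"
proof
  assume "const_graph x = const_graph y"
  then have "opair z (vset {}) \<in> elts (const_graph x) \<longleftrightarrow> opair z (vset {}) \<in> elts (const_graph y)" for z
    by simp
  then have "elts x = elts y" unfolding const_graph_def by auto
  then show "x = y" unfolding elts_inject .
qed simp

text \<open>The top condition is coded by a set of functions \<open>h \<gamma>\<close> that enumerate the codes of the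
  other conditions in \<open>below c \<gamma>\<close>. This makes \<open>below c \<gamma>\<close> definable from the forcing notion alone,
  and \<open>h \<gamma>\<close> has a domain that is contained in every model closed under short sequences.\<close>

locale coded_forcing = regular_successor K L
  for K L :: "'v::zfc_universe vord" +
  fixes c :: "'v vord \<Rightarrow> 'v vord set"
    and code :: "'v vord set \<times> 'v vord set set \<Rightarrow> 'v"
    and h :: "'v vord \<Rightarrow> 'v"
  assumes c: "\<And>\<delta>. \<delta> \<in> S \<Longrightarrow> ladder \<delta> (c \<delta>)"
    and code_inj: "inj_on code (conditions c)"
    and code_small: "vsmall (code ` conditions c)"
    and top_elts: "elts (code ({}, {})) = h ` {K<..<L}"
    and h_range: "\<And>\<gamma> u. \<gamma> \<in> {K<..<L} \<Longrightarrow>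
      (\<exists>y. opair y u \<in> elts (h \<gamma>)) \<longleftrightarrow> u \<in> code ` (below c \<gamma> - {({}, {})})"
    and h_dom: "\<And>\<gamma> y u. \<lbrakk>\<gamma> \<in> {K<..<L}; opair y u \<in> elts (h \<gamma>)\<rbrakk> \<Longrightarrow> y \<in> const_graph ` elts (Rep_vord K)"
    and h_fun: "\<And>\<gamma> y u u'. \<lbrakk>\<gamma> \<in> {K<..<L}; opair y u \<in> elts (h \<gamma>); opair y u' \<in> elts (h \<gamma>)\<rbrakk> \<Longrightarrow> u = u'"

text \<open>All conditions but the top keep an arbitrary code \<open>j\<close>; the top is recoded
  as the set of enumerations. Only \<gamma> above K are listed, where
  \<open>below c \<gamma>\<close> has exactly K elements besides the top.\<close>

lemma coded_forcing_exists:
  fixes K L :: "'v::zfc_universe vord"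
  assumes RS: "regular_successor K L" and c: "\<And>\<delta>. \<delta> \<in> regular_successor.S K L \<Longrightarrow> regular_successor.ladder K \<delta> (c \<delta>)"
  shows "\<exists>code h. coded_forcing K L c code h"
proof -
  interpret regular_successor K L by (rule RS)
  let ?C = "conditions c" and ?top = "({}, {}) :: 'v vord set \<times> 'v vord set set"
  have C: "?C \<subseteq> Pow {..<L} \<times> Pow (Pow {..<L})"
  proof
    fix p assume p: "p \<in> ?C"
    then have "D \<in> Pow {..<L}" if "D \<in> snd p" for D
      using obstacle_bounded[OF c, of D] conditionsD(3)[OF p] that by (auto dest: le_less_trans)
    then show "p \<in> Pow {..<L} \<times> Pow (Pow {..<L})"
      using conditionsD(1)[OF p] by (auto simp: mem_Times_iff)
  qed
  have "{..<L} \<lesssim> elts (Rep_vord L)" using lepoll_elts_Rep by blast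
  then obtain x :: 'v where x: "Pow {..<L} \<lesssim> elts x"
    using Pow_lepoll_elts by blast
  then obtain y :: 'v where "Pow (Pow {..<L}) \<lesssim> elts y"
    using Pow_lepoll_elts by blast
  with x obtain z :: 'v where "Pow {..<L} \<times> Pow (Pow {..<L}) \<lesssim> elts z" using Times_lepoll_elts by blast
  then have "?C \<lesssim> elts z" using lepoll_trans[OF subset_imp_lepoll[OF C]] by blast
  then obtain j where j: "inj_on j ?C" "j ` ?C \<subseteq> elts z" unfolding lepoll_def by blast
  have "\<forall>\<gamma>. \<exists>e. \<gamma> \<in> {K<..<L} \<longrightarrow> e ` {..<K} = below c \<gamma> - {?top}"
  proof
    fix \<gamma>
    show "\<exists>e. \<gamma> \<in> {K<..<L} \<longrightarrow> e ` {..<K} = below c \<gamma> - {?top}"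
    proof (cases "\<gamma> \<in> {K<..<L}")
      case True
      then have "below c \<gamma> - {?top} \<lesssim> {..<K}"
        by (intro lepoll_trans[OF subset_imp_lepoll below_lepoll[OF c]]) auto
      moreover have "{..<K} \<lesssim> below c \<gamma> - {?top}" using True by (intro lepoll_below[OF c]) auto
      ultimately have "{..<K} \<approx> below c \<gamma> - {?top}" by (intro lepoll_antisym)
      then show ?thesis unfolding eqpoll_def bij_betw_def by blast
    qed blast
  qed
  from choice[OF this] obtain e where e: "\<And>\<gamma>. \<gamma> \<in> {K<..<L} \<Longrightarrow> e \<gamma> ` {..<K} = below c \<gamma> - {?top}"
    by blast
  define h where "h \<gamma> = vset ((\<lambda>x. opair (const_graph x) (j (e \<gamma> (Abs_vord x)))) ` elts (Rep_vord K))" for \<gamma>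
  have h: "elts (h \<gamma>) = (\<lambda>x. opair (const_graph x) (j (e \<gamma> (Abs_vord x)))) ` elts (Rep_vord K)" for \<gamma>
    unfolding h_def by (rule elts_vset[OF vsmall_image]) simp
  have h_iff: "opair y u \<in> elts (h \<gamma>) \<longleftrightarrow> (\<exists>i<K. y = const_graph (Rep_vord i) \<and> u = j (e \<gamma> i))" for y u \<gamma>
    unfolding h Rep_image_lessThan[symmetric] by (auto simp: image_image Rep_vord_inverse)
  have h_ran: "(\<exists>y. opair y u \<in> elts (h \<gamma>)) \<longleftrightarrow> u \<in> j ` (below c \<gamma> - {?top})" if "\<gamma> \<in> {K<..<L}" for u \<gamma>
    unfolding h_iff e[OF that, symmetric] by auto
  define t where "t = vset (h ` {K<..<L})"
  have "h ` {K<..<L} \<subseteq> (\<lambda>x. h (Abs_vord x)) ` elts (Rep_vord L)"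
    unfolding Rep_image_lessThan[symmetric] by (auto simp: image_image Rep_vord_inverse)
  then have t: "elts t = h ` {K<..<L}"
    unfolding t_def by (intro elts_vset vsmall_subset[OF vsmall_image[OF vsmall_elts]])
  define code where "code r = (if r = ?top then t else j r)" for r
  \<comment> \<open>Injectivity survives the recoding: r occurs as a value in some
    \<open>h \<gamma>\<close>, so \<open>j r = t\<close> would violate foundation.\<close>
  have t_new: "j r \<noteq> t" if r: "r \<in> ?C" "r \<noteq> ?top" for r
  proof
    assume jr: "j r = t"
    obtain \<gamma>' where \<gamma>': "\<gamma>' < L" "r \<in> below c \<gamma>'" using condition_below[OF c r(1)] by blast
    obtain k where k: "K < k" "k < L" using L_limit[OF K_less_L] by blast
    have \<gamma>: "max k \<gamma>' \<in> {K<..<L}" using k \<gamma>'(1) by (auto simp: less_max_iff_disj)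
    have "r \<in> below c (max k \<gamma>')" using \<gamma>'(2) below_mono[of \<gamma>' "max k \<gamma>'" c] by auto
    then obtain y where y: "opair y (j r) \<in> elts (h (max k \<gamma>'))" using h_ran[OF \<gamma>] r(2) by blast
    have "h (max k \<gamma>') \<in> elts (j r)" unfolding jr t using \<gamma> by blast
    then show False
      using mem_acyclic[of "j r" "vset {y, j r}" "opair y (j r)" "h (max k \<gamma>')"] y by (simp add: elts_opair)
  qed
  have code_eq: "code ` (below c \<gamma> - {?top}) = j ` (below c \<gamma> - {?top})" for \<gamma>
    unfolding code_def by (intro image_cong) auto
  have "coded_forcing K L c code h"
  proof (unfold_locales)
    show "ladder \<delta> (c \<delta>)" if "\<delta> \<in> S" for \<delta> using c[OF that] .
    show "inj_on code ?C"
    proof (rule inj_onI)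
      fix p q assume "p \<in> ?C" "q \<in> ?C" "code p = code q"
      then show "p = q" using t_new[of p] t_new[of q] inj_onD[OF j(1), of p q]
        unfolding code_def by (auto split: if_splits)
    qed
    have "code ` ?C \<subseteq> insert t (j ` ?C)" unfolding code_def by auto
    moreover have "vsmall (insert t (j ` ?C))" by (intro vsmall_insert vsmall_subset[OF vsmall_elts j(2)])
    ultimately show "vsmall (code ` ?C)" using vsmall_subset by blast
    show "elts (code ?top) = h ` {K<..<L}" unfolding code_def by (simp add: t)
    show "(\<exists>y. opair y u \<in> elts (h \<gamma>)) \<longleftrightarrow> u \<in> code ` (below c \<gamma> - {?top})" if "\<gamma> \<in> {K<..<L}" for \<gamma> u
      unfolding code_eq by (rule h_ran[OF that])
    show "y \<in> const_graph ` elts (Rep_vord K)" if "opair y u \<in> elts (h \<gamma>)" for \<gamma> y u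
      using that unfolding h by auto
    show "u = u'" if "opair y u \<in> elts (h \<gamma>)" "opair y u' \<in> elts (h \<gamma>)" for \<gamma> y u u'
      using that unfolding h_iff by (auto simp: const_graph_inject Rep_vord_inject)
  qed
  then show ?thesis by blast
qed

context coded_forcing
begin

abbreviation "C \<equiv> conditions c"

abbreviation "P \<equiv> forcing_of code C extends"

lemma top_C: "({}, {}) \<in> C"
  using empty_condition below_conditions by blast

lemmas conds_P = conds_forcing_of[OF code_inj code_small, of extends]
lemmas fle_P = fle_forcing_of[OF code_inj code_small]
lemmas compat_P = compat_forcing_of[OF code_inj code_small]

lemma forcing_notion_P: "forcing_notion P"
  using top_C extends_refl extends_trans by (intro forcing_notion_forcing_of[OF code_inj code_small]) blast+

lemma lattice_forcing_P: "lattice_forcing (Rep_vord K) P"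
  unfolding lattice_forcing_def
proof (intro allI impI)
  fix T assume T: "T \<subseteq> conds P \<and> T \<prec> elts (Rep_vord K) \<and> (\<forall>p\<in>T. \<forall>q\<in>T. compat P p q)"
  define X where "X = {p \<in> C. code p \<in> T}"
  have TX: "T = code ` X" using T unfolding X_def conds_P by auto
  have "X \<approx> T"
    unfolding TX using inj_on_image_eqpoll_self[OF inj_on_subset[OF code_inj], of X] eqpoll_sym
    unfolding X_def by blast
  moreover have "small T" using T lesspoll_elts_Rep by blast
  ultimately have "small X" by (rule eq_lesspoll_trans)
  moreover have "X \<subseteq> C" unfolding X_def by blast
  moreover have "\<exists>r\<in>C. extends r p \<and> extends r q" if "p \<in> X" "q \<in> X" for p q
    using T that compat_P[of p q extends] unfolding X_def by blast
  ultimately have m: "merge X \<in> C" by (intro merge_conditions)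
  have "greatest_lower_bound P T (code (merge X))"
    unfolding greatest_lower_bound_def conds_P
  proof (intro conjI ballI impI)
    show "code (merge X) \<in> code ` C" using m by blast
    show "fle P (code (merge X)) s" if "s \<in> T" for s
      using that fle_P[OF m] merge_glb(1)[of _ X] \<open>X \<subseteq> C\<close> unfolding TX by blast
    fix g assume g: "g \<in> code ` C" "\<forall>s\<in>T. fle P g s"
    then obtain r where r: "r \<in> C" "g = code r" by blast
    have "extends r p" if "p \<in> X" for p
      using g(2) that fle_P[OF r(1), of p extends] \<open>X \<subseteq> C\<close> unfolding TX r(2) by blast
    then show "fle P g (code (merge X))"
      unfolding r(2) fle_P[OF r(1) m] by (rule merge_glb(2))
  qed
  then show "\<exists>g. greatest_lower_bound P T g" by blast
qed

text \<open>These are the sets of size \<kappa> that will witness stationarity.\<close>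

definition node :: "'v vord \<Rightarrow> 'v"
  where "node \<gamma> = vset (code ` below c \<gamma>)"

lemma elts_node: "elts (node \<gamma>) = code ` below c \<gamma>"
  unfolding node_def by (intro elts_vset vsmall_subset[OF code_small] image_mono below_conditions)

lemma code_node_iff: "p \<in> C \<Longrightarrow> code p \<in> elts (node \<gamma>) \<longleftrightarrow> p \<in> below c \<gamma>"
  unfolding elts_node using code_inj below_conditions[of c \<gamma>] by (auto dest: inj_onD)

lemma elts_node_iff:
  assumes "\<gamma> \<in> {K<..<L}"
  shows "u \<in> elts (node \<gamma>) \<longleftrightarrow> u = code ({}, {}) \<or> (\<exists>y. opair y u \<in> elts (h \<gamma>))"
  unfolding h_range[OF assms] elts_node using empty_condition[of c \<gamma>] by blast

lemma node_eqpoll: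
  assumes "\<gamma> \<in> {K<..<L}"
  shows "elts (node \<gamma>) \<approx> elts (Rep_vord K)"
proof -
  have "below c \<gamma> \<approx> {..<K}"
  proof (rule lepoll_antisym)
    show "below c \<gamma> \<lesssim> {..<K}" using assms by (intro below_lepoll[OF c]) auto
    have "{..<K} \<lesssim> below c \<gamma> - {({}, {})}" using assms by (intro lepoll_below[OF c]) auto
    then show "{..<K} \<lesssim> below c \<gamma>" by (rule lepoll_trans[OF _ subset_imp_lepoll]) blast
  qed
  moreover have "elts (node \<gamma>) \<approx> below c \<gamma>"
    unfolding elts_node by (rule inj_on_image_eqpoll_self[OF inj_on_subset[OF code_inj below_conditions]])
  ultimately show ?thesis
    using eqpoll_trans[OF _ eqpoll_sym[OF elts_Rep_eqpoll]] eqpoll_trans by blast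
qed

text \<open>Phrased by pairs, in the shape of \<open>closed_fm\<close>, so that it reflects
  literally.\<close>

definition closed_node :: "'v \<Rightarrow> 'v vord \<Rightarrow> bool"
  where "closed_node F \<gamma> \<longleftrightarrow>
    (\<forall>a y. opair a y \<in> elts F \<longrightarrow> elts a \<subseteq> elts (node \<gamma>) \<longrightarrow> y \<in> elts (node \<gamma>))"

text \<open>Makes the top definable from the order; it rests on the antisymmetry of
  inclusion.\<close>

lemma top_unique:
  assumes "t \<in> code ` C" "\<And>u. u \<in> code ` C \<Longrightarrow> fle P u t"
  shows "t = code ({}, {})"
proof -
  obtain r where r: "r \<in> C" "t = code r" using assms(1) by blast
  have "extends ({}, {}) r" using assms(2)[of "code ({}, {})"] fle_P[OF top_C r(1)] top_C r(2) by blast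
  then show ?thesis unfolding r(2) extends_def by (cases r) simp
qed

section \<open>A single closed elementary submodel\<close>

context
  fixes \<theta> M :: 'v
  assumes M_closed: "closed_model (Rep_vord K) M"
    and M_elem: "elementary_submodel (elts M) (H \<theta>)"
    and M_size: "elts M \<approx> elts (Rep_vord K)"
    and P_M: "P \<in> elts M"
begin

lemma M_H: "elts M \<subseteq> H \<theta>"
  using M_elem unfolding elementary_submodel_def by blast

lemma sat_M_H: "range s \<subseteq> elts M \<Longrightarrow> sat (elts M) s \<phi> \<longleftrightarrow> sat (H \<theta>) s \<phi>"
  using M_elem unfolding elementary_submodel_def by blast

lemma M_funs: "\<lbrakk>\<alpha> < K; g ` elts (Rep_vord \<alpha>) \<subseteq> elts M\<rbrakk> \<Longrightarrow> graph g (Rep_vord \<alpha>) \<in> elts M"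
  using M_closed unfolding closed_model_def funs_eq less_vord_def by blast

text \<open>The empty set is the sequence of length zero.\<close>

lemma empty_M: "vset {} \<in> elts M"
proof -
  obtain \<alpha> and g :: "'v vord \<Rightarrow> 'v" where "\<alpha> < K" "g ` {..<\<alpha>} = {}"
    using lesspoll_enumeration[OF small_finite[OF finite.emptyI]] by (elim exE conjE) (rule that)
  then have "elts (Rep_vord \<alpha>) = {}" using Rep_image_lessThan[of \<alpha>] by auto
  moreover from this have "elts (graph undefined (Rep_vord \<alpha>)) = elts (vset {})"
    unfolding elts_graph by (simp add: elts_vset)
  ultimately show ?thesis using M_funs[OF \<open>\<alpha> < K\<close>, of undefined] unfolding elts_inject by auto
qed

lemma const_graph_M: "x \<in> elts (Rep_vord K) \<Longrightarrow> const_graph x \<in> elts M"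
  unfolding Rep_image_lessThan[symmetric] const_graph_def using empty_M by (auto intro!: M_funs)

text \<open>Closure yields an enumeration of X rather than X itself, so formulas mention X as a
  range.\<close>

lemma small_range_M:
  assumes "X \<subseteq> elts M" "small X"
  shows "\<exists>f\<in>elts M. \<forall>y. (\<exists>i. opair i y \<in> elts f) \<longleftrightarrow> y \<in> X"
proof -
  obtain \<alpha> g where \<alpha>: "\<alpha> < K" "g ` {..<\<alpha>} = X" using lesspoll_enumeration[OF assms(2)] by blast
  define G where "G u = g (Abs_vord u)" for u
  have G: "G ` elts (Rep_vord \<alpha>) = X"
    unfolding Rep_image_lessThan[symmetric] \<alpha>(2)[symmetric] G_def image_image Rep_vord_inverse ..
  then have "graph G (Rep_vord \<alpha>) \<in> elts M" using assms(1) by (intro M_funs \<alpha>(1)) simp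
  moreover have "(\<exists>i. opair i y \<in> elts (graph G (Rep_vord \<alpha>))) \<longleftrightarrow> y \<in> X" for y
    using G by auto
  ultimately show ?thesis by blast
qed

text \<open>All witnesses of \<open>closed_set_fm\<close> lie in \<open>H \<theta>\<close>, so
  elementarity gives witnesses in M. They are decoded in turn: the pair determines conditions and
  order, the order its top, and a member of the top is some \<open>h \<gamma>'\<close>, whose range
  determines the node.\<close>

lemma reflect:
  assumes F: "F \<in> elts M" and f: "f \<in> elts M"
    and \<gamma>: "\<gamma> \<in> {K<..<L}" "\<And>i y. opair i y \<in> elts f \<Longrightarrow> y \<in> elts (node \<gamma>)" "closed_node F \<gamma>"
  shows "\<exists>\<gamma>\<in>{K<..<L}. node \<gamma> \<in> elts M \<and> h \<gamma> \<in> elts M \<and> code ({}, {}) \<in> elts M \<and>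
    (\<exists>x\<in>C. code x \<in> elts M \<and> x \<notin> below c \<gamma>) \<and>
    (\<forall>i y. opair i y \<in> elts f \<longrightarrow> y \<in> elts (node \<gamma>)) \<and> closed_node F \<gamma>"
proof -
  let ?A = "vfst P" and ?R = "vsnd P" and ?t = "code ({}, {})"
  have P_eq: "P = opair ?A ?R" unfolding forcing_of_def by simp
  have A: "elts ?A = code ` C" by (rule conds_P)
  have HP: "P \<in> H \<theta>" using P_M M_H by blast
  then have AR: "?A \<in> H \<theta>" "?R \<in> H \<theta>" using opair_mem_transitive[OF H_transitive] P_eq by metis+
  have tA: "?t \<in> elts ?A" unfolding A using top_C by blast
  then have tH: "?t \<in> H \<theta>" using mem_transitiveD[OF H_transitive AR(1)] by blast
  have ht: "h \<gamma> \<in> elts ?t" unfolding top_elts using \<gamma>(1) by blast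
  then have hH: "h \<gamma> \<in> H \<theta>" using mem_transitiveD[OF H_transitive tH] by blast
  \<comment> \<open>\<open>node \<gamma>\<close> is not in the transitive closure of
    \<open>P\<close>, but it is a subset of the set of conditions.\<close>
  have NH: "node \<gamma> \<in> H \<theta>"
    by (rule H_subset[OF AR(1)]) (use below_conditions in \<open>auto simp: elts_node A\<close>)
  define x where "x = ({\<gamma>}, {} :: 'v vord set set)"
  have xC: "x \<in> C" unfolding x_def using \<gamma>(1) by (intro conditionsI) (auto simp: small_finite)
  have xN: "x \<notin> below c \<gamma>" unfolding below_def x_def by auto
  have xA: "code x \<in> elts ?A" unfolding A using xC by blast
  then have xH: "code x \<in> H \<theta>" using mem_transitiveD[OF H_transitive AR(1)] by blast
  define s where "s n = (if n = 0 then P else if n = 1 then F else f)" for n :: nat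
  have s: "range s \<subseteq> elts M" unfolding s_def using P_M F f by auto
  define s1 where "s1 = s(3 := ?A, 4 := ?R, 5 := ?t, 6 := h \<gamma>, 7 := node \<gamma>, 8 := code x)"
  have s1: "assigns (H \<theta>) s1"
    unfolding s1_def using s M_H AR tH hH NH xH
    by (intro assigns_upd) (auto simp: assigns_def H_transitive)
  have "sat (H \<theta>) s1 closed_set_fm"
    unfolding sat_closed_set_fm[OF s1]
  proof (intro conjI allI impI ballI)
    show "s1 0 = opair (s1 3) (s1 4)" unfolding s1_def s_def using P_eq by simp
    show "s1 5 \<in> elts (s1 3)" unfolding s1_def using tA by simp
    show "opair u (s1 5) \<in> elts (s1 4)" if u: "u \<in> elts (s1 3)" for u
    proof -
      obtain r where "r \<in> C" "u = code r" using u unfolding s1_def by (auto simp: A)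
      then have "fle P u ?t" using fle_P[OF _ top_C, of r extends] unfolding extends_def by simp
      then show ?thesis unfolding fle_def s1_def by simp
    qed
    show "s1 6 \<in> elts (s1 5)" unfolding s1_def using ht by simp
    show "u \<in> elts (s1 7) \<longleftrightarrow> u = s1 5 \<or> (\<exists>y. opair y u \<in> elts (s1 6))" for u
      unfolding s1_def using elts_node_iff[OF \<gamma>(1), of u] by simp
    show "s1 8 \<in> elts (s1 3)" unfolding s1_def using xA by simp
    show "s1 8 \<notin> elts (s1 7)" unfolding s1_def using xN code_node_iff[OF xC] by simp
    show "y \<in> elts (s1 7)" if "opair i y \<in> elts (s1 2)" for i y
      using that \<gamma>(2) unfolding s1_def s_def by simp
    show "y \<in> elts (s1 7)" if "opair a y \<in> elts (s1 1)" "elts a \<subseteq> elts (s1 7)" for a y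
      using that \<gamma>(3) unfolding s1_def s_def closed_node_def by simp
  qed
  then have "sat (H \<theta>) s (Exists 3 (Exists 4 (Exists 5 (Exists 6 (Exists 7 (Exists 8 closed_set_fm))))))"
    unfolding s1_def sat.simps
    by - (intro bexI, assumption, rule xH, rule NH, rule hH, rule tH, rule AR(2), rule AR(1))
  then have "sat (elts M) s (Exists 3 (Exists 4 (Exists 5 (Exists 6 (Exists 7 (Exists 8 closed_set_fm))))))"
    unfolding sat_M_H[OF s] .
  then obtain A' R' t' h' N' x' where
    sat: "sat (elts M) (s(3 := A', 4 := R', 5 := t', 6 := h', 7 := N', 8 := x')) closed_set_fm"
    and M': "A' \<in> elts M" "R' \<in> elts M" "t' \<in> elts M" "h' \<in> elts M" "N' \<in> elts M" "x' \<in> elts M"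
    unfolding sat.simps by (elim bexE) (rule that)
  define s2 where "s2 = s(3 := A', 4 := R', 5 := t', 6 := h', 7 := N', 8 := x')"
  have s2M: "range s2 \<subseteq> elts M" unfolding s2_def using s M' by auto
  then have s2: "assigns (H \<theta>) s2" using M_H H_transitive unfolding assigns_def by blast
  have s2_simps: "s2 0 = P" "s2 1 = F" "s2 2 = f" "s2 3 = A'" "s2 4 = R'" "s2 5 = t'" "s2 6 = h'" "s2 7 = N'" "s2 8 = x'"
    unfolding s2_def s_def by simp_all
  have "sat (H \<theta>) s2 closed_set_fm" using sat sat_M_H[OF s2M] unfolding s2_def by blast
  then have "P = opair A' R'" "t' \<in> elts A'" "\<forall>u\<in>elts A'. opair u t' \<in> elts R'" "h' \<in> elts t'"
    and N': "\<forall>u. u \<in> elts N' \<longleftrightarrow> u = t' \<or> (\<exists>y. opair y u \<in> elts h')"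
    and x': "x' \<in> elts A'" "x' \<notin> elts N'"
    and fN: "\<forall>i y. opair i y \<in> elts f \<longrightarrow> y \<in> elts N'"
    and FN: "\<forall>a y. opair a y \<in> elts F \<longrightarrow> elts a \<subseteq> elts N' \<longrightarrow> y \<in> elts N'"
    unfolding sat_closed_set_fm[OF s2] s2_simps by blast+
  have AR': "A' = ?A" "R' = ?R" using \<open>P = opair A' R'\<close> P_eq by (metis opair_inject)+
  have t': "t' = ?t"
  proof (rule top_unique)
    show "t' \<in> code ` C" using \<open>t' \<in> elts A'\<close> unfolding AR' A .
    show "fle P u t'" if "u \<in> code ` C" for u
      using \<open>\<forall>u\<in>elts A'. opair u t' \<in> elts R'\<close> that unfolding AR' A fle_def by blast
  qed
  then obtain \<gamma>' where \<gamma>': "\<gamma>' \<in> {K<..<L}" "h' = h \<gamma>'" using \<open>h' \<in> elts t'\<close> top_elts by blast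
  have "elts N' = elts (node \<gamma>')" using N' elts_node_iff[OF \<gamma>'(1)] unfolding t' \<gamma>'(2) by blast
  then have N'_eq: "N' = node \<gamma>'" unfolding elts_inject .
  obtain r where r: "r \<in> C" "x' = code r" using x'(1) unfolding AR' A by blast
  have "r \<notin> below c \<gamma>'" using x'(2) code_node_iff[OF r(1)] unfolding N'_eq r(2) by blast
  then have "\<exists>x\<in>C. code x \<in> elts M \<and> x \<notin> below c \<gamma>'" using r M'(6) by blast
  moreover have "closed_node F \<gamma>'" using FN unfolding N'_eq closed_node_def by blast
  moreover have "\<forall>i y. opair i y \<in> elts f \<longrightarrow> y \<in> elts (node \<gamma>')" using fN unfolding N'_eq .
  ultimately show ?thesis using \<gamma>' M' unfolding N'_eq t' by blast
qed

lemma h_value_M: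
  assumes "g \<in> elts M" "y \<in> elts M" "opair y u \<in> elts g"
  shows "\<exists>u\<in>elts M. opair y u \<in> elts g"
proof -
  let ?fm = "Exists 2 (Exists 3 (Conj (Mem 3 0) (Pair_fm 3 1 2)))"
  define s where "s n = (if n = 0 then g else y)" for n :: nat
  have s: "range s \<subseteq> elts M" unfolding s_def using assms by auto
  have asg: "assigns (H \<theta>) s'" if "range s' \<subseteq> elts M" for s'
    using that M_H H_transitive unfolding assigns_def by blast
  have gH: "g \<in> H \<theta>" using assms(1) M_H by blast
  have uH: "opair y u \<in> H \<theta>" using mem_transitiveD[OF H_transitive gH assms(3)] .
  then have "u \<in> H \<theta>" using opair_mem_transitive[OF H_transitive] by blast
  then have "sat (H \<theta>) (s(2 := u, 3 := opair y u)) (Conj (Mem 3 0) (Pair_fm 3 1 2))"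
    using sat_Pair_fm'[OF assigns_upd[OF assigns_upd[OF asg[OF s]] uH], of u 1 2 3 2 3] assms(3)
    by (simp add: s_def)
  then have "sat (H \<theta>) s ?fm" unfolding sat.simps using uH \<open>u \<in> H \<theta>\<close> by blast
  then have "sat (elts M) s ?fm" unfolding sat_M_H[OF s] .
  then obtain v z where v: "v \<in> elts M" "z \<in> elts M" "sat (elts M) (s(2 := v, 3 := z)) (Conj (Mem 3 0) (Pair_fm 3 1 2))"
    unfolding sat.simps by blast
  have s2: "range (s(2 := v, 3 := z)) \<subseteq> elts M" using s v(1,2) by auto
  then have "sat (H \<theta>) (s(2 := v, 3 := z)) (Conj (Mem 3 0) (Pair_fm 3 1 2))"
    using sat_M_H v(3) by blast
  then have "opair y v \<in> elts g" using sat_Pair_fm'[OF asg[OF s2], of 1 2 3] by (simp add: s_def)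
  then show ?thesis using v(1) by blast
qed

text \<open>The indices of \<open>h \<gamma>\<close> are in M by closure, and by elementarity so is
  the unique value at each index.\<close>

lemma node_subset_M:
  assumes \<gamma>: "\<gamma> \<in> {K<..<L}" and M: "h \<gamma> \<in> elts M" "code ({}, {}) \<in> elts M"
  shows "elts (node \<gamma>) \<subseteq> elts M"
proof
  fix u assume "u \<in> elts (node \<gamma>)"
  then consider "u = code ({}, {})" | y where "opair y u \<in> elts (h \<gamma>)"
    unfolding elts_node_iff[OF \<gamma>] by blast
  then show "u \<in> elts M"
  proof cases
    case 2
    then have "y \<in> elts M" using h_dom[OF \<gamma>] const_graph_M by blast
    then obtain v where "v \<in> elts M" "opair y v \<in> elts (h \<gamma>)" using h_value_M[OF M(1) _ 2] by blast
    then show ?thesis using h_fun[OF \<gamma> 2] by blast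
  qed (use M(2) in simp)
qed

definition M_conds :: "('v vord set \<times> 'v vord set set) set"
  where "M_conds = {p \<in> C. code p \<in> elts M}"

text \<open>A suitable \<gamma> exists by \<open>below_closure\<close>, and \<open>reflect\<close>
  exchanges it for one known to M. The empty \<open>F\<close> imposes no closure and serves
  \<open>height_S\<close>.\<close>

lemma closed_node_exists:
  assumes F: "F \<in> elts M" "F = vset {} \<or> F \<in> funs (finite_subsets (vfst P)) (vfst P)"
    and X: "X \<subseteq> M_conds" "small X"
  shows "\<exists>\<gamma>\<in>{K<..<L}. node \<gamma> \<in> elts M \<and> elts (node \<gamma>) \<subseteq> elts M \<and> X \<subseteq> below c \<gamma> \<and>
    closed_node F \<gamma> \<and> (\<exists>x\<in>M_conds. x \<notin> below c \<gamma>)"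
proof -
  have XC: "X \<subseteq> C" "code ` X \<subseteq> elts M" using X(1) unfolding M_conds_def by blast+
  obtain f where f: "f \<in> elts M" "\<forall>y. (\<exists>i. opair i y \<in> elts f) \<longleftrightarrow> y \<in> code ` X"
    using small_range_M[OF XC(2) small_image[OF X(2)]] by blast
  obtain G where G: "\<And>A. A \<subseteq> C \<Longrightarrow> G A \<in> C"
    "\<And>a y. opair a y \<in> elts F \<Longrightarrow> \<exists>A. A \<subseteq> C \<and> finite A \<and> elts a = code ` A \<and> y = code (G A)"
  proof (cases "F = vset {}")
    case True
    then show thesis using that[of "\<lambda>_. ({}, {})"] top_C by (simp add: elts_vset)
  next
    case False
    then obtain g where g: "F = graph g (finite_subsets (vfst P))" "g ` elts (finite_subsets (vfst P)) \<subseteq> code ` C"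
      using F(2) unfolding funs_eq conds_P by blast
    \<comment> \<open>Translates g from sets of codes to sets of conditions. Infinite A get the top
      as a default, since \<open>below_closure\<close> expects a value for every set of
      conditions.\<close>
    define G where "G A = (if finite A then inv_into C code (g (vset (code ` A))) else ({}, {}))" for A
    have fin: "vset (code ` A) \<in> elts (finite_subsets (vfst P))" "elts (vset (code ` A)) = code ` A"
      if "A \<subseteq> C" "finite A" for A
    proof -
      show *: "elts (vset (code ` A)) = code ` A"
        by (intro elts_vset vsmall_subset[OF code_small] image_mono that(1))
      show "vset (code ` A) \<in> elts (finite_subsets (vfst P))"
        unfolding elts_finite_subsets conds_P mem_Collect_eq * using that by blast
    qed
    show thesis
    proof (rule that[of G])
      show "G A \<in> C" if "A \<subseteq> C" for A
      proof (cases "finite A")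
        case True
        then have "g (vset (code ` A)) \<in> code ` C" using fin(1)[OF that] g(2) by blast
        then show ?thesis unfolding G_def using True inv_into_into[of _ code C] by simp
      qed (simp add: G_def top_C)
      fix a y assume "opair a y \<in> elts F"
      then have a: "elts a \<subseteq> code ` C" "finite (elts a)" "y = g a" "g a \<in> code ` C"
        using g unfolding g(1) by (auto simp: elts_finite_subsets conds_P)
      obtain A where A: "A \<subseteq> C" "elts a = code ` A" using a(1) unfolding subset_image_iff by blast
      then have "finite A" using a(2) finite_imageD inj_on_subset[OF code_inj] by metis
      moreover have "a = vset (code ` A)" using A(2) by (metis vset_elts)
      ultimately have "y = code (G A)" unfolding G_def using a(3,4) by (simp add: f_inv_into_f)
      then show "\<exists>A. A \<subseteq> C \<and> finite A \<and> elts a = code ` A \<and> y = code (G A)"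
        using A \<open>finite A\<close> by blast
    qed
  qed
  have "\<exists>\<gamma>\<in>S. K < \<gamma> \<and> X \<subseteq> below c \<gamma> \<and> (\<forall>A. A \<subseteq> below c \<gamma> \<and> finite A \<longrightarrow> G A \<in> below c \<gamma>)"
    by (rule below_closure[OF c G(1) XC(1) lesspoll_imp_lepoll[OF X(2)]])
  then obtain \<gamma> where \<gamma>: "\<gamma> \<in> S" "K < \<gamma>" "X \<subseteq> below c \<gamma>" "\<forall>A. A \<subseteq> below c \<gamma> \<and> finite A \<longrightarrow> G A \<in> below c \<gamma>"
    by blast
  have \<gamma>KL: "\<gamma> \<in> {K<..<L}" using \<gamma>(2) S_less[OF \<gamma>(1)] by simp
  have "y \<in> elts (node \<gamma>)" if "opair i y \<in> elts f" for i y
    using that f(2) \<gamma>(3) unfolding elts_node by blast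
  moreover have "closed_node F \<gamma>"
    unfolding closed_node_def
  proof (intro allI impI)
    fix a y assume ay: "opair a y \<in> elts F" and sub: "elts a \<subseteq> elts (node \<gamma>)"
    obtain A where A: "A \<subseteq> C" "finite A" "elts a = code ` A" "y = code (G A)"
      using G(2)[OF ay] by (elim exE conjE) (rule that)
    have "A \<subseteq> below c \<gamma>" using sub A(1) code_node_iff unfolding A(3) by blast
    then show "y \<in> elts (node \<gamma>)" unfolding A(4) elts_node using \<gamma>(4) A(2) by blast
  qed
  ultimately obtain \<gamma>' where \<gamma>': "\<gamma>' \<in> {K<..<L}" "node \<gamma>' \<in> elts M" "h \<gamma>' \<in> elts M" "code ({}, {}) \<in> elts M"
    "\<exists>x\<in>C. code x \<in> elts M \<and> x \<notin> below c \<gamma>'" "\<forall>i y. opair i y \<in> elts f \<longrightarrow> y \<in> elts (node \<gamma>')" "closed_node F \<gamma>'"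
    using reflect[OF F(1) f(1) \<gamma>KL] by blast
  have "X \<subseteq> below c \<gamma>'"
  proof
    fix p assume p: "p \<in> X"
    then have "code p \<in> elts (node \<gamma>')" using \<gamma>'(6) f(2) by blast
    then show "p \<in> below c \<gamma>'" using code_node_iff XC(1) p by blast
  qed
  moreover have "\<exists>x\<in>M_conds. x \<notin> below c \<gamma>'" using \<gamma>'(5) unfolding M_conds_def by blast
  ultimately show ?thesis using \<gamma>' node_subset_M by blast
qed

text \<open>Stands in for the supremum of M below \<open>\<kappa>\<^sup>+\<close>, measured by the
  conditions in M because ordinals are not known to be elements of M.\<close>

definition height :: "'v vord"
  where "height = (LEAST \<delta>. \<forall>p\<in>M_conds. \<exists>\<gamma><\<delta>. p \<in> below c \<gamma>)"

lemma height_bound: "height < L" "\<And>p. p \<in> M_conds \<Longrightarrow> \<exists>\<gamma><height. p \<in> below c \<gamma>"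
proof -
  have "M_conds \<subseteq> C" unfolding M_conds_def by blast
  then have "\<forall>p\<in>M_conds. \<exists>\<gamma><L. p \<in> below c \<gamma>" using condition_below[OF c] by blast
  then obtain k where k: "\<And>p. p \<in> M_conds \<Longrightarrow> k p < L \<and> p \<in> below c (k p)" by metis
  have "code ` M_conds \<subseteq> elts M" unfolding M_conds_def by blast
  then have "code ` M_conds \<lesssim> {..<K}"
    using lepoll_trans[OF subset_imp_lepoll eqpoll_imp_lepoll[OF M_size]] lepoll_elts_Rep by blast
  then have "M_conds \<lesssim> {..<K}"
    using inj_on_image_lepoll_1[OF inj_on_subset[OF code_inj \<open>M_conds \<subseteq> C\<close>]] by blast
  then have "k ` M_conds \<lesssim> {..<K}" by (rule lepoll_trans[OF image_lepoll])
  moreover have "k ` M_conds \<subseteq> {..<L}" using k by blast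
  ultimately obtain b where b: "b < L" "k ` M_conds \<subseteq> {..<b}" using L_regular by blast
  then have b': "\<forall>p\<in>M_conds. \<exists>\<gamma><b. p \<in> below c \<gamma>" using k by blast
  then have "\<forall>p\<in>M_conds. \<exists>\<gamma><height. p \<in> below c \<gamma>" unfolding height_def by (rule LeastI)
  then show "\<And>p. p \<in> M_conds \<Longrightarrow> \<exists>\<gamma><height. p \<in> below c \<gamma>" by blast
  have "height \<le> b" unfolding height_def using b' by (rule Least_le)
  then show "height < L" using b(1) by simp
qed

lemma height_cofinal:
  assumes "b < height"
  shows "\<exists>p\<in>M_conds. \<forall>\<gamma>. p \<in> below c \<gamma> \<longrightarrow> b \<le> \<gamma>"
proof -
  have "\<not> (\<forall>p\<in>M_conds. \<exists>\<gamma><b. p \<in> below c \<gamma>)"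
    using not_less_Least[of b] assms unfolding height_def by blast
  then show ?thesis by (auto simp: not_less)
qed

lemma below_height:
  assumes "x \<in> M_conds" "x \<notin> below c \<gamma>"
  shows "\<exists>b<height. \<gamma> < b"
proof -
  obtain b where b: "b < height" "x \<in> below c b" using height_bound(2)[OF assms(1)] by blast
  then have "\<gamma> < b" using assms(2) below_mono[of b \<gamma> c] by (meson not_le subsetD)
  then show ?thesis using b(1) by blast
qed

text \<open>Given a small Y, fewer than K conditions of M reach the ordinals in Y. M has a node
  containing all of them and a condition outside that node, so its level bounds Y and lies below
  \<open>height\<close>.\<close>

lemma height_S: "height \<in> S"
  unfolding S_def
proof (intro CollectI conjI allI impI height_bound(1))
  fix Y assume Y: "Y \<subseteq> {..<height} \<and> small Y"
  then have "\<forall>y\<in>Y. \<exists>p\<in>M_conds. \<forall>\<gamma>. p \<in> below c \<gamma> \<longrightarrow> y \<le> \<gamma>" using height_cofinal by auto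
  then obtain k where k: "\<And>y. y \<in> Y \<Longrightarrow> k y \<in> M_conds \<and> (\<forall>\<gamma>. k y \<in> below c \<gamma> \<longrightarrow> y \<le> \<gamma>)" by metis
  have "k ` Y \<subseteq> M_conds" "small (k ` Y)" using k Y small_image by blast+
  from closed_node_exists[OF empty_M _ this] obtain \<gamma> x where
    \<gamma>: "k ` Y \<subseteq> below c \<gamma>" "x \<in> M_conds" "x \<notin> below c \<gamma>" by blast
  obtain b where b: "b < height" "\<gamma> < b" using below_height[OF \<gamma>(2,3)] by blast
  have "Y \<subseteq> {..<b}"
  proof
    fix y assume "y \<in> Y"
    then have "y \<le> \<gamma>" using k \<gamma>(1) by blast
    then show "y \<in> {..<b}" using b(2) by simp
  qed
  then show "\<exists>b<height. Y \<subseteq> {..<b}" using b(1) by blast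
qed

lemma projection_stationary:
  assumes q: "q \<in> C" "height \<in> fst q"
  shows "M_stationary M (Rep_vord K) (vfst P) (projection_sets (Rep_vord K) P M (code q))"
  unfolding M_stationary_def
proof (intro conjI ballI)
  show "projection_sets (Rep_vord K) P M (code q) \<subseteq> subsets_of_size (conds P) (Rep_vord K)"
    unfolding projection_sets_def subsets_of_size_def by blast
  fix F assume F: "F \<in> funs (finite_subsets (vfst P)) (vfst P) \<inter> elts M"
  obtain \<beta> where \<beta>: "\<beta> < height" "\<And>\<gamma>. \<beta> \<le> \<gamma> \<and> \<gamma> < height \<Longrightarrow>
    \<exists>w\<in>below c \<gamma>. \<forall>r\<in>below c \<gamma>. extends r w \<longrightarrow> (\<exists>s\<in>C. extends s r \<and> extends s q)"
    using reduction[OF c height_S q] by blast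
  \<comment> \<open>Demanding that the node contain p forces its level up to at least \<beta>, where
    \<open>reduction\<close> applies.\<close>
  obtain p where p: "p \<in> M_conds" "\<And>\<gamma>. p \<in> below c \<gamma> \<Longrightarrow> \<beta> \<le> \<gamma>"
    using height_cofinal[OF \<beta>(1)] by blast
  have "{p} \<subseteq> M_conds" "small {p}" using p(1) by (simp_all add: small_finite)
  from closed_node_exists[OF _ _ this, of F] F obtain \<gamma> x where
    \<gamma>: "\<gamma> \<in> {K<..<L}" "node \<gamma> \<in> elts M" "elts (node \<gamma>) \<subseteq> elts M" "p \<in> below c \<gamma>" "closed_node F \<gamma>"
    and x: "x \<in> M_conds" "x \<notin> below c \<gamma>" by blast
  have "\<gamma> < height" using below_height[OF x] less_trans by blast
  then obtain w where w: "w \<in> below c \<gamma>"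
    "\<And>r. \<lbrakk>r \<in> below c \<gamma>; extends r w\<rbrakk> \<Longrightarrow> \<exists>s\<in>C. extends s r \<and> extends s q"
    using \<beta>(2)[of \<gamma>] p(2)[OF \<gamma>(4)] by blast
  have wC: "w \<in> C" using w(1) below_conditions by blast
  have node_C: "elts (node \<gamma>) \<subseteq> code ` C" unfolding elts_node using below_conditions by blast
  have "node \<gamma> \<in> projection_sets (Rep_vord K) P M (code q)"
    unfolding projection_sets_def subsets_of_size_def mem_Collect_eq conds_P
  proof (intro conjI)
    show "elts (node \<gamma>) \<subseteq> code ` C \<inter> elts M" using node_C \<gamma>(3) by blast
    show "elts (node \<gamma>) \<approx> elts (Rep_vord K)" by (rule node_eqpoll[OF \<gamma>(1)])
    have "compat P r (code q)" if r: "r \<in> elts (node \<gamma>)" "fle P r (code w)" for r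
    proof -
      obtain r' where r': "r' \<in> below c \<gamma>" "r = code r'" using r(1) unfolding elts_node by blast
      then have "r' \<in> C" using below_conditions by blast
      then have "extends r' w" using r(2) fle_P[OF _ wC] unfolding r'(2) by blast
      then show ?thesis using w(2)[OF r'(1)] compat_P[OF \<open>r' \<in> C\<close> q(1)] unfolding r'(2) by blast
    qed
    then show "\<exists>w\<in>code ` C \<inter> elts (node \<gamma>). \<forall>r\<in>elts (node \<gamma>). fle P r w \<longrightarrow> compat P r (code q)"
      using wC w(1) unfolding elts_node by blast
  qed
  moreover have "app F ` elts (finite_subsets (node \<gamma>)) \<subseteq> elts (node \<gamma>)"
  proof -
    obtain g where g: "F = graph g (finite_subsets (vfst P))" using F unfolding funs_eq by blast
    have "app F a \<in> elts (node \<gamma>)" if a: "a \<in> elts (finite_subsets (node \<gamma>))" for a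
    proof -
      have a': "elts a \<subseteq> elts (node \<gamma>)" "a \<in> elts (finite_subsets (vfst P))"
        using a node_C by (auto simp: elts_finite_subsets conds_P)
      then have "opair a (app F a) \<in> elts F" unfolding g by (simp add: app_graph)
      then show ?thesis using \<gamma>(5) a'(1) unfolding closed_node_def by blast
    qed
    then show ?thesis by blast
  qed
  ultimately show "\<exists>N\<in>projection_sets (Rep_vord K) P M (code q) \<inter> elts M.
    app F ` elts (finite_subsets N) \<subseteq> elts N" using \<gamma>(2) by blast
qed

lemma strongly_generic_extension:
  assumes p: "p \<in> conds P \<inter> elts M"
  shows "\<exists>q\<in>conds P. fle P q p \<and> (\<forall>q'\<in>conds P. fle P q' q \<longrightarrow>
    M_stationary M (Rep_vord K) (vfst P) (projection_sets (Rep_vord K) P M q'))"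
proof -
  obtain r where r: "r \<in> C" "p = code r" using p unfolding conds_P by blast
  then have "r \<in> M_conds" using p unfolding M_conds_def by blast
  then obtain \<gamma> where "\<gamma> < height" "r \<in> below c \<gamma>" using height_bound(2) by blast
  then have rb: "r \<in> below c height" using below_mono[OF less_imp_le] by blast
  define s where "s = (insert height (fst r), snd r)"
  have s: "s \<in> C" unfolding s_def by (rule insert_point[OF c height_S rb])
  have "extends s r" unfolding s_def extends_def by auto
  then have "fle P (code s) p" unfolding r(2) fle_P[OF s r(1)] .
  moreover have "M_stationary M (Rep_vord K) (vfst P) (projection_sets (Rep_vord K) P M q')"
    if q': "q' \<in> conds P" "fle P q' (code s)" for q'
  proof -
    obtain u where u: "u \<in> C" "q' = code u" using q'(1) unfolding conds_P by blast
    then have "extends u s" using q'(2) fle_P[OF u(1) s] by blast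
    then have "height \<in> fst u" unfolding extends_def s_def by auto
    then show ?thesis unfolding u(2) by (rule projection_stationary[OF u(1)])
  qed
  moreover have "code s \<in> conds P" unfolding conds_P using s by blast
  ultimately show ?thesis by blast
qed

end

lemma MRP_strongly_proper_P: "MRP_strongly_proper (Rep_vord K) P"
  unfolding MRP_strongly_proper_def
proof (intro exI conjI allI impI ballI)
  \<comment> \<open>K can be the threshold: \<open>P \<in> M \<subseteq> H \<theta>\<close> already
    places all witnesses in \<open>H \<theta>\<close>.\<close>
  show "Card (Rep_vord K)" unfolding Card_Rep using K_initial by blast
qed (elim conjE, rule strongly_generic_extension)

lemma FA_generic_set:
  assumes FA: "FA (Rep_vord L) {P. forcing_notion P \<and> lattice_forcing (Rep_vord K) P \<and> MRP_strongly_proper (Rep_vord K) P}"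
  shows "\<exists>E. E \<subseteq> {..<L} \<and> (\<forall>x<L. \<exists>y\<in>E. x < y) \<and>
      (\<forall>\<delta>\<in>S. acc E \<delta> \<longrightarrow> \<delta> \<in> E \<and> (\<exists>\<zeta><\<delta>. \<forall>x\<in>E \<inter> c \<delta>. x < \<zeta>))"
proof -
  have req: "requirement c \<alpha> \<subseteq> C" for \<alpha> unfolding requirement_def by blast
  have "dense_in P (code ` requirement c (Abs_vord \<alpha>))" if "\<alpha> \<in> elts (Rep_vord L)" for \<alpha>
    unfolding dense_in_def conds_P
  proof (intro conjI ballI)
    show "code ` requirement c (Abs_vord \<alpha>) \<subseteq> code ` C" using req by blast
    have \<alpha>: "Abs_vord \<alpha> < L" using that unfolding Rep_image_lessThan[symmetric] by (auto simp: Rep_vord_inverse)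
    fix p assume "p \<in> code ` C"
    then obtain r where r: "r \<in> C" "p = code r" by blast
    then obtain s where s: "s \<in> requirement c (Abs_vord \<alpha>)" "extends s r" using requirement_dense[OF c \<alpha>] by blast
    then have "s \<in> C" using req by blast
    then have "fle P (code s) p" unfolding r(2) using fle_P[OF _ r(1)] s(2) by blast
    then show "\<exists>d\<in>code ` requirement c (Abs_vord \<alpha>). fle P d p" using s(1) by blast
  qed
  moreover have "P \<in> {P. forcing_notion P \<and> lattice_forcing (Rep_vord K) P \<and> MRP_strongly_proper (Rep_vord K) P}"
    using forcing_notion_P lattice_forcing_P MRP_strongly_proper_P by blast
  note FA[unfolded FA_def, rule_format, OF this, of "\<lambda>\<alpha>. code ` requirement c (Abs_vord \<alpha>)"]
  ultimately obtain G where G: "filter_on P G" "\<And>\<alpha>. \<alpha> \<in> elts (Rep_vord L) \<Longrightarrow> G \<inter> code ` requirement c (Abs_vord \<alpha>) \<noteq> {}"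
    by blast
  show ?thesis
  proof (rule generic_set)
    show "{p \<in> C. code p \<in> G} \<subseteq> C" by blast
    show "\<exists>r\<in>{p \<in> C. code p \<in> G}. extends r p \<and> extends r q"
      if pq: "p \<in> {p \<in> C. code p \<in> G}" "q \<in> {p \<in> C. code p \<in> G}" for p q
    proof -
      obtain u where u: "u \<in> G" "fle P u (code p)" "fle P u (code q)"
        using G(1) pq unfolding filter_on_def by blast
      then have "u \<in> code ` C" using G(1) unfolding filter_on_def conds_P by blast
      then obtain r where r: "r \<in> C" "u = code r" by blast
      then show ?thesis using u pq fle_P[OF r(1)] unfolding r(2) by blast
    qed
    show "{p \<in> C. code p \<in> G} \<inter> requirement c \<alpha> \<noteq> {}" if "\<alpha> < L" for \<alpha>
    proof -
      have "Rep_vord \<alpha> \<in> elts (Rep_vord L)" using that unfolding less_vord_def .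
      from G(2)[OF this] show ?thesis using req unfolding Rep_vord_inverse by blast
    qed
  qed
qed

end

theorem theorem8p5:
  fixes \<kappa> :: "'v::zfc_universe"
  assumes "Card \<kappa>"
    and "elts (card_succ (omega :: 'v)) \<subseteq> elts \<kappa>"
    and "(\<Union>\<alpha>\<in>elts \<kappa>. funs \<alpha> \<kappa>) \<approx> elts \<kappa>"
  shows "\<not> FA (card_succ \<kappa>)
    {P. forcing_notion P \<and> lattice_forcing \<kappa> P \<and> MRP_strongly_proper \<kappa> P}"
proof
  assume FA: "FA (card_succ \<kappa>)
    {P. forcing_notion P \<and> lattice_forcing \<kappa> P \<and> MRP_strongly_proper \<kappa> P}"
  obtain K L where KL: "\<kappa> = Rep_vord K" "card_succ \<kappa> = Rep_vord L" "regular_successor K L"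
    using regular_successor_universe[OF assms] by blast
  interpret regular_successor K L by (rule KL(3))
  show False
  proof (rule no_avoiding_sets)
    \<comment> \<open>Each ladder system gets its own coded forcing; its generic set is what club
      guessing forbids.\<close>
    fix c assume c: "\<And>\<delta>. \<delta> \<in> S \<Longrightarrow> ladder \<delta> (c \<delta>)"
    obtain code h where "coded_forcing K L c code h"
      using coded_forcing_exists[OF KL(3) c] by blast
    then interpret coded_forcing K L c code h .
    show "\<exists>E. E \<subseteq> {..<L} \<and> (\<forall>x<L. \<exists>y\<in>E. x < y) \<and>
      (\<forall>\<delta>\<in>S. acc E \<delta> \<longrightarrow> \<delta> \<in> E \<and> (\<exists>\<zeta><\<delta>. \<forall>x\<in>E \<inter> c \<delta>. x < \<zeta>))"
      by (rule FA_generic_set) (rule FA[unfolded KL(2), unfolded KL(1)])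
  qed
qed

end
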